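(* Let $m,n\geqslant1$, let $p_1,\ldots,p_m\geqslant 1$ be integers, and let $\mathbf f_i:(\mathbb C^{m+n},0)\to(\mathbb C^n,0)$, $i=1,\ldots,m$, be germs of holomorphic maps in the variables $(x,y)$, $x=(x_1,\ldots,x_m)$, $y=(y_1,\ldots,y_n)^{\top}$. Let the system $$x_i^{p_i}\,\frac{\partial y}{\partial x_i}=\mathbf f_i(x,y),\qquad i=1,\ldots,m,$$ be not completely integrable and have a formal power series solution $\varphi\in\mathbb C[[x_1,\ldots,x_m]]^n$ (without constant term). Let $$\mathbf F_{ij}(x,y)=x_j^{p_j}\frac{\partial \mathbf f_i}{\partial x_j}-x_i^{p_i}\frac{\partial \mathbf f_j}{\partial x_i}+\frac{\partial \mathbf f_i}{\partial y}\mathbf f_j-\frac{\partial \mathbf f_j}{\partial y}\mathbf f_i,\qquad i,j=1,\ldots,m.$$ If among all the (scalar) components of the vectors $\mathbf F_{ij}(x,y)$, $i,j=1,\ldots,m$, there are $n$ non-zero components $g_1,\ldots,g_n$ such that $$\det\Bigl(\frac{\partial g_i}{\partial y_j}(x_1,\ldots,x_m,\varphi)\Bigr)_{i,j=1}^n\neq 0$$ as an element of $\mathbb C[[x_1,\ldots,x_m]]$, then $\varphi$ converges near $0\in\mathbb C^m$.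
   Context: A formal power series solution of the system is a series $\varphi=\sum_{|k|>0}\mathbf c_k x^k\in\mathbb C[[x]]^n$, with $\mathbf c_k\in\mathbb C^n$, $k\in\mathbb Z_+^m$, $|k|=k_1+\ldots+k_m$, $x^k=x_1^{k_1}\cdots x_m^{k_m}$ (so without constant term), such that $x_i^{p_i}\,\partial\varphi/\partial x_i=\mathbf f_i(x,\varphi)$ in $\mathbb C[[x]]^n$ for all $i$. Substitution of $y=\varphi$ into a holomorphic germ means formal substitution into its Taylor series at the origin. $\frac{\partial\mathbf f_i}{\partial y}$ is the $n\times n$ Jacobi matrix with respect to $y$. Complete integrability: let $D$ be a connected open neighbourhood of $0\in\mathbb C^{m+n}$ in which all $\mathbf f_i$ are holomorphic, and let $\Sigma=\{(x,y)\in D\mid x_1\cdots x_m=0\}$. The system is called completely integrable (on $D\setminus\Sigma$) if for any $(x^0,y^0)\in D\setminus\Sigma$ there exists a unique solution $y=y(x)$, holomorphic near $x^0$ (unique as a germ at $x^0$), such that $y(x^0)=y^0$. Equivalently, all the $\mathbf F_{ij}$ are identically zero. *)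

theory Defs
  imports "HOL-Analysis.Analysis"
begin

section \<open>Formal power series in finitely many variables\<close>

text \<open>
  The variables are indexed by the finite type \<open>'v\<close>, the exponents are the functions
  \<open>k :: 'v \<Rightarrow> nat\<close>, and \<open>mfps_nth a k\<close> is the coefficient of the monomial with exponent \<open>k\<close>.
\<close>

typedef ('v, 'a) mfps = "UNIV :: (('v \<Rightarrow> nat) \<Rightarrow> 'a) set"
  morphisms mfps_nth Abs_mfps by simp

lemma mfps_nth_Abs [simp]: "mfps_nth (Abs_mfps f) = f"
  by (simp add: Abs_mfps_inverse)

lemma mfps_eqI: "(\<And>k. mfps_nth a k = mfps_nth b k) \<Longrightarrow> a = b"
  by (simp add: mfps_nth_inject[symmetric] fun_eq_iff)

definition exp_splits :: "('v \<Rightarrow> nat) \<Rightarrow> (('v \<Rightarrow> nat) \<times> ('v \<Rightarrow> nat)) set" where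
  "exp_splits k = {(i, j). \<forall>v. i v + j v = k v}"

lemma finite_bounded_exponents: "finite {i :: 'v::finite \<Rightarrow> nat. \<forall>v. i v \<le> k v}"
proof -
  have "{i :: 'v \<Rightarrow> nat. \<forall>v. i v \<le> k v} = PiE UNIV (\<lambda>v. {..k v})"
    by (auto simp: PiE_def Pi_def extensional_def)
  then show ?thesis by (simp add: finite_PiE)
qed

lemma finite_exp_splits [simp]: "finite (exp_splits (k :: 'v::finite \<Rightarrow> nat))"
proof (rule finite_subset)
  show "exp_splits k \<subseteq> {i. \<forall>v. i v \<le> k v} \<times> {i. \<forall>v. i v \<le> k v}"
    by (auto simp: exp_splits_def) (metis le_add1, metis le_add2)
qed (simp add: finite_bounded_exponents)

instantiation mfps :: (finite, comm_ring_1) comm_ring_1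
begin

definition "0 = Abs_mfps (\<lambda>_. 0)"
definition "1 = Abs_mfps (\<lambda>k. if k = (\<lambda>_. 0) then 1 else 0)"
definition "a + b = Abs_mfps (\<lambda>k. mfps_nth a k + mfps_nth b k)"
definition "- a = Abs_mfps (\<lambda>k. - mfps_nth a k)"
definition "a - b = Abs_mfps (\<lambda>k. mfps_nth a k - mfps_nth b k)"
definition "a * b = Abs_mfps (\<lambda>k. \<Sum>(i, j)\<in>exp_splits k. mfps_nth a i * mfps_nth b j)"

instance
proof
  fix a b c :: "('a, 'b) mfps"
  show "a + b + c = a + (b + c)" "a + b = b + a" "0 + a = a" "- a + a = 0" "a - b = a + - b"
    by (auto intro!: mfps_eqI simp: zero_mfps_def plus_mfps_def uminus_mfps_def minus_mfps_def)
  show "(0 :: ('a, 'b) mfps) \<noteq> 1"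
    by (auto simp: zero_mfps_def one_mfps_def Abs_mfps_inject fun_eq_iff)
  show "(a + b) * c = a * c + b * c"
    by (rule mfps_eqI)
      (simp add: plus_mfps_def times_mfps_def distrib_right sum.distrib case_prod_unfold)
  show "a * b = b * a"
  proof (rule mfps_eqI)
    fix k
    show "mfps_nth (a * b) k = mfps_nth (b * a) k"
      unfolding times_mfps_def mfps_nth_Abs
      by (rule sum.reindex_bij_witness[of _ prod.swap prod.swap])
        (auto simp: exp_splits_def add.commute mult.commute)
  qed
  show "1 * a = a"
  proof (rule mfps_eqI)
    fix k
    have "mfps_nth (1 * a) k =
        (\<Sum>p\<in>exp_splits k. if p = (\<lambda>_. 0, k) then mfps_nth a k else 0)"
      unfolding times_mfps_def one_mfps_def mfps_nth_Abs
      by (rule sum.cong) (auto simp: exp_splits_def fun_eq_iff split: if_splits)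
    also have "\<dots> = mfps_nth a k"
      by (subst sum.delta, simp) (auto simp: exp_splits_def)
    finally show "mfps_nth (1 * a) k = mfps_nth a k" .
  qed
  show "a * b * c = a * (b * c)"
  proof (rule mfps_eqI)
    fix k
    have "mfps_nth (a * b * c) k =
        (\<Sum>(p, q)\<in>Sigma (exp_splits k) (\<lambda>p. exp_splits (fst p)).
            mfps_nth a (fst q) * mfps_nth b (snd q) * mfps_nth c (snd p))"
      by (simp add: times_mfps_def case_prod_unfold sum_distrib_right sum.Sigma)
    also have "\<dots> = (\<Sum>(p, q)\<in>Sigma (exp_splits k) (\<lambda>p. exp_splits (snd p)).
            mfps_nth a (fst p) * (mfps_nth b (fst q) * mfps_nth c (snd q)))"
      by (rule sum.reindex_bij_witness[of _
            "\<lambda>((i, j), (i', j')). ((\<lambda>v. i v + i' v, j'), (i, i'))"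
            "\<lambda>((i, j), (i', j')). ((i', \<lambda>v. j' v + j v), (j', j))"])
        (auto simp: exp_splits_def fun_eq_iff mult.assoc, (metis add.assoc)+)
    also have "\<dots> = mfps_nth (a * (b * c)) k"
      by (simp add: times_mfps_def case_prod_unfold sum_distrib_left sum.Sigma)
    finally show "mfps_nth (a * b * c) k = mfps_nth (a * (b * c)) k" .
  qed
qed

end

definition mfps_X :: "'v \<Rightarrow> ('v, 'a::zero_neq_one) mfps" where
  "mfps_X v = Abs_mfps (\<lambda>k. if k = (\<lambda>w. if w = v then 1 else 0) then 1 else 0)"

definition mfps_deriv :: "'v \<Rightarrow> ('v, 'a::semiring_1) mfps \<Rightarrow> ('v, 'a) mfps" where
  "mfps_deriv v a = Abs_mfps (\<lambda>k. of_nat (Suc (k v)) * mfps_nth a (k(v := Suc (k v))))"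

text \<open>
  Formal substitution of the family \<open>s\<close> into \<open>g\<close>. It is meaningful only if all \<open>s w\<close> have zero
  constant term. In that case, an exponent \<open>q\<close> whose total degree exceeds that of \<open>k\<close> does not
  contribute to the coefficient at \<open>k\<close> (lemma \<open>mfps_prod_power_nth_eq_0\<close> below), so the finite sum
  is the full one.
\<close>

definition mfps_subst ::
  "('w::finite, 'a::comm_ring_1) mfps \<Rightarrow> ('w \<Rightarrow> ('v::finite, 'a) mfps) \<Rightarrow> ('v, 'a) mfps" where
  "mfps_subst g s = Abs_mfps (\<lambda>k.
     \<Sum>q | (\<Sum>w\<in>UNIV. q w) \<le> (\<Sum>v\<in>UNIV. k v).
       mfps_nth g q * mfps_nth (\<Prod>w\<in>UNIV. s w ^ q w) k)"

lemma finite_exponents_degree_le: "finite {q :: 'w::finite \<Rightarrow> nat. (\<Sum>w\<in>UNIV. q w) \<le> d}"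
  by (rule finite_subset[OF _ finite_bounded_exponents[of "\<lambda>_. d"]])
    (auto intro: order_trans[OF member_le_sum[of _ UNIV]])

definition mfps_order_ge :: "nat \<Rightarrow> ('v::finite, 'a::zero) mfps \<Rightarrow> bool" where
  "mfps_order_ge d a \<longleftrightarrow> (\<forall>k. (\<Sum>v\<in>UNIV. k v) < d \<longrightarrow> mfps_nth a k = 0)"

lemma mfps_order_ge_mult:
  fixes a b :: "('v::finite, 'a::comm_ring_1) mfps"
  assumes "mfps_order_ge c a" "mfps_order_ge d b"
  shows "mfps_order_ge (c + d) (a * b)"
  unfolding mfps_order_ge_def
proof (intro allI impI)
  fix k :: "'v \<Rightarrow> nat"
  assume k: "(\<Sum>v\<in>UNIV. k v) < c + d"
  have "mfps_nth a i * mfps_nth b j = 0" if "(i, j) \<in> exp_splits k" for i j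
  proof -
    have "(\<Sum>v\<in>UNIV. i v) + (\<Sum>v\<in>UNIV. j v) = (\<Sum>v\<in>UNIV. k v)"
      using that by (simp add: exp_splits_def flip: sum.distrib)
    then have "(\<Sum>v\<in>UNIV. i v) < c \<or> (\<Sum>v\<in>UNIV. j v) < d" using k by linarith
    then show ?thesis using assms by (auto simp: mfps_order_ge_def)
  qed
  then show "mfps_nth (a * b) k = 0"
    by (auto simp: times_mfps_def intro!: sum.neutral)
qed

lemma mfps_prod_power_nth_eq_0:
  fixes s :: "'w::finite \<Rightarrow> ('v::finite, 'a::comm_ring_1) mfps"
  assumes s: "\<And>w. mfps_nth (s w) (\<lambda>_. 0) = 0"
    and k: "(\<Sum>v\<in>UNIV. k v) < (\<Sum>w\<in>UNIV. q w)"
  shows "mfps_nth (\<Prod>w\<in>UNIV. s w ^ q w) k = 0"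
proof -
  have 0: "mfps_order_ge 0 (1 :: ('v, 'a) mfps)" by (simp add: mfps_order_ge_def)
  have 1: "mfps_order_ge 1 (s w)" for w
  proof -
    have "k = (\<lambda>_. 0)" if "(\<Sum>v\<in>UNIV. k v) = 0" for k :: "'v \<Rightarrow> nat"
      using that by (auto simp: fun_eq_iff)
    then show ?thesis using s[of w] by (auto simp: mfps_order_ge_def)
  qed
  have pow: "mfps_order_ge n (s w ^ n)" for w n
  proof (induction n)
    case (Suc n)
    then show ?case using mfps_order_ge_mult[OF 1 Suc] by simp
  qed (use 0 in simp)
  have "mfps_order_ge (\<Sum>w\<in>W. q w) (\<Prod>w\<in>W. s w ^ q w)" for W
  proof (induction W rule: infinite_finite_induct)
    case (insert w W)
    then show ?case using mfps_order_ge_mult[OF pow insert.IH] by simp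
  qed (use 0 in simp_all)
  from this[of UNIV] k show ?thesis by (simp add: mfps_order_ge_def)
qed

definition mfps_converges_near_0 :: "('v::finite, complex) mfps \<Rightarrow> bool" where
  "mfps_converges_near_0 a \<longleftrightarrow>
     (\<forall>\<^sub>F x :: complex ^ 'v in nhds 0.
        (\<lambda>k. mfps_nth a k * (\<Prod>v\<in>UNIV. x $ v ^ k v)) summable_on UNIV)"


section \<open>Holomorphic functions of several variables\<close>

definition mholomorphic_on :: "(complex ^ 'a::finite \<Rightarrow> complex ^ 'b::finite) \<Rightarrow> (complex ^ 'a) set \<Rightarrow> bool"
  where "mholomorphic_on g D \<longleftrightarrow>
    (\<forall>z\<in>D. \<exists>L. (g has_derivative L) (at z within D) \<and> (\<forall>c v. L (c *s v) = c *s L v))"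

definition partial :: "'a::finite \<Rightarrow> (complex ^ 'a \<Rightarrow> complex) \<Rightarrow> complex ^ 'a \<Rightarrow> complex" where
  "partial a g z = deriv (\<lambda>t. g (z + axis a t)) 0"

definition vpartial ::
  "'a::finite \<Rightarrow> (complex ^ 'a \<Rightarrow> complex ^ 'b) \<Rightarrow> complex ^ 'a \<Rightarrow> complex ^ 'b" where
  "vpartial a g z = (\<chi> c. partial a (\<lambda>w. g w $ c) z)"

text \<open>
  The order in which the partial derivatives are taken is fixed by an arbitrary enumeration of
  the variables; it is immaterial for holomorphic \<open>g\<close>.
\<close>

definition mixed_partial :: "('a::finite \<Rightarrow> nat) \<Rightarrow> (complex ^ 'a \<Rightarrow> complex) \<Rightarrow> complex ^ 'a \<Rightarrow> complex"
  where "mixed_partial k g =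
    fold (\<lambda>a. partial a ^^ k a) (SOME as. distinct as \<and> set as = UNIV) g"

definition taylor_0 :: "(complex ^ 'a::finite \<Rightarrow> complex) \<Rightarrow> ('a, complex) mfps" where
  "taylor_0 g = Abs_mfps (\<lambda>k. mixed_partial k g 0 / of_nat (\<Prod>a\<in>UNIV. fact (k a)))"


section \<open>The system\<close>

text \<open>
  A point \<open>(x, y)\<close> of \<open>\<complex>\<^sup>m\<^sup>+\<^sup>n\<close> is a vector indexed by the sum type \<open>'m + 'n\<close>: the left summand
  indexes the variables \<open>x\<close>, the right one the variables \<open>y\<close>. The system consists of the exponents
  \<open>p i\<close> and the right-hand sides \<open>f i\<close>, where \<open>i :: 'm\<close>.
\<close>

definition join :: "complex ^ 'm \<Rightarrow> complex ^ 'n \<Rightarrow> complex ^ ('m::finite + 'n::finite)" where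
  "join x y = (\<chi> s. case s of Inl i \<Rightarrow> x $ i | Inr c \<Rightarrow> y $ c)"

definition jacobian_y ::
  "(complex ^ ('m::finite + 'n::finite) \<Rightarrow> complex ^ 'n) \<Rightarrow> complex ^ ('m + 'n) \<Rightarrow> complex ^ 'n ^ 'n"
  where "jacobian_y g z = (\<chi> c b. partial (Inr b) (\<lambda>w. g w $ c) z)"

definition germ_subst ::
  "(complex ^ ('m::finite + 'n::finite) \<Rightarrow> complex) \<Rightarrow> ('m, complex) mfps ^ 'n \<Rightarrow> ('m, complex) mfps"
  where "germ_subst g \<phi> = mfps_subst (taylor_0 g) (case_sum mfps_X (\<lambda>c. \<phi> $ c))"

definition formal_solution ::
  "('m \<Rightarrow> nat) \<Rightarrow> ('m \<Rightarrow> complex ^ ('m::finite + 'n::finite) \<Rightarrow> complex ^ 'n)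
     \<Rightarrow> ('m, complex) mfps ^ 'n \<Rightarrow> bool"
  where "formal_solution p f \<phi> \<longleftrightarrow>
    (\<forall>c. mfps_nth (\<phi> $ c) (\<lambda>_. 0) = 0) \<and>
    (\<forall>i c. mfps_X i ^ p i * mfps_deriv i (\<phi> $ c) = germ_subst (\<lambda>z. f i z $ c) \<phi>)"

definition local_solution ::
  "('m \<Rightarrow> nat) \<Rightarrow> ('m \<Rightarrow> complex ^ ('m::finite + 'n::finite) \<Rightarrow> complex ^ 'n)
     \<Rightarrow> (complex ^ ('m + 'n)) set \<Rightarrow> complex ^ 'm \<Rightarrow> complex ^ 'n
     \<Rightarrow> (complex ^ 'm \<Rightarrow> complex ^ 'n) \<Rightarrow> bool"
  where "local_solution p f D x0 y0 y \<longleftrightarrow>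
    y x0 = y0 \<and>
    (\<exists>U. open U \<and> x0 \<in> U \<and> mholomorphic_on y U \<and>
      (\<forall>x\<in>U. join x (y x) \<in> D \<and>
        (\<forall>i. (x $ i) ^ p i *s vpartial i y x = f i (join x (y x)))))"

definition singular_locus :: "(complex ^ ('m::finite + 'n::finite)) set \<Rightarrow> (complex ^ ('m + 'n)) set"
  where "singular_locus D = {z \<in> D. (\<Prod>i\<in>UNIV. z $ Inl i) = 0}"

definition completely_integrable ::
  "('m \<Rightarrow> nat) \<Rightarrow> ('m \<Rightarrow> complex ^ ('m::finite + 'n::finite) \<Rightarrow> complex ^ 'n)
     \<Rightarrow> (complex ^ ('m + 'n)) set \<Rightarrow> bool"
  where "completely_integrable p f D \<longleftrightarrow>
    (\<forall>x0 y0. join x0 y0 \<in> D - singular_locus D \<longrightarrow>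
      (\<exists>y. local_solution p f D x0 y0 y) \<and>
      (\<forall>y1 y2. local_solution p f D x0 y0 y1 \<and> local_solution p f D x0 y0 y2 \<longrightarrow>
        (\<forall>\<^sub>F x in nhds x0. y1 x = y2 x)))"

definition integrability_defect ::
  "('m \<Rightarrow> nat) \<Rightarrow> ('m \<Rightarrow> complex ^ ('m::finite + 'n::finite) \<Rightarrow> complex ^ 'n)
     \<Rightarrow> 'm \<Rightarrow> 'm \<Rightarrow> complex ^ ('m + 'n) \<Rightarrow> complex ^ 'n"
  where "integrability_defect p f i j z =
      (z $ Inl j) ^ p j *s vpartial (Inl j) (f i) z
    - (z $ Inl i) ^ p i *s vpartial (Inl i) (f j) z
    + jacobian_y (f i) z *v f j z - jacobian_y (f j) z *v f i z"

end

theory Submission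
  imports Defs "HOL-Complex_Analysis.Cauchy_Integral_Formula" "HOL-Computational_Algebra.Polynomial"
begin

text \<open>
  Write \<open>\<delta>\<^sub>i = x\<^sub>i^p\<^sub>i \<partial>/\<partial>x\<^sub>i\<close>. Along a formal solution \<open>\<phi>\<close> the chain rule turns
  \<open>\<delta>\<^sub>j \<delta>\<^sub>i \<phi> - \<delta>\<^sub>i \<delta>\<^sub>j \<phi>\<close> into \<open>F\<^sub>i\<^sub>j(x, \<phi>)\<close>, and the two derivations commute. So every \<open>F\<^sub>i\<^sub>j\<close>
  vanishes along \<open>\<phi>\<close> (\<open>germ_subst_integrability_defect_eq_0\<close>), and the differential system has been
  traded for the \<open>n\<close> analytic equations \<open>g\<^sub>a(x, \<phi>) = 0\<close> in \<open>n\<close> unknowns, whose Jacobian determinant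
  \<open>\<Delta>\<close> along \<open>\<phi>\<close> is a non-zero power series. What remains is an implicit function theorem in
  which \<open>\<Delta>\<close> may vanish at the origin.

  For a single variable \<open>t\<close> this is Newton's method (\<open>formal_curve_converges\<close>). Let \<open>d\<close> be the
  order of \<open>\<Delta>\<close>, cut \<open>\<phi>\<close> off at degree \<open>d\<close>, and let \<open>h\<close> be the tail. Taylor expansion at the
  cut-off series and Cramer's rule give \<open>\<Delta>' h = V - Q(h)\<close>, where \<open>\<Delta>'\<close> has the same leading term
  as \<open>\<Delta>\<close>, \<open>V\<close> is a convergent series, and \<open>Q\<close> is at least quadratic in \<open>h\<close>. Since \<open>h\<close> has order
  greater than \<open>d\<close>, the coefficient of degree \<open>N + d\<close> of \<open>Q(h)\<close> involves only the coefficients of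
  \<open>h\<close> of degree less than \<open>N\<close>. This recursion bounds the coefficients of \<open>h\<close>.

  In several variables \<open>\<Delta>\<close> is in general no monomial times a unit, so one cannot divide by it.
  But the restriction to the line \<open>x = t\<xi>\<close> is a ring homomorphism that commutes with
  substitution, and \<open>\<Delta>(t\<xi>) \<noteq> 0\<close> for all \<open>\<xi>\<close> in some ball. Hence \<open>\<phi>(t\<xi>)\<close> converges for each
  such \<open>\<xi>\<close>, with a radius that may depend on \<open>\<xi>\<close>. By Baire's theorem the homogeneous parts of
  \<open>\<phi>\<close> are bounded geometrically on a smaller ball, and Cauchy's inequality transfers such a bound
  to the coefficients (\<open>converges_if_converges_on_lines\<close>).

  To pass between germs and series one needs that the Taylor expansion at \<open>0\<close>, which is given by
  iterated partial derivatives, is multiplicative, compatible with derivations and convergent.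
  These facts are derived from the one-variable Cauchy theory.
\<close>

section \<open>Separately holomorphic functions\<close>

text \<open>
  Continuity and holomorphy in each variable separately: by Osgood's lemma this is the same as
  holomorphy. The form is chosen because it is inherited by partial derivatives with one-variable
  arguments only.
\<close>

definition sep_holomorphic_on :: "(complex ^ 'a::finite \<Rightarrow> complex) \<Rightarrow> (complex ^ 'a) set \<Rightarrow> bool" where
  "sep_holomorphic_on g D \<longleftrightarrow> continuous_on D g \<and>
     (\<forall>z\<in>D. \<forall>a. (\<lambda>t. g (z + axis a t)) field_differentiable at 0)"

lemma axis_plus: "axis a (s + t) = axis a s + axis a (t :: complex)"
  by (simp add: vec_eq_iff axis_def)

lemma axis_0: "axis a 0 = (0 :: complex ^ 'a)"
  by (simp add: axis_def vec_eq_iff)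

lemma norm_axis: "norm (axis a t) = norm (t :: complex)"
  by (simp add: norm_vec_def L2_set_def axis_def if_distrib[of norm] if_distrib[of "\<lambda>x. x ^ 2"] cong: if_cong)

lemma continuous_on_axis: "continuous_on S (axis a :: complex \<Rightarrow> complex ^ 'a)"
proof -
  have "axis a = (\<lambda>t :: complex. \<chi> i. if i = a then t else 0)"
    by (auto simp: fun_eq_iff axis_def vec_eq_iff)
  moreover have "continuous_on S (\<lambda>t :: complex. \<chi> i. if i = a then t else (0 :: complex))"
  proof (rule continuous_on_vec_lambda)
    show "continuous_on S (\<lambda>t :: complex. if i = a then t else (0 :: complex))" for i
      by (cases "i = a") auto
  qed
  ultimately show ?thesis by simp
qed

lemma has_derivative_along_axis_iff:
  fixes z :: "complex ^ 'a::finite"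
  shows "((\<lambda>s. g (z + axis a t + axis a s)) has_field_derivative d) (at 0) \<longleftrightarrow>
   ((\<lambda>s. g (z + axis a s)) has_field_derivative d) (at t)"
proof -
  have "(\<lambda>s :: complex. g (z + axis a t + axis a s)) = (\<lambda>s. g (z + axis a (s + t)))"
    by (simp add: axis_plus add_ac)
  then show ?thesis
    using DERIV_shift[of "\<lambda>s. g (z + axis a s)" d 0 t] by simp
qed

text \<open>
  No differentiability is needed here, since \<open>deriv\<close> is a choice operator applied to a predicate
  that is invariant under translation.
\<close>

lemma deriv_along_axis: "deriv (\<lambda>s. g (z + axis a s)) t = partial a g (z + axis a t)"
  unfolding partial_def deriv_def has_derivative_along_axis_iff ..

lemma higher_deriv_along_axis:
  "(deriv ^^ n) (\<lambda>s. g (z + axis a s)) = (\<lambda>t. (partial a ^^ n) g (z + axis a t))"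
  by (induction n) (simp_all add: deriv_along_axis)

lemma sep_holomorphic_has_partial:
  assumes "sep_holomorphic_on g D" "z + axis a t \<in> D"
  shows "((\<lambda>s. g (z + axis a s)) has_field_derivative partial a g (z + axis a t)) (at t)"
proof -
  have "(\<lambda>s. g (z + axis a t + axis a s)) field_differentiable at 0"
    using assms by (auto simp: sep_holomorphic_on_def)
  then have "((\<lambda>s. g (z + axis a t + axis a s)) has_field_derivative partial a g (z + axis a t)) (at 0)"
    unfolding partial_def using DERIV_deriv_iff_field_differentiable by blast
  then show ?thesis by (simp add: has_derivative_along_axis_iff)
qed

lemma sep_holomorphic_on_slice:
  assumes "sep_holomorphic_on g D" "\<And>t. t \<in> T \<Longrightarrow> z + axis a t \<in> D"
  shows "(\<lambda>t. g (z + axis a t)) holomorphic_on T"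
  unfolding holomorphic_on_def
  using sep_holomorphic_has_partial[OF assms(1)] assms(2)
  by (meson field_differentiable_at_within field_differentiable_def)

lemma Cauchy_inequality_partial:
  assumes g: "sep_holomorphic_on g D" and "0 < r"
    and D: "\<And>t. norm t \<le> r \<Longrightarrow> z + axis a t \<in> D"
    and B: "\<And>t. norm t = r \<Longrightarrow> norm (g (z + axis a t)) \<le> B"
  shows "norm ((partial a ^^ n) g z) \<le> fact n * B / r ^ n"
proof -
  have hol: "(\<lambda>t. g (z + axis a t)) holomorphic_on cball 0 r"
    by (rule sep_holomorphic_on_slice[OF g]) (simp add: D)
  have "norm ((deriv ^^ n) (\<lambda>t. g (z + axis a t)) 0) \<le> fact n * B / r ^ n"
    using hol by (intro Cauchy_inequality)
      (auto intro: holomorphic_on_subset holomorphic_on_imp_continuous_on B \<open>0 < r\<close>)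
  then show ?thesis
    unfolding higher_deriv_along_axis by (simp add: axis_0)
qed

lemma sep_holomorphic_on_add:
  "sep_holomorphic_on g D \<Longrightarrow> sep_holomorphic_on h D \<Longrightarrow> sep_holomorphic_on (\<lambda>z. g z + h z) D"
  by (auto simp: sep_holomorphic_on_def intro!: continuous_intros derivative_intros)

lemma sep_holomorphic_on_diff:
  "sep_holomorphic_on g D \<Longrightarrow> sep_holomorphic_on h D \<Longrightarrow> sep_holomorphic_on (\<lambda>z. g z - h z) D"
  by (auto simp: sep_holomorphic_on_def intro!: continuous_intros derivative_intros)

lemma sep_holomorphic_on_mult:
  "sep_holomorphic_on g D \<Longrightarrow> sep_holomorphic_on h D \<Longrightarrow> sep_holomorphic_on (\<lambda>z. g z * h z) D"
  by (auto simp: sep_holomorphic_on_def intro!: continuous_intros derivative_intros)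

lemma sep_holomorphic_on_const: "sep_holomorphic_on (\<lambda>z. c) D"
  by (auto simp: sep_holomorphic_on_def intro!: continuous_intros derivative_intros)

lemma sep_holomorphic_on_coordinate:
  fixes b :: "'a::finite"
  shows "sep_holomorphic_on (\<lambda>z. z $ b) D"
proof -
  have "(\<lambda>t. (z + axis a t) $ b) field_differentiable at 0" for z and a
    by (cases "b = a") (auto simp: axis_def intro!: derivative_intros)
  then show ?thesis by (auto simp: sep_holomorphic_on_def intro!: continuous_intros)
qed

lemma sep_holomorphic_on_sum:
  "(\<And>i. i \<in> I \<Longrightarrow> sep_holomorphic_on (g i) D) \<Longrightarrow> sep_holomorphic_on (\<lambda>z. \<Sum>i\<in>I. g i z) D"
  by (induction I rule: infinite_finite_induct)
    (auto intro: sep_holomorphic_on_const sep_holomorphic_on_add)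

lemma sep_holomorphic_on_power:
  "sep_holomorphic_on g D \<Longrightarrow> sep_holomorphic_on (\<lambda>z. g z ^ n) D"
  by (induction n) (auto intro: sep_holomorphic_on_const sep_holomorphic_on_mult)

lemma mholomorphic_on_imp_sep_holomorphic_on:
  fixes F :: "complex ^ 'a::finite \<Rightarrow> complex ^ 'b::finite"
  assumes "open D" "mholomorphic_on F D"
  shows "sep_holomorphic_on (\<lambda>z. F z $ c) D"
  unfolding sep_holomorphic_on_def
proof (intro conjI ballI allI)
  have "continuous_on D F"
    using assms(2) unfolding mholomorphic_on_def continuous_on_eq_continuous_within
    by (meson has_derivative_continuous)
  then show "continuous_on D (\<lambda>z. F z $ c)" by (intro continuous_intros)
next
  fix z and a :: 'a assume z: "z \<in> D"
  then obtain L where L: "(F has_derivative L) (at z)" "\<And>c v. L (c *s v) = c *s L v"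
    using assms at_within_open[OF z] unfolding mholomorphic_on_def by metis
  have ax: "axis a t = t *s axis a 1" for t :: complex
    by (auto simp: vec_eq_iff axis_def)
  have "linear (axis a :: complex \<Rightarrow> complex ^ 'a)"
    by (rule linearI) (auto simp: vec_eq_iff axis_def)
  then have "bounded_linear (axis a :: complex \<Rightarrow> complex ^ 'a)"
    by (simp add: linear_conv_bounded_linear)
  then have "((\<lambda>t. z + axis a t) has_derivative (\<lambda>t. axis a t)) (at (0::complex))"
    by (auto intro!: derivative_eq_intros bounded_linear_imp_has_derivative)
  then have "((\<lambda>t. F (z + axis a t)) has_derivative (\<lambda>t. L (axis a t))) (at 0)"
    using has_derivative_compose[of "\<lambda>t. z + axis a t" "\<lambda>t. axis a t" 0 UNIV F L] L(1)
    by (simp add: axis_0)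
  then have "((\<lambda>t. F (z + axis a t) $ c) has_derivative (\<lambda>t. L (axis a t) $ c)) (at 0)"
    by (rule bounded_linear.has_derivative[OF bounded_linear_vec_nth])
  moreover have "(\<lambda>t. L (axis a t) $ c) = (*) (L (axis a 1) $ c)"
  proof
    show "L (axis a t) $ c = L (axis a 1) $ c * t" for t
      by (subst ax, subst L(2)) simp
  qed
  ultimately have "((\<lambda>t. F (z + axis a t) $ c) has_field_derivative L (axis a 1) $ c) (at 0)"
    unfolding has_field_derivative_def by simp
  then show "(\<lambda>t. F (z + axis a t) $ c) field_differentiable at 0"
    unfolding field_differentiable_def by blast
qed

text \<open>
  Cauchy's inequality for the difference of two parallel slices, on a circle of fixed radius,
  bounds the difference of the derivatives by the uniform distance of the slices.
\<close>

lemma continuous_on_partial: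
  assumes D: "open D" and g: "sep_holomorphic_on g D"
  shows "continuous_on D (partial a g)"
  unfolding continuous_on_iff
proof (intro ballI allI impI)
  fix z0 and e :: real assume z0: "z0 \<in> D" and e: "e > 0"
  obtain R0 where R0: "R0 > 0" "cball z0 R0 \<subseteq> D" using D z0 open_contains_cball by blast
  define R where "R = R0 / 2"
  have R: "R > 0" "cball z0 (2 * R) \<subseteq> D" using R0 by (auto simp: R_def)
  have "uniformly_continuous_on (cball z0 (2*R)) g"
    using g R by (intro compact_uniformly_continuous)
      (auto simp: sep_holomorphic_on_def intro: continuous_on_subset)
  then obtain d where d: "d > 0"
    "\<And>x x'. x \<in> cball z0 (2*R) \<Longrightarrow> x' \<in> cball z0 (2*R) \<Longrightarrow> dist x' x < d \<Longrightarrow> dist (g x') (g x) < e * R / 2"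
    unfolding uniformly_continuous_on_def using e R by (metis divide_pos_pos mult_pos_pos zero_less_numeral)
  have in_ball: "z + axis a t \<in> cball z0 (2*R)" if "dist z z0 \<le> R" "norm t \<le> R" for z and t :: complex
  proof -
    have "norm (z0 - (z + axis a t)) \<le> norm (z0 - z) + norm (axis a t :: complex ^ 'a)"
      using norm_triangle_ineq4[of "z0 - z" "axis a t"] by (simp add: algebra_simps)
    then show ?thesis using that by (simp add: dist_norm norm_minus_commute norm_axis)
  qed
  have "dist (partial a g z) (partial a g z0) < e" if z: "z \<in> D" "dist z z0 < min d R" for z
  proof -
    have "norm (deriv (\<lambda>t. g (z + axis a t) - g (z0 + axis a t)) 0) \<le> e / 2"
    proof -
      have hol: "(\<lambda>t. g (z + axis a t) - g (z0 + axis a t)) holomorphic_on cball 0 R"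
        by (intro holomorphic_intros sep_holomorphic_on_slice[OF g])
          (use in_ball R z z0 in \<open>auto simp: subset_iff\<close>)
      have "norm ((deriv ^^ 1) (\<lambda>t. g (z + axis a t) - g (z0 + axis a t)) 0)
          \<le> fact 1 * (e * R / 2) / R ^ 1"
      proof (rule Cauchy_inequality)
        fix x :: complex assume "norm (0 - x) = R"
        then have "dist (g (z + axis a x)) (g (z0 + axis a x)) < e * R / 2"
          by (intro d(2) in_ball) (use z R in \<open>auto simp: dist_norm\<close>)
        then show "norm (g (z + axis a x) - g (z0 + axis a x)) \<le> e * R / 2"
          by (simp add: dist_norm)
      qed (use hol R in \<open>auto intro: holomorphic_on_subset holomorphic_on_imp_continuous_on\<close>)
      then show ?thesis using R by simp
    qed
    also have "deriv (\<lambda>t. g (z + axis a t) - g (z0 + axis a t)) 0 = partial a g z - partial a g z0"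
      using sep_holomorphic_has_partial[OF g, of z a 0] sep_holomorphic_has_partial[OF g, of z0 a 0] z z0
      by (intro DERIV_imp_deriv) (auto simp: axis_0 intro!: derivative_intros)
    finally show ?thesis using e by (simp add: dist_norm)
  qed
  then show "\<exists>d>0. \<forall>z\<in>D. dist z z0 < d \<longrightarrow> dist (partial a g z) (partial a g z0) < e"
    using d R by (metis min_less_iff_conj)
qed

text \<open>
  Along the \<open>b\<close>-axis, the derivative in direction \<open>a\<close> is the uniform limit of difference
  quotients, which are holomorphic. Both that \<open>partial a g\<close> is holomorphic in direction \<open>b\<close> and
  that the partial derivatives commute follow, as derivatives pass to uniform limits of
  holomorphic functions.
\<close>

lemma sep_holomorphic_on_difference_quotient:
  assumes D: "open D" and g: "sep_holomorphic_on g D" and z0: "z0 \<in> D"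
  obtains R where "R > 0"
    "\<And>n. (\<lambda>t. (g (z0 + axis b t + axis a (of_real (R / real (Suc n)))) - g (z0 + axis b t))
            / of_real (R / real (Suc n))) holomorphic_on ball 0 R"
    "\<And>n. ((\<lambda>t. (g (z0 + axis b t + axis a (of_real (R / real (Suc n)))) - g (z0 + axis b t))
            / of_real (R / real (Suc n)))
        has_field_derivative (partial b g (z0 + axis a (of_real (R / real (Suc n)))) - partial b g z0)
            / of_real (R / real (Suc n))) (at 0)"
    "uniform_limit (ball 0 R)
       (\<lambda>n t. (g (z0 + axis b t + axis a (of_real (R / real (Suc n)))) - g (z0 + axis b t))
            / of_real (R / real (Suc n)))
       (\<lambda>t. partial a g (z0 + axis b t)) sequentially"
proof -
  obtain R0 where R0: "R0 > 0" "cball z0 R0 \<subseteq> D" using D z0 open_contains_cball by blast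
  define R where "R = R0 / 2"
  have R: "R > 0" "cball z0 (2 * R) \<subseteq> D" using R0 by (auto simp: R_def)
  define h where "h n = complex_of_real (R / real (Suc n))" for n
  have h_norm: "norm (h n) = R / real (Suc n)" for n
    unfolding h_def norm_of_real using R by simp
  have h_le: "norm (h n) \<le> R" for n
    unfolding h_norm using R by (simp add: field_simps)
  have h_nz: "h n \<noteq> 0" for n
    using h_norm[of n] R by (metis divide_eq_0_iff less_irrefl norm_zero of_nat_eq_0_iff old.nat.distinct(2))
  have in_ball: "z0 + axis b t + axis a s \<in> cball z0 (2*R)" if "norm t \<le> R" "norm s \<le> R" for t s :: complex
  proof -
    have "norm (axis b t + axis a s :: complex ^ 'a) \<le> norm t + norm s"
      by (metis norm_axis norm_triangle_ineq)
    moreover have "norm (z0 - (z0 + axis b t + axis a s)) = norm (axis b t + axis a s)"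
      using norm_minus_cancel[of "axis b t + axis a s"] by (simp add: algebra_simps)
    ultimately show ?thesis using that by (simp add: dist_norm)
  qed
  have inD: "z0 + axis b t + axis a s \<in> D" if "norm t \<le> R" "norm s \<le> R" for t s :: complex
    using in_ball[OF that] R by auto
  have inDb: "z0 + axis b t \<in> D" if "norm t \<le> R" for t
    using inD[OF that, of 0] R by (simp add: axis_0)
  have inDa: "z0 + axis a t \<in> D" if "norm t \<le> R" for t
    using inD[OF _ that, of 0] R by (simp add: axis_0)
  show thesis
  proof (rule that)
    show "R > 0" by (rule R)
    fix n
    have comm: "z0 + axis b t + axis a s = (z0 + axis a s) + axis b t" for t s by simp
    show "(\<lambda>t. (g (z0 + axis b t + axis a (of_real (R / real (Suc n)))) - g (z0 + axis b t))
            / of_real (R / real (Suc n))) holomorphic_on ball 0 R"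
      unfolding h_def[symmetric] comm
      by (intro holomorphic_intros sep_holomorphic_on_slice[OF g])
        (use h_nz h_le in \<open>auto simp: inDb inD simp flip: comm\<close>)
    show "((\<lambda>t. (g (z0 + axis b t + axis a (of_real (R / real (Suc n)))) - g (z0 + axis b t))
            / of_real (R / real (Suc n)))
        has_field_derivative (partial b g (z0 + axis a (of_real (R / real (Suc n)))) - partial b g z0)
            / of_real (R / real (Suc n))) (at 0)"
    proof -
      have "((\<lambda>t. g (z0 + axis a (h n) + axis b t)) has_field_derivative
          partial b g (z0 + axis a (h n))) (at 0)"
        using sep_holomorphic_has_partial[OF g, of "z0 + axis a (h n)" b 0] inDa[OF h_le]
        by (simp add: axis_0)
      moreover have "((\<lambda>t. g (z0 + axis b t)) has_field_derivative partial b g z0) (at 0)"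
        using sep_holomorphic_has_partial[OF g, of z0 b 0] z0 by (simp add: axis_0)
      ultimately show ?thesis
        unfolding h_def[symmetric] comm by (intro DERIV_cdivide DERIV_diff)
    qed
  next
    show "uniform_limit (ball 0 R)
       (\<lambda>n t. (g (z0 + axis b t + axis a (of_real (R / real (Suc n)))) - g (z0 + axis b t))
            / of_real (R / real (Suc n)))
       (\<lambda>t. partial a g (z0 + axis b t)) sequentially"
      unfolding h_def[symmetric]
    proof (rule uniform_limitI)
      fix e :: real assume e: "e > 0"
      have "uniformly_continuous_on (cball z0 (2*R)) (partial a g)"
        using continuous_on_partial[OF D g] R
        by (intro compact_uniformly_continuous) (auto intro: continuous_on_subset)
      then obtain d where d: "d > 0" "\<And>x x'. x \<in> cball z0 (2*R) \<Longrightarrow> x' \<in> cball z0 (2*R) \<Longrightarrow>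
            dist x' x < d \<Longrightarrow> dist (partial a g x') (partial a g x) < e / 2"
        unfolding uniformly_continuous_on_def using e by (metis half_gt_zero)
      have "(\<lambda>n. R / real (Suc n)) \<longlonglongrightarrow> 0"
        by (rule real_tendsto_divide_at_top[OF tendsto_const])
          (rule filterlim_compose[OF filterlim_real_sequentially filterlim_Suc])
      then have "\<forall>\<^sub>F n in sequentially. R / real (Suc n) < d"
        using d(1) by (rule order_tendstoD)
      then show "\<forall>\<^sub>F n in sequentially. \<forall>t\<in>ball 0 R.
          dist ((g (z0 + axis b t + axis a (h n)) - g (z0 + axis b t)) / h n) (partial a g (z0 + axis b t)) < e"
      proof eventually_elim
        case (elim n)
        show ?case
        proof
          fix t :: complex assume t: "t \<in> ball 0 R"
          define w where "w = z0 + axis b t"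
          define q where "q s = g (w + axis a s) - s * partial a g w" for s
          have le: "norm (q (h n) - q 0) \<le> e / 2 * norm (h n - 0)"
          proof (rule field_differentiable_bound[where S = "cball 0 (norm (h n))"])
            fix s :: complex assume s: "s \<in> cball 0 (norm (h n))"
            then have sR: "norm s \<le> R" "norm s < d"
              using h_le[of n] h_norm[of n] elim by auto
            have wD: "w + axis a s \<in> D"
              using inD t sR by (auto simp: w_def)
            show "(q has_field_derivative (partial a g (w + axis a s) - partial a g w)) (at s within cball 0 (norm (h n)))"
              unfolding q_def
              using DERIV_diff[OF sep_holomorphic_has_partial[OF g wD]
                  DERIV_cmult_right[OF DERIV_ident, where c = "partial a g w"]]
              by (simp add: has_field_derivative_at_within)
            have "dist (partial a g (w + axis a s)) (partial a g w) < e / 2"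
            proof (rule d(2))
              show "w \<in> cball z0 (2 * R)" "w + axis a s \<in> cball z0 (2 * R)"
                using in_ball[of t 0] in_ball[of t s] sR t R by (simp_all add: w_def axis_0)
              show "dist (w + axis a s) w < d" using sR by (simp add: dist_norm norm_axis)
            qed
            then show "norm (partial a g (w + axis a s) - partial a g w) \<le> e / 2"
              by (simp add: dist_norm)
          qed auto
          have eq: "(g (w + axis a (h n)) - g w) / h n - partial a g w = (q (h n) - q 0) / h n"
            using h_nz[of n] by (simp add: q_def axis_0 field_simps)
          have "norm ((g (w + axis a (h n)) - g w) / h n - partial a g w) \<le> e / 2"
            unfolding eq norm_divide using le h_nz[of n] by (simp add: divide_le_eq)
          then show "dist ((g (z0 + axis b t + axis a (h n)) - g (z0 + axis b t)) / h n)
              (partial a g (z0 + axis b t)) < e"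
            using e by (simp add: w_def dist_norm)
        qed
      qed
    qed
  qed
qed

lemma sep_holomorphic_on_partial:
  assumes D: "open D" and g: "sep_holomorphic_on g D"
  shows "sep_holomorphic_on (partial a g) D"
  unfolding sep_holomorphic_on_def
proof (intro conjI ballI allI)
  show "continuous_on D (partial a g)" by (rule continuous_on_partial[OF D g])
  fix z b assume z: "z \<in> D"
  obtain R where R: "R > 0"
    and hol: "\<And>n. (\<lambda>t. (g (z + axis b t + axis a (of_real (R / real (Suc n)))) - g (z + axis b t))
            / of_real (R / real (Suc n))) holomorphic_on ball 0 R"
    and der: "\<And>n. ((\<lambda>t. (g (z + axis b t + axis a (of_real (R / real (Suc n)))) - g (z + axis b t))
            / of_real (R / real (Suc n)))
        has_field_derivative (partial b g (z + axis a (of_real (R / real (Suc n)))) - partial b g z)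
            / of_real (R / real (Suc n))) (at 0)"
    and lim: "uniform_limit (ball 0 R)
       (\<lambda>n t. (g (z + axis b t + axis a (of_real (R / real (Suc n)))) - g (z + axis b t))
            / of_real (R / real (Suc n)))
       (\<lambda>t. partial a g (z + axis b t)) sequentially"
    by (rule sep_holomorphic_on_difference_quotient[OF D g z, where a = a and b = b]) (rule that)
  have "(\<lambda>t. partial a g (z + axis b t)) holomorphic_on ball 0 R"
  proof (rule holomorphic_uniform_sequence[OF open_ball hol])
    fix x :: complex assume "x \<in> ball 0 R"
    then obtain d where "d > 0" "cball x d \<subseteq> ball 0 R" using open_contains_cball open_ball by blast
    then show "\<exists>d>0. cball x d \<subseteq> ball 0 R \<and> uniform_limit (cball x d)
       (\<lambda>n t. (g (z + axis b t + axis a (of_real (R / real (Suc n)))) - g (z + axis b t))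
            / of_real (R / real (Suc n)))
       (\<lambda>t. partial a g (z + axis b t)) sequentially"
      using lim uniform_limit_on_subset by blast
  qed
  then show "(\<lambda>t. partial a g (z + axis b t)) field_differentiable at 0"
    using R by (meson centre_in_ball holomorphic_on_imp_differentiable_at open_ball)
qed

lemma partial_commute:
  assumes D: "open D" and g: "sep_holomorphic_on g D" and z: "z \<in> D"
  shows "partial a (partial b g) z = partial b (partial a g) z"
proof -
  obtain R where R: "R > 0"
    and hol: "\<And>n. (\<lambda>t. (g (z + axis b t + axis a (of_real (R / real (Suc n)))) - g (z + axis b t))
            / of_real (R / real (Suc n))) holomorphic_on ball 0 R"
    and der: "\<And>n. ((\<lambda>t. (g (z + axis b t + axis a (of_real (R / real (Suc n)))) - g (z + axis b t))
            / of_real (R / real (Suc n)))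
        has_field_derivative (partial b g (z + axis a (of_real (R / real (Suc n)))) - partial b g z)
            / of_real (R / real (Suc n))) (at 0)"
    and lim: "uniform_limit (ball 0 R)
       (\<lambda>n t. (g (z + axis b t + axis a (of_real (R / real (Suc n)))) - g (z + axis b t))
            / of_real (R / real (Suc n)))
       (\<lambda>t. partial a g (z + axis b t)) sequentially"
    by (rule sep_holomorphic_on_difference_quotient[OF D g z, where a = a and b = b]) (rule that)
  define h where "h n = complex_of_real (R / real (Suc n))" for n
  have h_nz: "h n \<noteq> 0" for n using R by (simp add: h_def del: of_nat_Suc)
  have h_lim: "h \<longlonglongrightarrow> 0"
  proof -
    have "(\<lambda>n. R / real (Suc n)) \<longlonglongrightarrow> 0"
      by (rule real_tendsto_divide_at_top[OF tendsto_const])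
        (rule filterlim_compose[OF filterlim_real_sequentially filterlim_Suc])
    then have "(\<lambda>n. complex_of_real (R / real (Suc n))) \<longlonglongrightarrow> of_real 0"
      by (rule tendsto_of_real)
    then show ?thesis unfolding h_def by simp
  qed
  have "(\<lambda>n. (deriv ^^ 1) (\<lambda>t. (g (z + axis b t + axis a (h n)) - g (z + axis b t)) / h n) 0)
      \<longlonglongrightarrow> (deriv ^^ 1) (\<lambda>t. partial a g (z + axis b t)) 0"
    unfolding h_def
    by (rule higher_deriv_complex_uniform_limit[OF lim]) (use hol R in auto)
  then have "(\<lambda>n. (partial b g (z + axis a (h n)) - partial b g z) / h n) \<longlonglongrightarrow> partial b (partial a g) z"
    using DERIV_imp_deriv[OF der] by (simp add: h_def deriv_along_axis axis_0)
  moreover have "(\<lambda>n. (partial b g (z + axis a (h n)) - partial b g z) / h n) \<longlonglongrightarrow> partial a (partial b g) z"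
  proof -
    have "((\<lambda>s. partial b g (z + axis a s)) has_field_derivative partial a (partial b g) (z + axis a 0)) (at 0)"
      by (rule sep_holomorphic_has_partial[OF sep_holomorphic_on_partial[OF D g]]) (simp add: z axis_0)
    then have "((\<lambda>s. (partial b g (z + axis a s) - partial b g z) / s) \<longlongrightarrow> partial a (partial b g) z) (at 0)"
      by (simp add: DERIV_def axis_0)
    then show ?thesis
      by (rule filterlim_compose) (use h_lim h_nz in \<open>auto simp: filterlim_at\<close>)
  qed
  ultimately show ?thesis by (rule LIMSEQ_unique[THEN sym])
qed

section \<open>Formal power series: monomials, derivations and substitution\<close>

abbreviation tdeg :: "('v::finite \<Rightarrow> nat) \<Rightarrow> nat" where
  "tdeg k \<equiv> \<Sum>v\<in>UNIV. k v"

abbreviation monom_at :: "('w::finite \<Rightarrow> 'a::comm_ring_1) \<Rightarrow> ('w \<Rightarrow> nat) \<Rightarrow> 'a" where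
  "monom_at s q \<equiv> \<Prod>w\<in>UNIV. s w ^ q w"

lemma tdeg_Suc: "tdeg (q(w := Suc (q w))) = Suc (tdeg q)"
  by (simp add: sum.remove[of UNIV w])

lemma monom_at_Suc: "monom_at s (q(w := Suc (q w))) = s w * monom_at s q"
proof -
  have "(\<Prod>x\<in>UNIV - {w}. s x ^ (q(w := Suc (q w))) x) = (\<Prod>x\<in>UNIV - {w}. s x ^ q x)"
    by (rule prod.cong) auto
  then show ?thesis by (simp add: prod.remove[of UNIV w] mult_ac)
qed

lemma exponent_induct [case_names zero Suc]:
  fixes q :: "'w::finite \<Rightarrow> nat"
  assumes "P (\<lambda>_. 0)" "\<And>q w. P q \<Longrightarrow> P (q(w := Suc (q w)))"
  shows "P q"
proof (induction "tdeg q" arbitrary: q)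
  case 0
  then have "q = (\<lambda>_. 0)" by (auto simp: fun_eq_iff)
  then show ?case using assms(1) by simp
next
  case (Suc n)
  obtain w where w: "q w \<noteq> 0"
    using Suc(2) by (metis sum.neutral nat.distinct(1))
  define q' where "q' = q(w := q w - 1)"
  have q: "q = q'(w := Suc (q' w))" using w by (auto simp: q'_def fun_eq_iff)
  have "n = tdeg q'" using Suc(2) tdeg_Suc[of q' w] q by simp
  then show ?case using Suc(1) assms(2) q by metis
qed

text \<open>
  The part of first order in \<open>h\<close> of the monomial \<open>(s + h)^q\<close>. With \<open>h\<close> the derivatives of \<open>s\<close>
  it is the derivative of \<open>s^q\<close>, so it serves both the chain rule and Taylor's formula. If
  \<open>q w = 0\<close>, the truncated subtraction is harmless because of the factor \<open>of_nat (q w)\<close>.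
\<close>

definition linear_part :: "('w::finite \<Rightarrow> 'a::comm_ring_1) \<Rightarrow> ('w \<Rightarrow> 'a) \<Rightarrow> ('w \<Rightarrow> nat) \<Rightarrow> 'a" where
  "linear_part s h q = (\<Sum>w\<in>UNIV. of_nat (q w) * monom_at s (q(w := q w - 1)) * h w)"

lemma linear_part_0: "linear_part s h (\<lambda>_. 0) = 0"
  by (simp add: linear_part_def)

lemma linear_part_Suc:
  "linear_part s h (q(v := Suc (q v))) = s v * linear_part s h q + h v * monom_at s q"
proof -
  have "of_nat ((q(v := Suc (q v))) w) * monom_at s ((q(v := Suc (q v)))(w := (q(v := Suc (q v))) w - 1)) * h w
      = s v * (of_nat (q w) * monom_at s (q(w := q w - 1)) * h w) + (if w = v then h v * monom_at s q else 0)"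
    (is "?L w = ?R w") for w
  proof (cases "w = v")
    case False
    have "(q(v := Suc (q v)))(w := q w - 1) = (q(w := q w - 1))(v := Suc ((q(w := q w - 1)) v))"
      using False by auto
    then have "monom_at s ((q(v := Suc (q v)))(w := q w - 1)) = s v * monom_at s (q(w := q w - 1))"
      by (simp only: monom_at_Suc)
    then show ?thesis using False by (simp only: fun_upd_other) (simp add: mult_ac)
  next
    case True
    have upd: "(q(v := Suc (q v)))(v := (q(v := Suc (q v))) v - 1) = q" by auto
    have L: "?L v = of_nat (Suc (q v)) * monom_at s q * h v" unfolding upd by simp
    show ?thesis
    proof (cases "q v")
      case 0
      then show ?thesis unfolding True L by (simp add: mult_ac)
    next
      case (Suc n)
      have "q = (q(v := n))(v := Suc ((q(v := n)) v))" using Suc by auto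
      then have "monom_at s q = s v * monom_at s (q(v := n))"
        using monom_at_Suc[of s "q(v := n)" v] by simp
      then show ?thesis unfolding True L using Suc by (simp add: algebra_simps)
    qed
  qed
  then have "linear_part s h (q(v := Suc (q v))) = (\<Sum>w\<in>UNIV. ?R w)"
    unfolding linear_part_def by (intro sum.cong) auto
  also have "\<dots> = s v * linear_part s h q + h v * monom_at s q"
    by (simp add: sum.distrib linear_part_def sum_distrib_left)
  finally show ?thesis .
qed

lemma mfps_nth_0 [simp]: "mfps_nth 0 k = 0"
  by (simp add: zero_mfps_def)

lemma mfps_nth_1: "mfps_nth (1 :: ('v::finite, 'a::comm_ring_1) mfps) k = (if k = (\<lambda>_. 0) then 1 else 0)"
  by (simp add: one_mfps_def)

lemma mfps_nth_add [simp]: "mfps_nth (a + b) k = mfps_nth a k + mfps_nth b k"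
  by (simp add: plus_mfps_def)

lemma mfps_nth_diff [simp]: "mfps_nth (a - b) k = mfps_nth a k - mfps_nth b k"
  by (simp add: minus_mfps_def)

lemma mfps_nth_uminus [simp]: "mfps_nth (- a) k = - mfps_nth a k"
  by (simp add: uminus_mfps_def)

lemma mfps_nth_mult: "mfps_nth (a * b) k = (\<Sum>(i, j)\<in>exp_splits k. mfps_nth a i * mfps_nth b j)"
  by (simp add: times_mfps_def)

lemma mfps_nth_sum [simp]: "mfps_nth (\<Sum>i\<in>I. a i) k = (\<Sum>i\<in>I. mfps_nth (a i) k)"
  by (induction I rule: infinite_finite_induct) auto

lemma mfps_nth_of_nat_mult [simp]: "mfps_nth (of_nat n * a) k = of_nat n * mfps_nth a k"
  by (induction n) (simp_all add: distrib_right)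

lemma mfps_nth_of_nat_mult_mult [simp]: "mfps_nth (of_nat n * a * b) k = of_nat n * mfps_nth (a * b) k"
  by (simp add: mult.assoc)

lemma tdeg_exp_splits: "(i, j) \<in> exp_splits k \<Longrightarrow> tdeg k = tdeg i + tdeg j"
  by (simp add: exp_splits_def flip: sum.distrib)

lemma sum_exp_splits:
  fixes P :: "nat \<Rightarrow> bool"
  assumes "finite {q :: 'v::finite \<Rightarrow> nat. P (tdeg q)}"
  shows "(\<Sum>q | P (tdeg q). \<Sum>(i, j)\<in>exp_splits q. F i j)
    = (\<Sum>(i, j)\<in>{(i, j :: 'v \<Rightarrow> nat). P (tdeg i + tdeg j)}. F i j)"
proof -
  have "(\<Sum>q | P (tdeg q). \<Sum>(i, j)\<in>exp_splits q. F i j)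
      = (\<Sum>(q, p)\<in>Sigma {q. P (tdeg q)} exp_splits. F (fst p) (snd p))"
    by (subst sum.Sigma) (auto simp: assms case_prod_unfold)
  also have "\<dots> = (\<Sum>(i, j)\<in>{(i, j). P (tdeg i + tdeg j)}. F i j)"
    by (rule sum.reindex_bij_witness[of _ "\<lambda>(i, j). (\<lambda>v. i v + j v, (i, j))" snd])
      (auto simp: exp_splits_def fun_eq_iff sum.distrib, metis (no_types, lifting) sum.cong sum.distrib)
  finally show ?thesis .
qed

lemma tdeg_eq_0: "tdeg k = 0 \<longleftrightarrow> k = (\<lambda>_. 0)"
  by (auto simp: fun_eq_iff)

lemma mfps_deriv_nth: "mfps_nth (mfps_deriv v a) k = of_nat (Suc (k v)) * mfps_nth a (k(v := Suc (k v)))"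
  by (simp add: mfps_deriv_def)

lemma mfps_deriv_add: "mfps_deriv v (a + b) = mfps_deriv v a + mfps_deriv v b"
  by (rule mfps_eqI) (simp add: mfps_deriv_nth algebra_simps del: of_nat_Suc)

lemma mfps_deriv_1: "mfps_deriv v 1 = (0 :: ('v::finite, 'a::comm_ring_1) mfps)"
  by (rule mfps_eqI) (auto simp: mfps_deriv_nth mfps_nth_1 fun_eq_iff)

lemma mfps_deriv_X:
  "mfps_deriv v (mfps_X w) = (if v = w then 1 else (0 :: ('v::finite, 'a::comm_ring_1) mfps))"
proof (rule mfps_eqI)
  fix k
  have "k(v := Suc (k v)) = (\<lambda>u. if u = w then 1 else 0) \<longleftrightarrow> v = w \<and> k = (\<lambda>_. 0)"
    by (auto simp: fun_eq_iff split: if_splits)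
  then show "mfps_nth (mfps_deriv v (mfps_X w)) k = mfps_nth (if v = w then 1 else 0 :: ('v, 'a) mfps) k"
    by (auto simp: mfps_deriv_nth mfps_X_def mfps_nth_1)
qed

lemma mfps_deriv_commute:
  fixes a :: "('v::finite, 'a::comm_ring_1) mfps"
  shows "mfps_deriv v (mfps_deriv w a) = mfps_deriv w (mfps_deriv v a)"
proof (cases "v = w")
  case False
  show ?thesis
    by (rule mfps_eqI) (use False in \<open>simp add: mfps_deriv_nth fun_upd_twist mult_ac del: of_nat_Suc\<close>)
qed simp

lemma mfps_deriv_mult:
  fixes a b :: "('v::finite, 'a::comm_ring_1) mfps"
  shows "mfps_deriv v (a * b) = mfps_deriv v a * b + a * mfps_deriv v b"
proof (rule mfps_eqI)
  fix k
  define k' where "k' = k(v := Suc (k v))"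
  have shift: "(\<Sum>(i, j)\<in>exp_splits k'. of_nat (i v) * (mfps_nth a i * mfps_nth b j))
      = mfps_nth (mfps_deriv v a * b) k" for a b :: "('v, 'a) mfps"
  proof -
    have "(\<Sum>(i, j)\<in>exp_splits k'. of_nat (i v) * (mfps_nth a i * mfps_nth b j))
        = (\<Sum>(i, j)\<in>{(i, j) \<in> exp_splits k'. i v \<noteq> 0}. of_nat (i v) * (mfps_nth a i * mfps_nth b j))"
    proof (rule sum.mono_neutral_right)
      show "\<forall>p\<in>exp_splits k' - {(i, j) \<in> exp_splits k'. i v \<noteq> 0}.
          (case p of (i, j) \<Rightarrow> of_nat (i v) * (mfps_nth a i * mfps_nth b j)) = 0"
      proof
        fix p assume p: "p \<in> exp_splits k' - {(i, j) \<in> exp_splits k'. i v \<noteq> 0}"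
        obtain i j where ij: "p = (i, j)" by (cases p)
        then have "i v = 0" using p by auto
        then show "(case p of (i, j) \<Rightarrow> of_nat (i v) * (mfps_nth a i * mfps_nth b j)) = 0"
          by (simp add: ij)
      qed
    qed auto
    also have "\<dots> = (\<Sum>(i, j)\<in>exp_splits k. of_nat (Suc (i v)) * (mfps_nth a (i(v := Suc (i v))) * mfps_nth b j))"
    proof (rule sum.reindex_bij_witness[of _ "\<lambda>(i, j). (i(v := Suc (i v)), j)" "\<lambda>(i, j). (i(v := i v - 1), j)"])
      fix p assume p: "p \<in> {(i, j) \<in> exp_splits k'. i v \<noteq> 0}"
      obtain i j where ij: "p = (i, j)" by (cases p)
      have iv: "i v \<noteq> 0" and sp: "\<And>w. i w + j w = k' w" using p by (auto simp: ij exp_splits_def)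
      have upd: "(i(v := i v - 1))(v := Suc ((i(v := i v - 1)) v)) = i" using iv by auto
      show "(case case p of (i, j) \<Rightarrow> (i(v := i v - 1), j) of (i, j) \<Rightarrow> (i(v := Suc (i v)), j)) = p"
        unfolding ij prod.case upd ..
      have "(i(v := i v - 1)) w + j w = k w" for w
        using sp[of w] iv by (cases "w = v") (auto simp: k'_def)
      then show "(case p of (i, j) \<Rightarrow> (i(v := i v - 1), j)) \<in> exp_splits k"
        by (simp add: ij exp_splits_def del: fun_upd_apply)
      show "(case case p of (i, j) \<Rightarrow> (i(v := i v - 1), j) of (i, j) \<Rightarrow>
            of_nat (Suc (i v)) * (mfps_nth a (i(v := Suc (i v))) * mfps_nth b j))
          = (case p of (i, j) \<Rightarrow> of_nat (i v) * (mfps_nth a i * mfps_nth b j))"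
        unfolding ij prod.case upd using iv by simp
    next
      fix p assume p: "p \<in> exp_splits k"
      obtain i j where ij: "p = (i, j)" by (cases p)
      show "(case case p of (i, j) \<Rightarrow> (i(v := Suc (i v)), j) of (i, j) \<Rightarrow> (i(v := i v - 1), j)) = p"
        by (simp add: ij)
      show "(case p of (i, j) \<Rightarrow> (i(v := Suc (i v)), j)) \<in> {(i, j) \<in> exp_splits k'. i v \<noteq> 0}"
        using p by (auto simp: ij exp_splits_def k'_def)
    qed
    finally show ?thesis by (simp add: mfps_nth_mult mfps_deriv_nth mult.assoc del: of_nat_Suc)
  qed
  have swap: "(\<Sum>(i, j)\<in>exp_splits k'. of_nat (j v) * (mfps_nth a i * mfps_nth b j))
      = (\<Sum>(i, j)\<in>exp_splits k'. of_nat (i v) * (mfps_nth b i * mfps_nth a j))"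
    by (rule sum.reindex_bij_witness[of _ prod.swap prod.swap])
      (auto simp: exp_splits_def add.commute mult.commute)
  have "mfps_nth (mfps_deriv v (a * b)) k
      = (\<Sum>(i, j)\<in>exp_splits k'. of_nat (Suc (k v)) * (mfps_nth a i * mfps_nth b j))"
    by (simp add: mfps_deriv_nth mfps_nth_mult k'_def sum_distrib_left case_prod_unfold del: of_nat_Suc)
  also have "\<dots> = (\<Sum>(i, j)\<in>exp_splits k'. of_nat (i v) * (mfps_nth a i * mfps_nth b j)
      + of_nat (j v) * (mfps_nth a i * mfps_nth b j))"
  proof (rule sum.cong, simp, clarify)
    fix i j assume "(i, j) \<in> exp_splits k'"
    then have "Suc (k v) = i v + j v" by (auto simp: exp_splits_def k'_def dest: spec[of _ v])
    then show "of_nat (Suc (k v)) * (mfps_nth a i * mfps_nth b j)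
        = of_nat (i v) * (mfps_nth a i * mfps_nth b j) + of_nat (j v) * (mfps_nth a i * mfps_nth b j)"
      by (simp add: distrib_right del: of_nat_Suc)
  qed
  also have "\<dots> = mfps_nth (mfps_deriv v a * b + a * mfps_deriv v b) k"
    using shift[of a b] shift[of b a] swap
    by (simp add: sum.distrib case_prod_unfold mult.commute[of a])
  finally show "mfps_nth (mfps_deriv v (a * b)) k = mfps_nth (mfps_deriv v a * b + a * mfps_deriv v b) k" .
qed

lemma mfps_deriv_monom_at:
  fixes s :: "'w::finite \<Rightarrow> ('v::finite, 'a::comm_ring_1) mfps"
  shows "mfps_deriv v (monom_at s q) = linear_part s (\<lambda>w. mfps_deriv v (s w)) q"
proof (induction q rule: exponent_induct)
  case zero
  show ?case by (simp add: linear_part_0 mfps_deriv_1)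
next
  case (Suc q w)
  then show ?case by (simp only: monom_at_Suc linear_part_Suc mfps_deriv_mult) (simp add: mult_ac)
qed

text \<open>
  The definition of \<open>mfps_subst\<close> cuts off at the degree of \<open>k\<close>. That the cut-off may be raised
  makes it possible to use one index set for several coefficients.
\<close>

lemma mfps_subst_nth:
  fixes s :: "'w::finite \<Rightarrow> ('v::finite, 'a::comm_ring_1) mfps"
  assumes s: "\<And>w. mfps_nth (s w) (\<lambda>_. 0) = 0" and N: "tdeg k \<le> N"
  shows "mfps_nth (mfps_subst g s) k = (\<Sum>q | tdeg q \<le> N. mfps_nth g q * mfps_nth (monom_at s q) k)"
  unfolding mfps_subst_def mfps_nth_Abs
  by (rule sum.mono_neutral_left)
    (use N in \<open>auto simp: finite_exponents_degree_le mfps_prod_power_nth_eq_0[OF s]\<close>)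

lemma mfps_subst_mult_nth:
  fixes s :: "'w::finite \<Rightarrow> ('v::finite, 'a::comm_ring_1) mfps"
  assumes s: "\<And>w. mfps_nth (s w) (\<lambda>_. 0) = 0" and N: "tdeg k \<le> N"
  shows "mfps_nth (mfps_subst g s * c) k = (\<Sum>q | tdeg q \<le> N. mfps_nth g q * mfps_nth (monom_at s q * c) k)"
proof -
  have "mfps_nth (mfps_subst g s * c) k =
      (\<Sum>(i, j)\<in>exp_splits k. \<Sum>q | tdeg q \<le> N. mfps_nth g q * (mfps_nth (monom_at s q) i * mfps_nth c j))"
    unfolding mfps_nth_mult
  proof (rule sum.cong, simp, clarify)
    fix i j assume "(i, j) \<in> exp_splits k"
    then have "tdeg i \<le> N" using tdeg_exp_splits N by fastforce
    then show "mfps_nth (mfps_subst g s) i * mfps_nth c j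
        = (\<Sum>q | tdeg q \<le> N. mfps_nth g q * (mfps_nth (monom_at s q) i * mfps_nth c j))"
      by (simp add: mfps_subst_nth[OF s] sum_distrib_right mult.assoc)
  qed
  also have "\<dots> = (\<Sum>q | tdeg q \<le> N. \<Sum>(i, j)\<in>exp_splits k. mfps_nth g q * (mfps_nth (monom_at s q) i * mfps_nth c j))"
    unfolding case_prod_unfold by (rule sum.swap)
  finally show ?thesis by (simp add: mfps_nth_mult sum_distrib_left case_prod_unfold)
qed

lemma mfps_subst_add: "mfps_subst (g + h) s = mfps_subst g s + mfps_subst h s"
  by (rule mfps_eqI) (simp add: mfps_subst_def distrib_right sum.distrib)

lemma mfps_subst_diff: "mfps_subst (g - h) s = mfps_subst g s - mfps_subst h s"
  by (rule mfps_eqI) (simp add: mfps_subst_def left_diff_distrib sum_subtractf)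

lemma mfps_subst_0: "mfps_subst 0 s = 0"
  by (rule mfps_eqI) (simp add: mfps_subst_def)

lemma mfps_subst_sum: "mfps_subst (\<Sum>i\<in>I. g i) s = (\<Sum>i\<in>I. mfps_subst (g i) s)"
  by (induction I rule: infinite_finite_induct) (simp_all add: mfps_subst_0 mfps_subst_add)

lemma mfps_subst_mult:
  fixes s :: "'w::finite \<Rightarrow> ('v::finite, 'a::comm_ring_1) mfps"
  assumes s: "\<And>w. mfps_nth (s w) (\<lambda>_. 0) = 0"
  shows "mfps_subst (g * h) s = mfps_subst g s * mfps_subst h s"
proof (rule mfps_eqI)
  fix k :: "'v \<Rightarrow> nat"
  define N where "N = tdeg k"
  define F where "F i j = mfps_nth g i * mfps_nth h j * mfps_nth (monom_at s i * monom_at s j) k" for i j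
  have "mfps_nth (mfps_subst (g * h) s) k
      = (\<Sum>q | tdeg q \<le> N. \<Sum>(i, j)\<in>exp_splits q. F i j)"
  proof -
    have "mfps_nth (g * h) q * mfps_nth (monom_at s q) k = (\<Sum>(i, j)\<in>exp_splits q. F i j)" for q
    proof -
      have "monom_at s q = monom_at s i * monom_at s j" if "(i, j) \<in> exp_splits q" for i j
      proof -
        have "q = (\<lambda>v. i v + j v)" using that by (auto simp: exp_splits_def fun_eq_iff)
        then show ?thesis by (simp add: power_add prod.distrib)
      qed
      then show ?thesis
        unfolding mfps_nth_mult[of g h] sum_distrib_right F_def by (intro sum.cong) auto
    qed
    then show ?thesis by (simp add: mfps_subst_nth[OF s, of k N] N_def)
  qed
  also have "\<dots> = (\<Sum>(i, j)\<in>{(i, j). tdeg i + tdeg j \<le> N}. F i j)"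
    by (rule sum_exp_splits) (rule finite_exponents_degree_le)
  also have "\<dots> = (\<Sum>(i, j)\<in>{i. tdeg i \<le> N} \<times> {j. tdeg j \<le> N}. F i j)"
  proof (rule sum.mono_neutral_left)
    show "\<forall>p\<in>{i. tdeg i \<le> N} \<times> {j. tdeg j \<le> N} - {(i, j). tdeg i + tdeg j \<le> N}. (case p of (i, j) \<Rightarrow> F i j) = 0"
    proof
      fix p :: "('w \<Rightarrow> nat) \<times> ('w \<Rightarrow> nat)"
      assume p: "p \<in> {i. tdeg i \<le> N} \<times> {j. tdeg j \<le> N} - {(i, j). tdeg i + tdeg j \<le> N}"
      obtain i j where ij: "p = (i, j)" by (cases p)
      have "\<not> tdeg i + tdeg j \<le> N" using p by (auto simp: ij)
      then have "mfps_nth (monom_at s (\<lambda>v. i v + j v)) k = 0"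
        by (intro mfps_prod_power_nth_eq_0[OF s]) (simp add: N_def sum.distrib)
      then show "(case p of (i, j) \<Rightarrow> F i j) = 0" by (simp add: ij F_def power_add prod.distrib)
    qed
  qed (auto simp: finite_exponents_degree_le)
  also have "\<dots> = (\<Sum>i | tdeg i \<le> N. \<Sum>j | tdeg j \<le> N. F i j)"
    by (simp add: sum.cartesian_product)
  also have "\<dots> = mfps_nth (mfps_subst g s * mfps_subst h s) k"
  proof -
    have "mfps_nth (monom_at s i * mfps_subst h s) k
        = (\<Sum>j | tdeg j \<le> N. mfps_nth h j * mfps_nth (monom_at s i * monom_at s j) k)" for i
      using mfps_subst_mult_nth[OF s, where k = k and N = N and g = h and c = "monom_at s i"] by (simp add: N_def mult.commute)
    then show ?thesis
      by (simp add: mfps_subst_mult_nth[OF s, of k N] N_def F_def sum_distrib_left mult.assoc)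
  qed
  finally show "mfps_nth (mfps_subst (g * h) s) k = mfps_nth (mfps_subst g s * mfps_subst h s) k" .
qed

lemma mfps_subst_1:
  fixes s :: "'w::finite \<Rightarrow> ('v::finite, 'a::comm_ring_1) mfps"
  shows "mfps_subst 1 s = 1"
proof (rule mfps_eqI)
  fix k
  have "mfps_nth (mfps_subst 1 s) k =
      (\<Sum>q | tdeg q \<le> tdeg k. if q = (\<lambda>_ :: 'w. 0) then mfps_nth 1 k else 0)"
    unfolding mfps_subst_def mfps_nth_Abs by (rule sum.cong) (auto simp: mfps_nth_1)
  also have "\<dots> = mfps_nth 1 k" by (subst sum.delta) (auto simp: finite_exponents_degree_le)
  finally show "mfps_nth (mfps_subst 1 s) k = mfps_nth 1 k" .
qed

lemma mfps_subst_X: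
  fixes s :: "'w::finite \<Rightarrow> ('v::finite, 'a::comm_ring_1) mfps"
  assumes s: "\<And>w. mfps_nth (s w) (\<lambda>_. 0) = 0"
  shows "mfps_subst (mfps_X v) s = s v"
proof (rule mfps_eqI)
  fix k
  let ?e = "\<lambda>w. if w = v then 1 else 0 :: nat"
  have e: "tdeg ?e = 1" by simp
  have m: "monom_at s ?e = s v"
    by (simp add: if_distrib[of "\<lambda>n. _ ^ n"] prod.delta cong: if_cong)
  have "mfps_nth (mfps_subst (mfps_X v) s) k =
      (\<Sum>q | tdeg q \<le> Suc (tdeg k). if q = ?e then mfps_nth (s v) k else 0)"
    unfolding mfps_subst_nth[OF s, of k "Suc (tdeg k)", simplified]
    by (rule sum.cong) (auto simp: mfps_X_def m)
  also have "\<dots> = mfps_nth (s v) k" by (subst sum.delta) (auto simp: finite_exponents_degree_le)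
  finally show "mfps_nth (mfps_subst (mfps_X v) s) k = mfps_nth (s v) k" .
qed

lemma mfps_subst_power:
  assumes "\<And>w. mfps_nth (s w) (\<lambda>_. 0) = 0"
  shows "mfps_subst (g ^ n) s = mfps_subst g s ^ n"
  by (induction n) (simp_all add: mfps_subst_1 mfps_subst_mult[OF assms])

text \<open>
  The coefficients of the derivatives of \<open>g\<close> are re-indexed so that the left-hand side becomes
  the sum over the monomials of \<open>g\<close>, each replaced by its \<open>linear_part\<close>. The degree bound rises
  by one because differentiation lowers degrees.
\<close>

lemma mfps_subst_linear_nth:
  fixes s :: "'w::finite \<Rightarrow> ('v::finite, 'a::comm_ring_1) mfps"
  assumes s: "\<And>w. mfps_nth (s w) (\<lambda>_. 0) = 0" and N: "tdeg k \<le> N"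
  shows "mfps_nth (\<Sum>w\<in>UNIV. mfps_subst (mfps_deriv w g) s * c w) k
    = (\<Sum>q | tdeg q \<le> Suc N. mfps_nth g q * mfps_nth (linear_part s c q) k)"
proof -
  define T where "T w q = of_nat (q w) * mfps_nth g q * mfps_nth (monom_at s (q(w := q w - 1)) * c w) k" for w q
  have "(\<Sum>q | tdeg q \<le> Suc N. T w q) = mfps_nth (mfps_subst (mfps_deriv w g) s * c w) k" for w
  proof -
    have "(\<Sum>q | tdeg q \<le> Suc N. T w q) = (\<Sum>q | tdeg q \<le> Suc N \<and> q w \<noteq> 0. T w q)"
      by (rule sum.mono_neutral_right) (auto simp: finite_exponents_degree_le T_def)
    also have "\<dots> = (\<Sum>q | tdeg q \<le> N. mfps_nth (mfps_deriv w g) q * mfps_nth (monom_at s q * c w) k)"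
    proof (rule sum.reindex_bij_witness[of _ "\<lambda>q. q(w := Suc (q w))" "\<lambda>q. q(w := q w - 1)"])
      fix q :: "'w \<Rightarrow> nat" assume q: "q \<in> {q. tdeg q \<le> Suc N \<and> q w \<noteq> 0}"
      then show eq: "(q(w := q w - 1))(w := Suc ((q(w := q w - 1)) w)) = q" by auto
      show "q(w := q w - 1) \<in> {q. tdeg q \<le> N}"
        using tdeg_Suc[of "q(w := q w - 1)" w] q unfolding eq by simp
      show "mfps_nth (mfps_deriv w g) (q(w := q w - 1)) * mfps_nth (monom_at s (q(w := q w - 1)) * c w) k = T w q"
        unfolding mfps_deriv_nth eq T_def using q by simp
    next
      fix q :: "'w \<Rightarrow> nat" assume q: "q \<in> {q. tdeg q \<le> N}"
      show "(q(w := Suc (q w)))(w := (q(w := Suc (q w))) w - 1) = q" by simp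
      show "q(w := Suc (q w)) \<in> {q. tdeg q \<le> Suc N \<and> q w \<noteq> 0}"
        using q by (simp only: mem_Collect_eq tdeg_Suc) simp
    qed
    also have "\<dots> = mfps_nth (mfps_subst (mfps_deriv w g) s * c w) k"
      by (simp add: mfps_subst_mult_nth[OF s N])
    finally show ?thesis .
  qed
  then have "mfps_nth (\<Sum>w\<in>UNIV. mfps_subst (mfps_deriv w g) s * c w) k = (\<Sum>w\<in>UNIV. \<Sum>q | tdeg q \<le> Suc N. T w q)"
    by simp
  also have "\<dots> = (\<Sum>q | tdeg q \<le> Suc N. \<Sum>w\<in>UNIV. T w q)"
    by (rule sum.swap)
  also have "\<dots> = (\<Sum>q | tdeg q \<le> Suc N. mfps_nth g q * mfps_nth (linear_part s c q) k)"
    by (rule sum.cong) (auto simp: T_def linear_part_def sum_distrib_left mult.assoc mult.left_commute[of "of_nat _" "mfps_nth g _"])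
  finally show ?thesis .
qed

theorem mfps_deriv_subst:
  fixes s :: "'w::finite \<Rightarrow> ('v::finite, 'a::comm_ring_1) mfps"
  assumes s: "\<And>w. mfps_nth (s w) (\<lambda>_. 0) = 0"
  shows "mfps_deriv v (mfps_subst g s) = (\<Sum>w\<in>UNIV. mfps_subst (mfps_deriv w g) s * mfps_deriv v (s w))"
proof (rule mfps_eqI)
  fix k
  have "mfps_nth (mfps_deriv v (mfps_subst g s)) k
      = (\<Sum>q | tdeg q \<le> Suc (tdeg k). mfps_nth g q * mfps_nth (mfps_deriv v (monom_at s q)) k)"
    by (simp add: mfps_deriv_nth mfps_subst_nth[OF s, of _ "Suc (tdeg k)"] tdeg_Suc sum_distrib_left mult_ac
        del: of_nat_Suc fun_upd_apply)
  also have "\<dots> = mfps_nth (\<Sum>w\<in>UNIV. mfps_subst (mfps_deriv w g) s * mfps_deriv v (s w)) k"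
    unfolding mfps_deriv_monom_at by (rule mfps_subst_linear_nth[OF s order_refl, symmetric])
  finally show "mfps_nth (mfps_deriv v (mfps_subst g s)) k
      = mfps_nth (\<Sum>w\<in>UNIV. mfps_subst (mfps_deriv w g) s * mfps_deriv v (s w)) k" .
qed

section \<open>Taylor expansion\<close>

lemma partial_cong:
  assumes "open D" "\<And>z. z \<in> D \<Longrightarrow> g z = h z" "z \<in> D"
  shows "partial a g z = partial a h z"
proof -
  have "open ((\<lambda>t. z + axis a t) -` D)"
    by (intro open_vimage assms continuous_on_add continuous_on_const continuous_on_axis)
  moreover have "0 \<in> (\<lambda>t. z + axis a t) -` D" using assms by (simp add: axis_0)
  ultimately have "\<forall>\<^sub>F t in nhds 0. t \<in> (\<lambda>t. z + axis a t) -` D"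
    by (rule eventually_nhds_in_open)
  then have "\<forall>\<^sub>F t in nhds 0. g (z + axis a t) = h (z + axis a t)"
    by eventually_elim (use assms in auto)
  then show ?thesis unfolding partial_def by (rule deriv_cong_ev) simp
qed

lemma partial_add:
  assumes "sep_holomorphic_on g D" "sep_holomorphic_on h D" "z \<in> D"
  shows "partial a (\<lambda>z. g z + h z) z = partial a g z + partial a h z"
  using sep_holomorphic_has_partial[OF assms(1), of z a 0] sep_holomorphic_has_partial[OF assms(2), of z a 0] assms(3)
  unfolding partial_def[of a "\<lambda>z. g z + h z"] by (intro DERIV_imp_deriv) (auto simp: axis_0 intro: DERIV_add)

lemma partial_mult:
  assumes "sep_holomorphic_on g D" "sep_holomorphic_on h D" "z \<in> D"
  shows "partial a (\<lambda>z. g z * h z) z = partial a g z * h z + g z * partial a h z"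
proof -
  have "((\<lambda>t. g (z + axis a t)) has_field_derivative partial a g z) (at 0)"
    "((\<lambda>t. h (z + axis a t)) has_field_derivative partial a h z) (at 0)"
    using sep_holomorphic_has_partial[OF assms(1), of z a 0]
      sep_holomorphic_has_partial[OF assms(2), of z a 0] assms(3) by (simp_all add: axis_0)
  from DERIV_mult[OF this] show ?thesis
    unfolding partial_def[of a "\<lambda>z. g z * h z"] by (intro DERIV_imp_deriv) (simp add: axis_0 mult.commute add.commute)
qed

lemma sep_holomorphic_on_higher_partial:
  "open D \<Longrightarrow> sep_holomorphic_on g D \<Longrightarrow> sep_holomorphic_on ((partial a ^^ n) g) D"
  by (induction n) (auto intro: sep_holomorphic_on_partial)

lemma higher_partial_cong:
  assumes "open D" "\<And>z. z \<in> D \<Longrightarrow> g z = h z" "z \<in> D"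
  shows "(partial a ^^ n) g z = (partial a ^^ n) h z"
  using assms(3)
proof (induction n arbitrary: z)
  case (Suc n)
  then show ?case by (auto intro: partial_cong[OF assms(1)])
qed (use assms in auto)

lemma partial_higher_partial_commute:
  assumes D: "open D" and g: "sep_holomorphic_on g D" and z: "z \<in> D"
  shows "partial b ((partial a ^^ n) g) z = (partial a ^^ n) (partial b g) z"
  using z
proof (induction n arbitrary: z)
  case (Suc n)
  have "partial b ((partial a ^^ Suc n) g) z = partial a (partial b ((partial a ^^ n) g)) z"
    using partial_commute[OF D sep_holomorphic_on_higher_partial[OF D g] Suc.prems] by simp
  also have "\<dots> = partial a ((partial a ^^ n) (partial b g)) z"
    by (rule partial_cong[OF D Suc.IH Suc.prems])
  finally show ?case by simp
qed simp

text \<open>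
  The Taylor coefficients in the definition of \<open>mixed_partial\<close> use some fixed enumeration of the
  variables. Keeping the list variable permits induction over it.
\<close>

abbreviation list_partial :: "'a list \<Rightarrow> ('a::finite \<Rightarrow> nat) \<Rightarrow> (complex ^ 'a \<Rightarrow> complex) \<Rightarrow> complex ^ 'a \<Rightarrow> complex"
  where "list_partial as k \<equiv> fold (\<lambda>a. partial a ^^ k a) as"

lemma list_partial_cong:
  assumes "open D" "\<And>z. z \<in> D \<Longrightarrow> g z = h z" "z \<in> D"
  shows "list_partial as k g z = list_partial as k h z"
  using assms(2)
proof (induction as arbitrary: g h)
  case (Cons a as)
  have "list_partial as k ((partial a ^^ k a) g) z = list_partial as k ((partial a ^^ k a) h) z"
    by (rule Cons.IH) (rule higher_partial_cong[OF assms(1) Cons.prems])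
  then show ?case by simp
qed (use assms in auto)

lemma list_partial_Suc:
  assumes D: "open D" and g: "sep_holomorphic_on g D" and z: "z \<in> D"
    and "distinct as" "b \<in> set as"
  shows "list_partial as (k(b := Suc (k b))) g z = list_partial as k (partial b g) z"
  using assms(4,5) g
proof (induction as arbitrary: g)
  case (Cons a as)
  show ?case
  proof (cases "a = b")
    case True
    have "list_partial as (k(b := Suc (k b))) = list_partial as k"
      using Cons.prems True by (intro ext fold_cong) auto
    then show ?thesis using True by (simp add: funpow_swap1)
  next
    case False
    have "list_partial (a # as) (k(b := Suc (k b))) g z
        = list_partial as (k(b := Suc (k b))) ((partial a ^^ k a) g) z" using False by simp
    also have "\<dots> = list_partial as k (partial b ((partial a ^^ k a) g)) z"
      using Cons.prems False by (intro Cons.IH sep_holomorphic_on_higher_partial D) auto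
    also have "\<dots> = list_partial as k ((partial a ^^ k a) (partial b g)) z"
      by (rule list_partial_cong[OF D partial_higher_partial_commute[OF D Cons.prems(3)] z])
    finally show ?thesis by simp
  qed
qed simp

definition variable_enumeration :: "'a::finite list" where
  "variable_enumeration = (SOME as. distinct as \<and> set as = UNIV)"

lemma variable_enumeration: "distinct variable_enumeration" "set variable_enumeration = (UNIV :: 'a::finite set)"
  using someI_ex[OF finite_distinct_list[OF finite[of UNIV]], unfolded conj_commute[of "set _ = _"]]
  by (auto simp: variable_enumeration_def)

lemma mixed_partial_eq: "mixed_partial k g = list_partial variable_enumeration k g"
  by (simp add: mixed_partial_def variable_enumeration_def)

lemma taylor_0_nth: "mfps_nth (taylor_0 g) k
    = list_partial variable_enumeration k g 0 / of_nat (\<Prod>a\<in>UNIV. fact (k a))"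
  by (simp add: taylor_0_def mixed_partial_eq)

lemma taylor_0_nth_0: "mfps_nth (taylor_0 g) (\<lambda>_. 0) = g 0"
proof -
  have "fold (\<lambda>a. partial a ^^ 0) as g = g" for as by (induction as) auto
  then show ?thesis by (simp add: taylor_0_nth)
qed

lemma taylor_0_cong:
  assumes "open D" "0 \<in> D" "\<And>z. z \<in> D \<Longrightarrow> g z = h z"
  shows "taylor_0 g = taylor_0 h"
  by (rule mfps_eqI) (simp add: taylor_0_nth list_partial_cong[OF assms(1,3,2)])

text \<open>
  The one place where the order of differentiation matters: the additional derivative has to be
  moved to its position in the enumeration.
\<close>

lemma taylor_0_partial:
  assumes D: "open D" "0 \<in> D" and g: "sep_holomorphic_on g D"
  shows "taylor_0 (partial a g) = mfps_deriv a (taylor_0 g)"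
proof (rule mfps_eqI)
  fix k
  have "(\<Prod>b\<in>UNIV - {a}. fact ((k(a := Suc (k a))) b)) = (\<Prod>b\<in>UNIV - {a}. fact (k b) :: nat)"
    by (rule prod.cong) auto
  then have "(\<Prod>b\<in>UNIV. fact ((k(a := Suc (k a))) b)) = Suc (k a) * (\<Prod>b\<in>UNIV. fact (k b) :: nat)"
    by (simp add: prod.remove[of UNIV a] fun_upd_same del: fun_upd_apply mult_Suc)
  moreover have "list_partial variable_enumeration (k(a := Suc (k a))) g 0
      = list_partial variable_enumeration k (partial a g) 0"
    by (rule list_partial_Suc[OF D(1) g D(2)]) (simp_all add: variable_enumeration)
  ultimately show "mfps_nth (taylor_0 (partial a g)) k = mfps_nth (mfps_deriv a (taylor_0 g)) k"
    by (simp add: mfps_deriv_nth taylor_0_nth del: of_nat_Suc fun_upd_apply mult_Suc of_nat_prod)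
qed

lemma mfps_eq_by_deriv:
  fixes a b :: "('v::finite, 'a::field_char_0) mfps"
  assumes "mfps_nth a (\<lambda>_. 0) = mfps_nth b (\<lambda>_. 0)" "\<And>v. mfps_deriv v a = mfps_deriv v b"
  shows "a = b"
proof (rule mfps_eqI)
  show "mfps_nth a k = mfps_nth b k" for k
  proof (induction k rule: exponent_induct)
    case (Suc k v)
    have "mfps_nth (mfps_deriv v a) k = mfps_nth (mfps_deriv v b) k" using assms(2) by simp
    then show ?case by (simp add: mfps_deriv_nth del: of_nat_Suc fun_upd_apply)
  qed (rule assms)
qed

lemma taylor_0_0: "taylor_0 (\<lambda>_. 0) = 0"
proof (rule mfps_eqI)
  fix k
  have "(partial a ^^ n) (\<lambda>_. 0) = (\<lambda>_. 0)" for a :: 'a and n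
    by (induction n) (simp_all add: fun_eq_iff partial_def)
  then have "list_partial as k (\<lambda>_. 0) = (\<lambda>_. 0)" for as :: "'a list"
    by (induction as) simp_all
  then show "mfps_nth (taylor_0 (\<lambda>_. 0)) k = mfps_nth 0 k" by (simp add: taylor_0_nth)
qed

lemma taylor_0_1: "taylor_0 (\<lambda>_. 1) = 1"
proof (rule mfps_eq_by_deriv)
  show "mfps_deriv v (taylor_0 (\<lambda>_. 1)) = mfps_deriv v 1" for v :: 'a
  proof -
    have "partial v (\<lambda>_. 1) = (\<lambda>_. 0)" by (simp add: fun_eq_iff partial_def)
    then show ?thesis
      using taylor_0_partial[OF open_UNIV UNIV_I sep_holomorphic_on_const, of v 1]
      by (simp add: taylor_0_0 mfps_deriv_1)
  qed
qed (simp add: taylor_0_nth_0 mfps_nth_1)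

lemma taylor_0_coordinate: "taylor_0 (\<lambda>z. z $ b) = mfps_X b"
proof (rule mfps_eq_by_deriv)
  show "mfps_deriv v (taylor_0 (\<lambda>z. z $ b)) = mfps_deriv v (mfps_X b)" for v
  proof -
    have "partial v (\<lambda>z. z $ b) = (\<lambda>_. if v = b then 1 else 0)"
      by (cases "v = b") (auto simp: partial_def axis_def fun_eq_iff intro!: DERIV_imp_deriv derivative_eq_intros)
    then show ?thesis
      using taylor_0_partial[OF open_UNIV UNIV_I sep_holomorphic_on_coordinate, of v b]
      by (simp add: taylor_0_0 taylor_0_1 mfps_deriv_X split: if_splits)
  qed
  show "mfps_nth (taylor_0 (\<lambda>z. z $ b)) (\<lambda>_. 0) = mfps_nth (mfps_X b) (\<lambda>_. 0)"
    by (auto simp: taylor_0_nth_0 mfps_X_def fun_eq_iff)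
qed

lemma mfps_nth_Suc_eq:
  fixes a :: "('v::finite, 'a::field_char_0) mfps"
  shows "mfps_nth a (k(v := Suc (k v))) = mfps_nth (mfps_deriv v a) k / of_nat (Suc (k v))"
  by (simp add: mfps_deriv_nth del: of_nat_Suc)

text \<open>
  Together with \<open>taylor_0_partial\<close>, the constant terms determine all coefficients. So identities
  between Taylor series are proved by induction on the exponent, applied to all functions at the
  same time. This also yields multiplicativity, without any multinomial Leibniz formula.
\<close>

lemma taylor_0_add:
  assumes D: "open D" "0 \<in> D" and g: "sep_holomorphic_on g D" and h: "sep_holomorphic_on h D"
  shows "taylor_0 (\<lambda>z. g z + h z) = taylor_0 g + taylor_0 h"
proof (rule mfps_eqI)
  show "mfps_nth (taylor_0 (\<lambda>z. g z + h z)) k = mfps_nth (taylor_0 g + taylor_0 h) k" for k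
    using g h
  proof (induction k arbitrary: g h rule: exponent_induct)
    case (Suc k a)
    note gh = Suc.prems
    have "mfps_deriv a (taylor_0 (\<lambda>z. g z + h z)) = taylor_0 (\<lambda>z. partial a g z + partial a h z)"
      unfolding taylor_0_partial[OF D sep_holomorphic_on_add[OF gh], symmetric]
      by (rule taylor_0_cong[OF D partial_add[OF gh]])
    then show ?case
      unfolding mfps_nth_Suc_eq mfps_deriv_add
      using Suc.IH[OF sep_holomorphic_on_partial[OF D(1) gh(1)] sep_holomorphic_on_partial[OF D(1) gh(2)]]
      by (simp add: taylor_0_partial[OF D gh(1)] taylor_0_partial[OF D gh(2)])
  qed (simp add: taylor_0_nth_0)
qed

lemma taylor_0_mult:
  assumes D: "open D" "0 \<in> D" and g: "sep_holomorphic_on g D" and h: "sep_holomorphic_on h D"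
  shows "taylor_0 (\<lambda>z. g z * h z) = taylor_0 g * taylor_0 h"
proof (rule mfps_eqI)
  show "mfps_nth (taylor_0 (\<lambda>z. g z * h z)) k = mfps_nth (taylor_0 g * taylor_0 h) k" for k
    using g h
  proof (induction k arbitrary: g h rule: exponent_induct)
    case zero
    have "exp_splits (\<lambda>_ :: 'a. 0) = {(\<lambda>_. 0, \<lambda>_. 0)}" by (auto simp: exp_splits_def fun_eq_iff)
    then show ?case by (simp add: taylor_0_nth_0 mfps_nth_mult)
  next
    case (Suc k a)
    note gh = Suc.prems
    note gh' = sep_holomorphic_on_partial[OF D(1) gh(1), of a] sep_holomorphic_on_partial[OF D(1) gh(2), of a]
    have "mfps_deriv a (taylor_0 (\<lambda>z. g z * h z)) = taylor_0 (\<lambda>z. partial a g z * h z + g z * partial a h z)"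
      unfolding taylor_0_partial[OF D sep_holomorphic_on_mult[OF gh], symmetric]
      by (rule taylor_0_cong[OF D partial_mult[OF gh]])
    also have "\<dots> = taylor_0 (\<lambda>z. partial a g z * h z) + taylor_0 (\<lambda>z. g z * partial a h z)"
      by (intro taylor_0_add[OF D] sep_holomorphic_on_mult gh gh')
    finally have "mfps_nth (mfps_deriv a (taylor_0 (\<lambda>z. g z * h z))) k
        = mfps_nth (mfps_deriv a (taylor_0 g * taylor_0 h)) k"
      using Suc.IH[OF gh'(1) gh(2)] Suc.IH[OF gh(1) gh'(2)]
      by (simp add: mfps_deriv_mult taylor_0_partial[OF D gh(1)] taylor_0_partial[OF D gh(2)])
    then show ?case unfolding mfps_nth_Suc_eq by simp
  qed
qed

lemma taylor_0_diff:
  assumes D: "open D" "0 \<in> D" and g: "sep_holomorphic_on g D" and h: "sep_holomorphic_on h D"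
  shows "taylor_0 (\<lambda>z. g z - h z) = taylor_0 g - taylor_0 h"
  using taylor_0_add[OF D sep_holomorphic_on_diff[OF g h] h] by (simp add: algebra_simps)

lemma taylor_0_sum:
  assumes D: "open D" "0 \<in> D" and g: "\<And>i. i \<in> I \<Longrightarrow> sep_holomorphic_on (g i) D"
  shows "taylor_0 (\<lambda>z. \<Sum>i\<in>I. g i z) = (\<Sum>i\<in>I. taylor_0 (g i))"
  using g
proof (induction I rule: infinite_finite_induct)
  case (insert i I)
  then show ?case
    using taylor_0_add[OF D, of "g i" "\<lambda>z. \<Sum>i\<in>I. g i z"] by (simp add: sep_holomorphic_on_sum)
qed (simp_all add: taylor_0_0)

lemma taylor_0_coordinate_power: "taylor_0 (\<lambda>z. (z $ b) ^ n) = mfps_X b ^ n"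
proof (induction n)
  case (Suc n)
  then show ?case
    using taylor_0_mult[OF open_UNIV UNIV_I sep_holomorphic_on_coordinate[of b]
        sep_holomorphic_on_power[OF sep_holomorphic_on_coordinate[of b], of n]]
    by (simp add: taylor_0_coordinate)
qed (simp add: taylor_0_1)

text \<open>
  One application of Cauchy's inequality for each variable, each of which halves the radius of
  the ball on which the bound holds.
\<close>

lemma taylor_0_geometric_bound:
  assumes D: "open D" "0 \<in> D" and g: "sep_holomorphic_on g D"
  obtains r M where "r > 0" "\<And>k. norm (mfps_nth (taylor_0 g) k) * r ^ tdeg k \<le> M"
proof -
  obtain R where R: "R > 0" "cball 0 R \<subseteq> D" using D open_contains_cball by blast
  have "continuous_on (cball 0 R) g"
    using g R by (auto simp: sep_holomorphic_on_def intro: continuous_on_subset)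
  then have "bounded (g ` cball 0 R)"
    by (intro compact_imp_bounded compact_continuous_image compact_cball)
  then obtain M0 where M0: "\<And>z. z \<in> cball 0 R \<Longrightarrow> norm (g z) \<le> M0"
    unfolding bounded_iff by blast
  define M where "M = max M0 0"
  have M: "M \<ge> 0" "\<And>z. z \<in> cball 0 R \<Longrightarrow> norm (g z) \<le> M"
    using M0 by (auto simp: M_def le_max_iff_disj)
  have bound: "norm (list_partial as k g z) \<le> M * (\<Prod>a\<leftarrow>as. fact (k a) / (R / 2 ^ length as) ^ k a)"
    if "sep_holomorphic_on g D" "R > 0" "cball 0 R \<subseteq> D" "M \<ge> 0"
      "\<And>z. z \<in> cball 0 R \<Longrightarrow> norm (g z) \<le> M" "z \<in> cball 0 (R / 2 ^ length as)"
    for as and k :: "'a \<Rightarrow> nat" and g R M z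
    using that
  proof (induction as arbitrary: g R M)
    case Nil
    then show ?case by simp
  next
    case (Cons a as)
    define M' where "M' = fact (k a) * M / (R / 2) ^ k a"
    have bd: "norm ((partial a ^^ k a) g w) \<le> M'" if w: "w \<in> cball 0 (R / 2)" for w
      unfolding M'_def
    proof (rule Cauchy_inequality_partial[OF Cons.prems(1)])
      have "w + axis a t \<in> cball 0 R" if "norm t \<le> R / 2" for t :: complex
        using norm_triangle_ineq[of w "axis a t"] w that by (simp add: norm_axis)
      then show "norm t \<le> R / 2 \<Longrightarrow> w + axis a t \<in> D" "norm t = R / 2 \<Longrightarrow> norm (g (w + axis a t)) \<le> M" for t :: complex
        using Cons.prems by auto
    qed (use Cons.prems in auto)
    have "norm (list_partial as k ((partial a ^^ k a) g) z)
        \<le> M' * (\<Prod>a\<leftarrow>as. fact (k a) / (R / 2 / 2 ^ length as) ^ k a)"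
    proof (rule Cons.IH)
      show "sep_holomorphic_on ((partial a ^^ k a) g) D"
        by (rule sep_holomorphic_on_higher_partial[OF D(1) Cons.prems(1)])
      show "cball 0 (R / 2) \<subseteq> D" using Cons.prems(2,3) subset_cball[of "R/2" R] by fastforce
    qed (use Cons.prems bd in \<open>auto simp: M'_def field_simps\<close>)
    also have "\<dots> \<le> (M * (fact (k a) / (R / 2 / 2 ^ length as) ^ k a))
        * (\<Prod>a\<leftarrow>as. fact (k a) / (R / 2 / 2 ^ length as) ^ k a)"
    proof (rule mult_right_mono)
      have "(R / 2 / 2 ^ length as) ^ k a \<le> (R / 2) ^ k a"
        using Cons.prems(2) by (intro power_mono) (auto simp: field_simps)
      then have "fact (k a) / (R / 2) ^ k a \<le> fact (k a) / (R / 2 / 2 ^ length as) ^ k a"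
        using Cons.prems(2) by (intro divide_left_mono) auto
      from mult_left_mono[OF this Cons.prems(4)]
      show "M' \<le> M * (fact (k a) / (R / 2 / 2 ^ length as) ^ k a)" by (simp add: M'_def mult.commute)
    qed (use Cons.prems(2) in \<open>auto intro!: prod_list_nonneg\<close>)
    finally show ?case by (simp add: mult_ac)
  qed
  define r where "r = R / 2 ^ length (variable_enumeration :: 'a list)"
  show thesis
  proof (rule that)
    show r: "r > 0" using R by (simp add: r_def)
    fix k :: "'a \<Rightarrow> nat"
    have "norm (list_partial variable_enumeration k g 0)
        \<le> M * (\<Prod>a\<leftarrow>variable_enumeration. fact (k a) / r ^ k a)"
      unfolding r_def by (rule bound[OF g R M]) (use R in auto)
    also have "(\<Prod>a\<leftarrow>variable_enumeration. fact (k a) / r ^ k a) = (\<Prod>a\<in>UNIV. fact (k a) / r ^ k a)"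
      using prod.distinct_set_conv_list[OF variable_enumeration(1), of "\<lambda>a. fact (k a) / r ^ k a"]
      by (simp add: variable_enumeration)
    also have "\<dots> = (\<Prod>a\<in>UNIV. fact (k a)) / r ^ tdeg k"
      by (simp add: prod_dividef power_sum)
    also have "(\<Prod>a\<in>UNIV. fact (k a)) = real (\<Prod>a\<in>UNIV. fact (k a))" by simp
    finally have "norm (list_partial variable_enumeration k g 0)
        \<le> M * (real (\<Prod>a\<in>UNIV. fact (k a)) / r ^ tdeg k)" .
    moreover have "real (\<Prod>a\<in>UNIV. fact (k a)) > 0"
      by (simp only: of_nat_0_less_iff) (simp add: prod_pos)
    ultimately show "norm (mfps_nth (taylor_0 g) k) * r ^ tdeg k \<le> M"
      using r by (simp add: taylor_0_nth norm_divide norm_of_nat field_simps del: of_nat_prod)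
  qed
qed

section \<open>The integrability defects along a formal solution\<close>

lemma mfps_X_nth_0: "mfps_nth (mfps_X v) (\<lambda>_. 0) = (0 :: 'a::zero_neq_one)"
  by (auto simp: mfps_X_def fun_eq_iff)

lemma germ_subst_mult:
  assumes "open D" "0 \<in> D" "sep_holomorphic_on g D" "sep_holomorphic_on h D"
    and "\<And>c. mfps_nth (\<phi> $ c) (\<lambda>_. 0) = 0"
  shows "germ_subst (\<lambda>z. g z * h z) \<phi> = germ_subst g \<phi> * germ_subst h \<phi>"
  unfolding germ_subst_def taylor_0_mult[OF assms(1-4)]
  by (rule mfps_subst_mult) (auto simp: assms(5) mfps_X_nth_0 split: sum.split)

lemma mfps_deriv_germ_subst:
  assumes "open D" "0 \<in> D" "sep_holomorphic_on g D" and \<phi>: "\<And>c. mfps_nth (\<phi> $ c) (\<lambda>_. 0) = 0"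
  shows "mfps_deriv i (germ_subst g \<phi>) = germ_subst (partial (Inl i) g) \<phi>
    + (\<Sum>c\<in>UNIV. germ_subst (partial (Inr c) g) \<phi> * mfps_deriv i (\<phi> $ c))"
proof -
  let ?s = "case_sum mfps_X (\<lambda>c. \<phi> $ c)"
  have "mfps_nth (?s w) (\<lambda>_. 0) = 0" for w
    by (auto simp: \<phi> mfps_X_nth_0 split: sum.split)
  then have "mfps_deriv i (germ_subst g \<phi>)
      = (\<Sum>w\<in>UNIV <+> UNIV. germ_subst (partial w g) \<phi> * mfps_deriv i (?s w))"
    unfolding germ_subst_def taylor_0_partial[OF assms(1-3)] UNIV_Plus_UNIV by (rule mfps_deriv_subst)
  also have "\<dots> = (\<Sum>j\<in>UNIV. germ_subst (partial (Inl j) g) \<phi> * mfps_deriv i (mfps_X j))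
      + (\<Sum>c\<in>UNIV. germ_subst (partial (Inr c) g) \<phi> * mfps_deriv i (\<phi> $ c))"
    by (subst sum.Plus) auto
  also have "(\<Sum>j\<in>UNIV. germ_subst (partial (Inl j) g) \<phi> * mfps_deriv i (mfps_X j))
      = germ_subst (partial (Inl i) g) \<phi>"
    by (simp add: mfps_deriv_X if_distrib[of "\<lambda>x. _ * x"] cong: if_cong)
  finally show ?thesis .
qed

lemma integrability_defect_component:
  "integrability_defect p f i j z $ c =
     ((z $ Inl j) ^ p j * partial (Inl j) (\<lambda>w. f i w $ c) z
        + (\<Sum>b\<in>UNIV. partial (Inr b) (\<lambda>w. f i w $ c) z * f j z $ b))
   - ((z $ Inl i) ^ p i * partial (Inl i) (\<lambda>w. f j w $ c) z
        + (\<Sum>b\<in>UNIV. partial (Inr b) (\<lambda>w. f j w $ c) z * f i z $ b))"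
  by (simp add: integrability_defect_def vpartial_def jacobian_y_def matrix_vector_mult_def)

lemma sep_holomorphic_on_integrability_defect:
  assumes D: "open D" and f: "\<And>i. mholomorphic_on (f i) D"
  shows "sep_holomorphic_on (\<lambda>z. integrability_defect p f i j z $ c) D"
  unfolding integrability_defect_component
  by (intro sep_holomorphic_on_diff sep_holomorphic_on_add sep_holomorphic_on_mult sep_holomorphic_on_sum
      sep_holomorphic_on_power sep_holomorphic_on_coordinate sep_holomorphic_on_partial
      mholomorphic_on_imp_sep_holomorphic_on D f)

text \<open>
  The chain rule along the solution: the derivation \<open>x\<^sub>i^p\<^sub>i \<partial>/\<partial>x\<^sub>i + f\<^sub>i \<partial>/\<partial>y\<close> of functions of
  \<open>(x, y)\<close> corresponds to \<open>x\<^sub>i^p\<^sub>i \<partial>/\<partial>x\<^sub>i\<close> on series in \<open>x\<close>.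
\<close>

lemma germ_subst_vector_field:
  fixes f :: "'m \<Rightarrow> complex ^ ('m::finite + 'n::finite) \<Rightarrow> complex ^ 'n"
  assumes D: "open D" "0 \<in> D" and f: "\<And>i. mholomorphic_on (f i) D" and g: "sep_holomorphic_on g D"
    and sol: "formal_solution p f \<phi>"
  shows "germ_subst (\<lambda>z. (z $ Inl i) ^ p i * partial (Inl i) g z
        + (\<Sum>b\<in>UNIV. partial (Inr b) g z * f i z $ b)) \<phi>
      = mfps_X i ^ p i * mfps_deriv i (germ_subst g \<phi>)"
proof -
  have \<phi>0: "\<And>c. mfps_nth (\<phi> $ c) (\<lambda>_. 0) = 0"
    and eqs: "\<And>i c. mfps_X i ^ p i * mfps_deriv i (\<phi> $ c) = germ_subst (\<lambda>z. f i z $ c) \<phi>"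
    using sol by (auto simp: formal_solution_def)
  let ?s = "case_sum mfps_X (\<lambda>c. \<phi> $ c)"
  have s: "mfps_nth (?s w) (\<lambda>_. 0) = 0" for w
    by (auto simp: \<phi>0 mfps_X_nth_0 split: sum.split)
  note holo = sep_holomorphic_on_partial[OF D(1) g] mholomorphic_on_imp_sep_holomorphic_on[OF D(1) f]
  have "germ_subst (\<lambda>z. (z $ Inl i) ^ p i * partial (Inl i) g z
        + (\<Sum>b\<in>UNIV. partial (Inr b) g z * f i z $ b)) \<phi>
      = germ_subst (\<lambda>z. (z $ Inl i) ^ p i * partial (Inl i) g z) \<phi>
        + (\<Sum>b\<in>UNIV. germ_subst (\<lambda>z. partial (Inr b) g z * f i z $ b) \<phi>)"
  proof -
    have A: "sep_holomorphic_on (\<lambda>z. (z $ Inl i) ^ p i * partial (Inl i) g z) D"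
      and B: "sep_holomorphic_on (\<lambda>z. partial (Inr b) g z * f i z $ b) D" for b
      by (intro sep_holomorphic_on_mult sep_holomorphic_on_power sep_holomorphic_on_coordinate holo)+
    have "taylor_0 (\<lambda>z. (z $ Inl i) ^ p i * partial (Inl i) g z + (\<Sum>b\<in>UNIV. partial (Inr b) g z * f i z $ b))
        = taylor_0 (\<lambda>z. (z $ Inl i) ^ p i * partial (Inl i) g z)
          + (\<Sum>b\<in>UNIV. taylor_0 (\<lambda>z. partial (Inr b) g z * f i z $ b))"
      using taylor_0_add[OF D A sep_holomorphic_on_sum[where I = UNIV
            and g = "\<lambda>b z. partial (Inr b) g z * f i z $ b", OF B]]
        taylor_0_sum[OF D, where I = UNIV and g = "\<lambda>b z. partial (Inr b) g z * f i z $ b", OF B]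
      by simp
    then show ?thesis by (simp add: germ_subst_def mfps_subst_add mfps_subst_sum)
  qed
  also have "germ_subst (\<lambda>z. (z $ Inl i) ^ p i * partial (Inl i) g z) \<phi>
      = mfps_X i ^ p i * germ_subst (partial (Inl i) g) \<phi>"
  proof -
    have "germ_subst (\<lambda>z. (z $ Inl i) ^ p i) \<phi> = mfps_X i ^ p i"
      by (simp add: germ_subst_def taylor_0_coordinate_power mfps_subst_power[OF s] mfps_subst_X[OF s])
    then show ?thesis
      by (subst germ_subst_mult[OF D _ _ \<phi>0])
        (auto intro: sep_holomorphic_on_power sep_holomorphic_on_coordinate holo)
  qed
  also have "(\<Sum>b\<in>UNIV. germ_subst (\<lambda>z. partial (Inr b) g z * f i z $ b) \<phi>)
      = (\<Sum>b\<in>UNIV. mfps_X i ^ p i * (germ_subst (partial (Inr b) g) \<phi> * mfps_deriv i (\<phi> $ b)))"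
    by (rule sum.cong[OF refl], subst germ_subst_mult[OF D holo \<phi>0])
      (simp add: eqs[symmetric] mult.left_commute)
  finally show ?thesis
    by (simp add: mfps_deriv_germ_subst[OF D g \<phi>0] distrib_left sum_distrib_left)
qed

lemma mfps_Euler_derivations_commute:
  fixes a :: "('v::finite, 'a::comm_ring_1) mfps"
  assumes "i \<noteq> j"
  shows "mfps_X j ^ q * mfps_deriv j (mfps_X i ^ r * mfps_deriv i a)
    = mfps_X i ^ r * mfps_deriv i (mfps_X j ^ q * mfps_deriv j a)"
proof -
  have 0: "mfps_deriv u (mfps_X v ^ n) = (0 :: ('v, 'a) mfps)" if "u \<noteq> v" for u v n
    by (induction n) (simp_all add: that mfps_deriv_mult mfps_deriv_1 mfps_deriv_X)
  show ?thesis
    using assms by (simp add: mfps_deriv_mult 0 mfps_deriv_commute[of i j a] mult.left_commute)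
qed

text \<open>
  The defect is the difference of two such derivations, one applied to \<open>f\<^sub>i\<close> and the other to
  \<open>f\<^sub>j\<close>. Along the solution it becomes the commutator of \<open>x\<^sub>j^p\<^sub>j \<partial>/\<partial>x\<^sub>j\<close> and \<open>x\<^sub>i^p\<^sub>i \<partial>/\<partial>x\<^sub>i\<close>
  applied to \<open>\<phi>\<close>, which is zero.
\<close>

theorem germ_subst_integrability_defect_eq_0:
  fixes f :: "'m \<Rightarrow> complex ^ ('m::finite + 'n::finite) \<Rightarrow> complex ^ 'n"
  assumes D: "open D" "0 \<in> D" and f: "\<And>i. mholomorphic_on (f i) D"
    and sol: "formal_solution p f \<phi>"
  shows "germ_subst (\<lambda>z. integrability_defect p f i j z $ c) \<phi> = 0"
proof (cases "i = j")
  case True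
  then show ?thesis by (simp add: integrability_defect_def germ_subst_def taylor_0_0 mfps_subst_0)
next
  case False
  note fc = mholomorphic_on_imp_sep_holomorphic_on[OF D(1) f]
  have E: "sep_holomorphic_on (\<lambda>z. (z $ Inl i) ^ p i * partial (Inl i) (\<lambda>w. f j w $ c) z
        + (\<Sum>b\<in>UNIV. partial (Inr b) (\<lambda>w. f j w $ c) z * f i z $ b)) D" for i j
    by (intro sep_holomorphic_on_add sep_holomorphic_on_mult sep_holomorphic_on_sum fc D
      sep_holomorphic_on_power sep_holomorphic_on_coordinate sep_holomorphic_on_partial)
  have sol': "germ_subst (\<lambda>z. f i z $ c) \<phi> = mfps_X i ^ p i * mfps_deriv i (\<phi> $ c)" for i
    using sol by (simp add: formal_solution_def)
  have "germ_subst (\<lambda>z. integrability_defect p f i j z $ c) \<phi>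
      = mfps_X j ^ p j * mfps_deriv j (germ_subst (\<lambda>z. f i z $ c) \<phi>)
        - mfps_X i ^ p i * mfps_deriv i (germ_subst (\<lambda>z. f j z $ c) \<phi>)"
    unfolding germ_subst_vector_field[OF D f fc sol, symmetric]
    unfolding germ_subst_def mfps_subst_diff[symmetric] integrability_defect_component
    by (subst taylor_0_diff[OF D E E]) (rule refl)
  then show ?thesis
    unfolding sol' using mfps_Euler_derivations_commute[OF False] by simp
qed

section \<open>Restriction to lines through the origin\<close>

lemma finite_exponents_degree_eq: "finite {q :: 'w::finite \<Rightarrow> nat. tdeg q = n}"
  by (rule finite_subset[OF _ finite_exponents_degree_le[of n]]) auto

definition homogeneous_part :: "('v::finite, 'a::comm_ring_1) mfps \<Rightarrow> nat \<Rightarrow> ('v \<Rightarrow> 'a) \<Rightarrow> 'a" where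
  "homogeneous_part a n \<xi> = (\<Sum>q | tdeg q = n. mfps_nth a q * monom_at \<xi> q)"

text \<open>
  The series \<open>a(t\<xi>)\<close> in the single variable \<open>t\<close>. One variable is encoded by the index type
  \<open>unit\<close>, so that substitution and norms need not be developed twice.
\<close>

definition mfps_line :: "('v::finite \<Rightarrow> 'a::comm_ring_1) \<Rightarrow> ('v, 'a) mfps \<Rightarrow> (unit, 'a) mfps" where
  "mfps_line \<xi> a = Abs_mfps (\<lambda>k. homogeneous_part a (k ()) \<xi>)"

lemma mfps_line_nth: "mfps_nth (mfps_line \<xi> a) k = homogeneous_part a (k ()) \<xi>"
  by (simp add: mfps_line_def)

lemma mfps_line_0: "mfps_line \<xi> 0 = 0"
  by (rule mfps_eqI) (simp add: mfps_line_nth homogeneous_part_def)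

lemma mfps_line_add: "mfps_line \<xi> (a + b) = mfps_line \<xi> a + mfps_line \<xi> b"
  by (rule mfps_eqI) (simp add: mfps_line_nth homogeneous_part_def distrib_right sum.distrib)

lemma mfps_line_uminus: "mfps_line \<xi> (- a) = - mfps_line \<xi> a"
  by (rule mfps_eqI) (simp add: mfps_line_nth homogeneous_part_def sum_negf)

lemma mfps_line_sum: "mfps_line \<xi> (\<Sum>i\<in>I. a i) = (\<Sum>i\<in>I. mfps_line \<xi> (a i))"
  by (induction I rule: infinite_finite_induct) (simp_all add: mfps_line_0 mfps_line_add)

lemma mfps_line_1:
  fixes \<xi> :: "'v::finite \<Rightarrow> 'a::comm_ring_1"
  shows "mfps_line \<xi> 1 = 1"
proof (rule mfps_eqI)
  fix k :: "unit \<Rightarrow> nat"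
  have "mfps_nth (mfps_line \<xi> 1) k = (\<Sum>q | tdeg q = k (). if q = (\<lambda>_ :: 'v. 0) then 1 else 0)"
    unfolding mfps_line_nth homogeneous_part_def by (rule sum.cong) (auto simp: mfps_nth_1)
  also have "\<dots> = mfps_nth 1 k"
    by (subst sum.delta[OF finite_exponents_degree_eq]) (auto simp: mfps_nth_1 fun_eq_iff)
  finally show "mfps_nth (mfps_line \<xi> 1) k = mfps_nth 1 k" .
qed

lemma mfps_line_mult:
  fixes a b :: "('v::finite, 'a::comm_ring_1) mfps"
  shows "mfps_line \<xi> (a * b) = mfps_line \<xi> a * mfps_line \<xi> b"
proof (rule mfps_eqI)
  fix k :: "unit \<Rightarrow> nat"
  define F where "F i j = mfps_nth a i * monom_at \<xi> i * (mfps_nth b j * monom_at \<xi> j)" for i j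
  have "mfps_nth (mfps_line \<xi> (a * b)) k = (\<Sum>q | tdeg q = k (). \<Sum>(i, j)\<in>exp_splits q. F i j)"
    unfolding mfps_line_nth homogeneous_part_def mfps_nth_mult sum_distrib_right
  proof (rule sum.cong[OF refl], rule sum.cong[OF refl], clarify)
    fix q i j :: "'v \<Rightarrow> nat" assume "(i, j) \<in> exp_splits q"
    then have "q = (\<lambda>v. i v + j v)" by (auto simp: exp_splits_def fun_eq_iff)
    then show "mfps_nth a i * mfps_nth b j * monom_at \<xi> q = F i j"
      by (simp add: F_def power_add prod.distrib mult_ac)
  qed
  also have "\<dots> = (\<Sum>(i, j)\<in>{(i, j). tdeg i + tdeg j = k ()}. F i j)"
    by (rule sum_exp_splits) (rule finite_exponents_degree_eq)
  also have "\<dots> = (\<Sum>(p, q)\<in>Sigma (exp_splits k) (\<lambda>p. {i. tdeg i = fst p ()} \<times> {j. tdeg j = snd p ()}). F (fst q) (snd q))"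
    by (rule sum.reindex_bij_witness[of _ snd "\<lambda>(i, j). ((\<lambda>_. tdeg i, \<lambda>_. tdeg j), (i, j))"])
      (auto simp: exp_splits_def)
  also have "\<dots> = (\<Sum>p\<in>exp_splits k. \<Sum>i | tdeg i = fst p (). \<Sum>j | tdeg j = snd p (). F i j)"
    by (subst sum.Sigma[symmetric])
      (auto simp: finite_exponents_degree_eq sum.cartesian_product case_prod_unfold)
  also have "\<dots> = mfps_nth (mfps_line \<xi> a * mfps_line \<xi> b) k"
    by (simp add: mfps_nth_mult mfps_line_nth homogeneous_part_def F_def sum_product case_prod_unfold)
  finally show "mfps_nth (mfps_line \<xi> (a * b)) k = mfps_nth (mfps_line \<xi> a * mfps_line \<xi> b) k" .
qed

lemma mfps_line_prod: "mfps_line \<xi> (\<Prod>i\<in>I. a i) = (\<Prod>i\<in>I. mfps_line \<xi> (a i))"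
  by (induction I rule: infinite_finite_induct) (simp_all add: mfps_line_1 mfps_line_mult)

lemma mfps_line_power: "mfps_line \<xi> (a ^ n) = mfps_line \<xi> a ^ n"
  by (induction n) (simp_all add: mfps_line_1 mfps_line_mult)

lemma mfps_line_det:
  fixes A :: "('v::finite, 'a::comm_ring_1) mfps ^ 'n::finite ^ 'n"
  shows "mfps_line \<xi> (det A) = det (\<chi> i j. mfps_line \<xi> (A $ i $ j))"
proof -
  have "mfps_line \<xi> (of_int (sign p) * x) = of_int (sign p) * mfps_line \<xi> x"
    for p :: "'n \<Rightarrow> 'n" and x :: "('v, 'a) mfps"
    by (cases p rule: sign_cases) (simp_all add: mfps_line_uminus)
  then show ?thesis by (simp add: det_def mfps_line_sum mfps_line_prod)
qed

lemma mfps_line_nth_0: "mfps_nth a (\<lambda>_. 0) = 0 \<Longrightarrow> mfps_nth (mfps_line \<xi> a) (\<lambda>_. 0) = 0"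
  unfolding mfps_line_nth homogeneous_part_def by (rule sum.neutral) (auto simp only: tdeg_eq_0 mem_Collect_eq mult_zero_left)

theorem mfps_line_subst:
  fixes s :: "'w::finite \<Rightarrow> ('v::finite, 'a::comm_ring_1) mfps"
  assumes s: "\<And>w. mfps_nth (s w) (\<lambda>_. 0) = 0"
  shows "mfps_line \<xi> (mfps_subst g s) = mfps_subst g (\<lambda>w. mfps_line \<xi> (s w))"
proof (rule mfps_eqI)
  fix k :: "unit \<Rightarrow> nat"
  have "mfps_nth (mfps_line \<xi> (mfps_subst g s)) k
      = (\<Sum>q | tdeg q = k (). (\<Sum>r | tdeg r \<le> k (). mfps_nth g r * mfps_nth (monom_at s r) q) * monom_at \<xi> q)"
    unfolding mfps_line_nth homogeneous_part_def
    by (rule sum.cong) (auto simp: mfps_subst_nth[OF s, OF order.refl])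
  also have "\<dots> = (\<Sum>r | tdeg r \<le> k (). mfps_nth g r * mfps_nth (mfps_line \<xi> (monom_at s r)) k)"
    unfolding mfps_line_nth homogeneous_part_def sum_distrib_left sum_distrib_right
    by (subst sum.swap) (simp add: mult.assoc)
  also have "\<dots> = mfps_nth (mfps_subst g (\<lambda>w. mfps_line \<xi> (s w))) k"
    by (simp add: mfps_subst_nth[OF mfps_line_nth_0[OF s], of _ "k ()"] mfps_line_prod mfps_line_power UNIV_unit)
  finally show "mfps_nth (mfps_line \<xi> (mfps_subst g s)) k = mfps_nth (mfps_subst g (\<lambda>w. mfps_line \<xi> (s w))) k" .
qed

section \<open>Truncated norms and convergence\<close>

lemma mfps_order_ge_0 [simp]: "mfps_order_ge 0 a" and mfps_order_ge_zero [simp]: "mfps_order_ge n 0"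
  by (simp_all add: mfps_order_ge_def)

lemma mfps_order_ge_add: "mfps_order_ge n a \<Longrightarrow> mfps_order_ge n b \<Longrightarrow> mfps_order_ge n (a + b)"
  and mfps_order_ge_diff: "mfps_order_ge n a \<Longrightarrow> mfps_order_ge n b \<Longrightarrow> mfps_order_ge n (a - b)"
  for a b :: "('v::finite, 'a::comm_ring_1) mfps"
  by (simp_all add: mfps_order_ge_def)

lemma mfps_order_ge_sum:
  fixes a :: "'i \<Rightarrow> ('v::finite, 'a::comm_ring_1) mfps"
  shows "(\<And>i. i \<in> I \<Longrightarrow> mfps_order_ge n (a i)) \<Longrightarrow> mfps_order_ge n (\<Sum>i\<in>I. a i)"
  by (simp add: mfps_order_ge_def)

lemma mfps_order_ge_mult_left:
  fixes a b :: "('v::finite, 'a::comm_ring_1) mfps"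
  shows "mfps_order_ge n b \<Longrightarrow> mfps_order_ge n (a * b)"
  using mfps_order_ge_mult[of 0 a n b] by simp

lemma mfps_order_ge_mono: "mfps_order_ge n a \<Longrightarrow> m \<le> n \<Longrightarrow> mfps_order_ge m a"
  by (simp add: mfps_order_ge_def)

text \<open>
  The truncation keeps the sum finite for every formal series. Convergence then is boundedness
  in \<open>N\<close>, which is accessible to induction on \<open>N\<close>.
\<close>

definition trunc_norm :: "real \<Rightarrow> nat \<Rightarrow> ('v::finite, complex) mfps \<Rightarrow> real" where
  "trunc_norm \<rho> N a = (\<Sum>k | tdeg k \<le> N. norm (mfps_nth a k) * \<rho> ^ tdeg k)"

lemma trunc_norm_nonneg: "\<rho> \<ge> 0 \<Longrightarrow> trunc_norm \<rho> N a \<ge> 0"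
  by (simp add: trunc_norm_def sum_nonneg)

lemma trunc_norm_0 [simp]: "trunc_norm \<rho> N 0 = 0"
  by (simp add: trunc_norm_def)

lemma trunc_norm_uminus [simp]: "trunc_norm \<rho> N (- a) = trunc_norm \<rho> N a"
  by (simp add: trunc_norm_def)

lemma trunc_norm_1: "trunc_norm \<rho> N (1 :: ('v::finite, complex) mfps) = 1"
proof -
  have "trunc_norm \<rho> N (1 :: ('v, complex) mfps) = (\<Sum>k :: 'v \<Rightarrow> nat | tdeg k \<le> N. if k = (\<lambda>_. 0) then 1 else 0)"
    unfolding trunc_norm_def by (rule sum.cong) (auto simp: mfps_nth_1)
  then show ?thesis by (simp add: finite_exponents_degree_le)
qed

lemma trunc_norm_add: "\<rho> \<ge> 0 \<Longrightarrow> trunc_norm \<rho> N (a + b) \<le> trunc_norm \<rho> N a + trunc_norm \<rho> N b"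
  unfolding trunc_norm_def sum.distrib[symmetric]
  by (rule sum_mono) (simp add: distrib_right[symmetric] mult_right_mono norm_triangle_ineq)

lemma trunc_norm_diff: "\<rho> \<ge> 0 \<Longrightarrow> trunc_norm \<rho> N (a - b) \<le> trunc_norm \<rho> N a + trunc_norm \<rho> N b"
  using trunc_norm_add[of \<rho> N a "- b"] by simp

lemma trunc_norm_sum: "\<rho> \<ge> 0 \<Longrightarrow> trunc_norm \<rho> N (\<Sum>i\<in>I. a i) \<le> (\<Sum>i\<in>I. trunc_norm \<rho> N (a i))"
proof (induction I rule: infinite_finite_induct)
  case (insert i I)
  then show ?case using trunc_norm_add[of \<rho> N "a i" "\<Sum>i\<in>I. a i"] by simp
qed simp_all

text \<open>
  Shrinking the radius makes a series of order \<open>e\<close> small like the \<open>e\<close>-th power of the radius.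
\<close>

lemma trunc_norm_order:
  fixes a :: "('a::finite, complex) mfps"
  assumes a: "mfps_order_ge e a" and \<rho>: "0 \<le> \<rho>" "\<rho> \<le> \<rho>'" "0 < \<rho>'"
  shows "trunc_norm \<rho> N a \<le> (\<rho> / \<rho>') ^ e * trunc_norm \<rho>' N a"
  unfolding trunc_norm_def sum_distrib_left
proof (rule sum_mono)
  fix k :: "'a \<Rightarrow> nat"
  show "norm (mfps_nth a k) * \<rho> ^ tdeg k \<le> (\<rho> / \<rho>') ^ e * (norm (mfps_nth a k) * \<rho>' ^ tdeg k)"
  proof (cases "tdeg k < e")
    case True
    then show ?thesis using a by (simp add: mfps_order_ge_def)
  next
    case False
    have "\<rho> ^ tdeg k = (\<rho> / \<rho>') ^ tdeg k * \<rho>' ^ tdeg k" using \<rho> by (simp add: power_divide)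
    also have "\<dots> \<le> (\<rho> / \<rho>') ^ e * \<rho>' ^ tdeg k"
      using \<rho> False by (intro mult_right_mono power_decreasing) auto
    finally have "norm (mfps_nth a k) * \<rho> ^ tdeg k \<le> norm (mfps_nth a k) * ((\<rho> / \<rho>') ^ e * \<rho>' ^ tdeg k)"
      by (rule mult_left_mono) simp
    then show ?thesis by (simp add: mult_ac)
  qed
qed

text \<open>
  If \<open>a\<close> and \<open>b\<close> have positive order, then the coefficients of \<open>a * b\<close> up to degree \<open>N\<close> depend
  on fewer coefficients of the factors. This gain is what makes the recursion in
  \<open>formal_curve_converges\<close> work.
\<close>

lemma trunc_norm_mult:
  fixes a b :: "('a::finite, complex) mfps"
  assumes a: "mfps_order_ge c a" and b: "mfps_order_ge e b"
    and N: "N \<le> N1 + e" "N \<le> N2 + c" and \<rho>: "\<rho> \<ge> 0"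
  shows "trunc_norm \<rho> N (a * b) \<le> trunc_norm \<rho> N1 a * trunc_norm \<rho> N2 b"
proof -
  define F where "F i j = (norm (mfps_nth a i) * \<rho> ^ tdeg i) * (norm (mfps_nth b j) * \<rho> ^ tdeg j)" for i j
  have F0: "F i j \<ge> 0" for i j using \<rho> by (simp add: F_def)
  have "trunc_norm \<rho> N (a * b) \<le> (\<Sum>k | tdeg k \<le> N. \<Sum>(i, j)\<in>exp_splits k. F i j)"
    unfolding trunc_norm_def
  proof (rule sum_mono)
    fix k :: "'a \<Rightarrow> nat"
    have "norm (mfps_nth (a * b) k) * \<rho> ^ tdeg k
        \<le> (\<Sum>(i, j)\<in>exp_splits k. norm (mfps_nth a i * mfps_nth b j)) * \<rho> ^ tdeg k"
      unfolding mfps_nth_mult case_prod_unfold using \<rho> by (intro mult_right_mono norm_sum) auto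
    also have "\<dots> = (\<Sum>(i, j)\<in>exp_splits k. F i j)"
      unfolding sum_distrib_right
      by (rule sum.cong) (auto simp: F_def norm_mult power_add tdeg_exp_splits mult_ac)
    finally show "norm (mfps_nth (a * b) k) * \<rho> ^ tdeg k \<le> (\<Sum>(i, j)\<in>exp_splits k. F i j)" .
  qed
  also have "\<dots> = (\<Sum>(i, j)\<in>{(i, j). tdeg i + tdeg j \<le> N}. F i j)"
    by (rule sum_exp_splits) (rule finite_exponents_degree_le)
  also have "\<dots> = (\<Sum>(i, j)\<in>{(i, j). tdeg i + tdeg j \<le> N \<and> c \<le> tdeg i \<and> e \<le> tdeg j}. F i j)"
  proof (rule sum.mono_neutral_right)
    have "finite ({i :: 'a \<Rightarrow> nat. tdeg i \<le> N} \<times> {j :: 'a \<Rightarrow> nat. tdeg j \<le> N})"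
      by (simp add: finite_exponents_degree_le)
    then show "finite {(i :: 'a \<Rightarrow> nat, j :: 'a \<Rightarrow> nat). tdeg i + tdeg j \<le> N}"
      by (rule rev_finite_subset) auto
    show "\<forall>p\<in>{(i, j). tdeg i + tdeg j \<le> N} - {(i, j). tdeg i + tdeg j \<le> N \<and> c \<le> tdeg i \<and> e \<le> tdeg j}.
        (case p of (i, j) \<Rightarrow> F i j) = 0"
    proof
      fix p :: "('a \<Rightarrow> nat) \<times> ('a \<Rightarrow> nat)"
      assume p: "p \<in> {(i, j). tdeg i + tdeg j \<le> N} - {(i, j). tdeg i + tdeg j \<le> N \<and> c \<le> tdeg i \<and> e \<le> tdeg j}"
      obtain i j where ij: "p = (i, j)" by (cases p)
      have "tdeg i < c \<or> tdeg j < e" using p by (auto simp only: ij mem_Collect_eq Diff_iff prod.case not_le)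
      then show "(case p of (i, j) \<Rightarrow> F i j) = 0"
        using a b by (auto simp: ij F_def mfps_order_ge_def)
    qed
  qed auto
  also have "\<dots> \<le> (\<Sum>(i, j)\<in>{i. tdeg i \<le> N1} \<times> {j. tdeg j \<le> N2}. F i j)"
    using N by (intro sum_mono2) (auto simp: finite_exponents_degree_le F0)
  also have "\<dots> = trunc_norm \<rho> N1 a * trunc_norm \<rho> N2 b"
    by (simp add: trunc_norm_def F_def sum_product sum.cartesian_product)
  finally show ?thesis .
qed

lemma trunc_norm_mult_le: "\<rho> \<ge> 0 \<Longrightarrow> trunc_norm \<rho> N (a * b) \<le> trunc_norm \<rho> N a * trunc_norm \<rho> N b"
  by (rule trunc_norm_mult[where c = 0 and e = 0]) simp_all

lemma trunc_norm_monom_at: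
  assumes "\<rho> \<ge> 0" "\<And>w. trunc_norm \<rho> N (s w) \<le> S"
  shows "trunc_norm \<rho> N (monom_at s q) \<le> S ^ tdeg q"
proof (induction q rule: exponent_induct)
  case zero
  then show ?case by (simp add: trunc_norm_1)
next
  case (Suc q w)
  have "trunc_norm \<rho> N (s w * monom_at s q) \<le> trunc_norm \<rho> N (s w) * trunc_norm \<rho> N (monom_at s q)"
    by (rule trunc_norm_mult_le[OF assms(1)])
  also have "\<dots> \<le> S * S ^ tdeg q"
    using assms Suc trunc_norm_nonneg[OF assms(1)] by (intro mult_mono) (auto intro: order_trans)
  finally show ?case unfolding monom_at_Suc tdeg_Suc by simp
qed

text \<open>
  Bounds for the summands \<open>c q\<close>, which stand for monomials or their remainders, pass to the
  power series in them that has the coefficients of \<open>g\<close>.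
\<close>

lemma trunc_norm_power_sum:
  fixes a :: "('v::finite, complex) mfps" and g :: "('w::finite, complex) mfps"
  assumes c: "\<And>k. tdeg k \<le> N \<Longrightarrow> mfps_nth a k = (\<Sum>q | tdeg q \<le> L. mfps_nth g q * mfps_nth (c q) k)"
    and \<rho>: "\<rho> \<ge> 0" and b: "\<And>q. trunc_norm \<rho> N (c q) \<le> B * S ^ tdeg q"
  shows "trunc_norm \<rho> N a \<le> B * trunc_norm S L g"
proof -
  have "trunc_norm \<rho> N a
      \<le> (\<Sum>k | tdeg k \<le> N. \<Sum>q | tdeg q \<le> L. norm (mfps_nth g q) * (norm (mfps_nth (c q) k) * \<rho> ^ tdeg k))"
    unfolding trunc_norm_def
  proof (rule sum_mono)
    fix k :: "'v \<Rightarrow> nat" assume k: "k \<in> {k. tdeg k \<le> N}"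
    have "norm (mfps_nth a k) * \<rho> ^ tdeg k
        \<le> (\<Sum>q | tdeg q \<le> L. norm (mfps_nth g q * mfps_nth (c q) k)) * \<rho> ^ tdeg k"
      using \<rho> k by (subst c) (auto intro!: mult_right_mono norm_sum)
    then show "norm (mfps_nth a k) * \<rho> ^ tdeg k
        \<le> (\<Sum>q | tdeg q \<le> L. norm (mfps_nth g q) * (norm (mfps_nth (c q) k) * \<rho> ^ tdeg k))"
      by (simp add: sum_distrib_right norm_mult mult.assoc)
  qed
  also have "\<dots> = (\<Sum>q | tdeg q \<le> L. norm (mfps_nth g q) * trunc_norm \<rho> N (c q))"
    by (subst sum.swap) (simp add: trunc_norm_def sum_distrib_left)
  also have "\<dots> \<le> (\<Sum>q | tdeg q \<le> L. norm (mfps_nth g q) * (B * S ^ tdeg q))"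
    by (intro sum_mono mult_left_mono b) simp
  also have "\<dots> = B * trunc_norm S L g"
    by (simp add: trunc_norm_def sum_distrib_left mult_ac)
  finally show ?thesis .
qed

lemma trunc_norm_subst:
  assumes s: "\<And>w. mfps_nth (s w) (\<lambda>_. 0) = 0" and \<rho>: "\<rho> \<ge> 0" and S: "\<And>w. trunc_norm \<rho> N (s w) \<le> S"
  shows "trunc_norm \<rho> N (mfps_subst g s) \<le> trunc_norm S N g"
proof -
  have "trunc_norm \<rho> N (mfps_subst g s) \<le> 1 * trunc_norm S N g"
  proof (rule trunc_norm_power_sum)
    show "trunc_norm \<rho> N (monom_at s q) \<le> 1 * S ^ tdeg q" for q
      using trunc_norm_monom_at[OF \<rho> S] by simp
  qed (use \<rho> mfps_subst_nth[OF s] in auto)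
  then show ?thesis by simp
qed

text \<open>
  Absolute convergence on the polydisc of radius \<open>\<rho>\<close>.
\<close>

definition converges_at :: "real \<Rightarrow> ('v::finite, complex) mfps \<Rightarrow> bool" where
  "converges_at \<rho> a \<longleftrightarrow> \<rho> \<ge> 0 \<and> (\<exists>B. \<forall>N. trunc_norm \<rho> N a \<le> B)"

lemma converges_at_0: "\<rho> \<ge> 0 \<Longrightarrow> converges_at \<rho> 0"
  and converges_at_1: "\<rho> \<ge> 0 \<Longrightarrow> converges_at \<rho> 1"
  by (auto simp: converges_at_def trunc_norm_1)

lemma converges_at_uminus: "converges_at \<rho> a \<Longrightarrow> converges_at \<rho> (- a)"
  by (simp add: converges_at_def)

lemma converges_at_add: "converges_at \<rho> a \<Longrightarrow> converges_at \<rho> b \<Longrightarrow> converges_at \<rho> (a + b)"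
  unfolding converges_at_def by (meson add_mono order_trans trunc_norm_add)

lemma converges_at_diff: "converges_at \<rho> a \<Longrightarrow> converges_at \<rho> b \<Longrightarrow> converges_at \<rho> (a - b)"
  unfolding converges_at_def by (meson add_mono order_trans trunc_norm_diff)

lemma converges_at_mult:
  assumes "converges_at \<rho> a" "converges_at \<rho> b" shows "converges_at \<rho> (a * b)"
proof -
  from assms obtain A B where "\<rho> \<ge> 0" "\<And>N. trunc_norm \<rho> N a \<le> A" "\<And>N. trunc_norm \<rho> N b \<le> B"
    by (auto simp: converges_at_def)
  then have "trunc_norm \<rho> N (a * b) \<le> A * B" for N
    by (intro order_trans[OF trunc_norm_mult_le mult_mono]) (auto intro: order_trans[OF trunc_norm_nonneg])
  then show ?thesis using \<open>\<rho> \<ge> 0\<close> by (auto simp: converges_at_def)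
qed

lemma converges_at_sum:
  "\<rho> \<ge> 0 \<Longrightarrow> (\<And>i. i \<in> I \<Longrightarrow> converges_at \<rho> (a i)) \<Longrightarrow> converges_at \<rho> (\<Sum>i\<in>I. a i)"
  by (induction I rule: infinite_finite_induct) (auto intro: converges_at_0 converges_at_add)

lemma converges_at_prod:
  "\<rho> \<ge> 0 \<Longrightarrow> (\<And>i. i \<in> I \<Longrightarrow> converges_at \<rho> (a i)) \<Longrightarrow> converges_at \<rho> (\<Prod>i\<in>I. a i)"
  by (induction I rule: infinite_finite_induct) (auto intro: converges_at_1 converges_at_mult)

lemma converges_at_det:
  fixes A :: "('v::finite, complex) mfps ^ 'n::finite ^ 'n"
  assumes "\<rho> \<ge> 0" "\<And>i j. converges_at \<rho> (A $ i $ j)"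
  shows "converges_at \<rho> (det A)"
proof -
  have sgn: "converges_at \<rho> (of_int (sign p) * x)" if "converges_at \<rho> x" for p :: "'n \<Rightarrow> 'n" and x :: "('v, complex) mfps"
    by (cases p rule: sign_cases) (use that in \<open>simp_all add: converges_at_uminus\<close>)
  show ?thesis
    unfolding det_def by (intro converges_at_sum sgn converges_at_prod assms)
qed

lemma converges_at_mono:
  assumes "converges_at \<rho>' a" "0 \<le> \<rho>" "\<rho> \<le> \<rho>'" "0 < \<rho>'"
  shows "converges_at \<rho> a"
proof -
  obtain B where "\<And>N. trunc_norm \<rho>' N a \<le> B" using assms by (auto simp: converges_at_def)
  moreover have "trunc_norm \<rho> N a \<le> trunc_norm \<rho>' N a" for N
    using trunc_norm_order[of 0 a \<rho> \<rho>' N] assms by simp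
  ultimately show ?thesis unfolding converges_at_def using assms(2) order_trans by blast
qed

lemma converges_at_subst:
  assumes s: "\<And>w. mfps_nth (s w) (\<lambda>_. 0) = 0" and \<rho>: "\<rho> \<ge> 0" and S: "\<And>w N. trunc_norm \<rho> N (s w) \<le> S"
    and g: "converges_at S g"
  shows "converges_at \<rho> (mfps_subst g s)"
proof -
  obtain B where B: "\<And>N. trunc_norm S N g \<le> B" using g by (auto simp: converges_at_def)
  have "trunc_norm \<rho> N (mfps_subst g s) \<le> B" for N
    using trunc_norm_subst[OF s \<rho> S, of N] B[of N] by (rule order_trans)
  then show ?thesis using \<rho> by (auto simp: converges_at_def)
qed

lemma converges_at_deriv:
  fixes g :: "('a::finite, complex) mfps"
  assumes g: "converges_at r g" and r: "r > 0"
  shows "converges_at (r / 2) (mfps_deriv v g)"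
proof -
  obtain B where B: "\<And>N. trunc_norm r N g \<le> B" using g by (auto simp: converges_at_def)
  have "trunc_norm (r / 2) N (mfps_deriv v g) \<le> B / r" for N
  proof -
    have "trunc_norm (r / 2) N (mfps_deriv v g)
        \<le> (\<Sum>k | tdeg k \<le> N. norm (mfps_nth g (k(v := Suc (k v)))) * r ^ tdeg (k(v := Suc (k v))) / r)"
      unfolding trunc_norm_def
    proof (rule sum_mono)
      fix k :: "'a \<Rightarrow> nat"
      have "Suc (k v) \<le> 2 ^ tdeg k"
      proof -
        have "k v \<le> tdeg k" by (rule member_le_sum) auto
        also have "\<dots> < 2 ^ tdeg k" by (rule less_exp)
        finally show ?thesis by simp
      qed
      then have "real (Suc (k v)) \<le> 2 ^ tdeg k"
        by (metis of_nat_le_iff of_nat_numeral of_nat_power)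
      then have "real (Suc (k v)) / 2 ^ tdeg k \<le> 1" by simp
      from mult_right_mono[OF this, of "norm (mfps_nth g (k(v := Suc (k v)))) * r ^ tdeg k"]
      have "real (Suc (k v)) * norm (mfps_nth g (k(v := Suc (k v)))) * (r / 2) ^ tdeg k
          \<le> norm (mfps_nth g (k(v := Suc (k v)))) * r ^ tdeg k"
        using r by (simp add: power_divide mult_ac)
      then show "norm (mfps_nth (mfps_deriv v g) k) * (r / 2) ^ tdeg k
          \<le> norm (mfps_nth g (k(v := Suc (k v)))) * r ^ tdeg (k(v := Suc (k v))) / r"
        unfolding mfps_deriv_nth norm_mult norm_of_nat tdeg_Suc using r by simp
    qed
    also have "\<dots> = (\<Sum>k\<in>(\<lambda>k. k(v := Suc (k v))) ` {k. tdeg k \<le> N}. norm (mfps_nth g k) * r ^ tdeg k / r)"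
    proof (subst sum.reindex)
      show "inj_on (\<lambda>k. k(v := Suc (k v))) {k. tdeg k \<le> N}"
        by (rule inj_on_inverseI[where g = "\<lambda>k. k(v := k v - 1)"]) simp
    qed simp
    also have "\<dots> \<le> (\<Sum>k | tdeg k \<le> Suc N. norm (mfps_nth g k) * r ^ tdeg k / r)"
    proof (rule sum_mono2)
      show "(\<lambda>k. k(v := Suc (k v))) ` {k. tdeg k \<le> N} \<subseteq> {k. tdeg k \<le> Suc N}"
        by (auto simp only: tdeg_Suc)
    qed (use r in \<open>auto simp: finite_exponents_degree_le\<close>)
    also have "\<dots> = trunc_norm r (Suc N) g / r" by (simp add: trunc_norm_def sum_divide_distrib)
    also have "\<dots> \<le> B / r" using B r by (simp add: divide_right_mono)
    finally show ?thesis .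
  qed
  then show ?thesis using r by (auto simp: converges_at_def)
qed

lemma converges_at_geometric:
  fixes a :: "('v::finite, complex) mfps"
  assumes r: "r > 0" and M: "\<And>k. norm (mfps_nth a k) * r ^ tdeg k \<le> M"
  shows "converges_at (r / 2) a"
proof -
  have "0 \<le> norm (mfps_nth a (\<lambda>_. 0)) * r ^ tdeg (\<lambda>_ :: 'v. 0)" using r by simp
  also have "\<dots> \<le> M" by (rule M)
  finally have M0: "M \<ge> 0" .
  have "trunc_norm (r / 2) N a \<le> M * 2 ^ CARD('v)" for N
  proof -
    have "trunc_norm (r / 2) N a \<le> (\<Sum>k :: 'v \<Rightarrow> nat | tdeg k \<le> N. M * (\<Prod>v\<in>UNIV. (1 / 2) ^ k v))"
      unfolding trunc_norm_def
    proof (rule sum_mono)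
      fix k :: "'v \<Rightarrow> nat"
      show "norm (mfps_nth a k) * (r / 2) ^ tdeg k \<le> M * (\<Prod>v\<in>UNIV. (1 / 2) ^ k v)"
      proof -
        have "(\<Prod>v\<in>UNIV. (1 / 2 :: real) ^ k v) = (1 / 2) ^ tdeg k" by (simp only: power_sum)
        then show ?thesis
          using mult_right_mono[OF M[of k], of "(1/2) ^ tdeg k"] by (simp add: power_divide)
      qed
    qed
    also have "\<dots> \<le> (\<Sum>k\<in>PiE (UNIV :: 'v set) (\<lambda>_. {..N}). M * (\<Prod>v\<in>UNIV. (1 / 2) ^ k v))"
    proof (rule sum_mono2)
      show "{k :: 'v \<Rightarrow> nat. tdeg k \<le> N} \<subseteq> PiE UNIV (\<lambda>_. {..N})"
        by (auto intro: order_trans[OF member_le_sum[of _ UNIV]])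
    qed (auto intro!: finite_PiE mult_nonneg_nonneg prod_nonneg M0)
    also have "\<dots> = M * (\<Prod>v\<in>(UNIV :: 'v set). \<Sum>n\<le>N. (1 / 2) ^ n)"
      by (subst prod_sum_PiE) (simp_all add: sum_distrib_left)
    also have "\<dots> \<le> M * (\<Prod>v\<in>(UNIV :: 'v set). 2)"
    proof (intro mult_left_mono prod_mono conjI M0)
      have "(\<Sum>n\<le>N. (1 / 2 :: real) ^ n) = 2 - (1/2) ^ N"
        by (induction N) (simp_all add: field_simps)
      then show "(\<Sum>n\<le>N. (1 / 2 :: real) ^ n) \<le> 2" by simp
    qed (simp add: sum_nonneg)
    finally show ?thesis by simp
  qed
  then show ?thesis using r by (auto simp: converges_at_def)
qed

lemma converges_at_imp_converges_near_0:
  fixes a :: "('v::finite, complex) mfps"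
  assumes a: "converges_at \<rho> a" and \<rho>: "\<rho> > 0"
  shows "mfps_converges_near_0 a"
proof -
  obtain B where B: "\<And>N. trunc_norm \<rho> N a \<le> B" using a by (auto simp: converges_at_def)
  have "(\<lambda>k. mfps_nth a k * (\<Prod>v\<in>UNIV. x $ v ^ k v)) summable_on UNIV" if x: "x \<in> ball 0 \<rho>" for x :: "complex ^ 'v"
  proof -
    have "(\<lambda>k. norm (mfps_nth a k * (\<Prod>v\<in>UNIV. x $ v ^ k v))) summable_on UNIV"
    proof (rule nonneg_bdd_above_summable_on)
      have "sum (\<lambda>k. norm (mfps_nth a k * (\<Prod>v\<in>UNIV. x $ v ^ k v))) F \<le> B" if F: "finite F" for F
      proof -
        obtain N where N: "\<And>k. k \<in> F \<Longrightarrow> tdeg k \<le> N"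
          using finite_nat_set_iff_bounded_le[of "tdeg ` F"] F by auto
        have "sum (\<lambda>k. norm (mfps_nth a k * (\<Prod>v\<in>UNIV. x $ v ^ k v))) F
            \<le> (\<Sum>k\<in>F. norm (mfps_nth a k) * \<rho> ^ tdeg k)"
        proof (rule sum_mono)
          fix k :: "'v \<Rightarrow> nat"
          have "norm (x $ v) \<le> \<rho>" for v
            using x Finite_Cartesian_Product.norm_nth_le[of x v] by simp
          then have "(\<Prod>v\<in>UNIV. norm (x $ v) ^ k v) \<le> (\<Prod>v\<in>UNIV. \<rho> ^ k v)"
            by (intro prod_mono) (auto intro: power_mono)
          then show "norm (mfps_nth a k * (\<Prod>v\<in>UNIV. x $ v ^ k v)) \<le> norm (mfps_nth a k) * \<rho> ^ tdeg k"
            by (simp add: norm_mult norm_power power_sum prod_norm[symmetric] mult_left_mono)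
        qed
        also have "\<dots> \<le> trunc_norm \<rho> N a"
          unfolding trunc_norm_def using N \<rho> by (intro sum_mono2) (auto simp: finite_exponents_degree_le)
        finally show ?thesis using B order_trans by blast
      qed
      then show "bdd_above (sum (\<lambda>k. norm (mfps_nth a k * (\<Prod>v\<in>UNIV. x $ v ^ k v))) ` {F. F \<subseteq> UNIV \<and> finite F})"
        by (intro bdd_aboveI[of _ B]) auto
    qed simp
    then show ?thesis by (rule abs_summable_summable)
  qed
  moreover have "\<forall>\<^sub>F x :: complex ^ 'v in nhds 0. x \<in> ball 0 \<rho>"
    using \<rho> by (intro eventually_nhds_in_open) auto
  ultimately show ?thesis unfolding mfps_converges_near_0_def by (auto elim: eventually_mono)
qed

section \<open>The implicit function theorem with degenerate Jacobian in one variable\<close>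

text \<open>
  Taylor's formula of second order with norm bounds. The perturbation \<open>h\<close> is of size \<open>U\<close>, and
  \<open>S + \<eta>\<close> is a radius at which the outer series converges. A perturbation of size \<open>U \<le> \<eta>\<close> is
  \<open>U / \<eta>\<close> times one of size \<open>\<eta>\<close>, whence the factors \<open>U / \<eta>\<close> and \<open>(U / \<eta>)\<^sup>2\<close> for the differences
  of first and second order. The remainder is controlled up to degree \<open>N2\<close> by the coefficients of
  \<open>h\<close> up to degree \<open>N1\<close>, which may be smaller by the order of \<open>h\<close>.
\<close>

context
  fixes s h :: "'w::finite \<Rightarrow> ('v::finite, complex) mfps" and \<rho> S \<eta> U :: real and e N1 N2 :: nat
  assumes \<rho>: "\<rho> \<ge> 0" and \<eta>: "\<eta> > 0" and U: "U \<le> \<eta>" and N: "N2 \<le> N1 + e"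
    and S: "\<And>w N. trunc_norm \<rho> N (s w) \<le> S"
    and h_order: "\<And>w. mfps_order_ge e (h w)" and h: "\<And>w. trunc_norm \<rho> N1 (h w) \<le> U"
begin

lemma perturbation_bounds_nonneg: "S \<ge> 0" "U \<ge> 0"
  using S h trunc_norm_nonneg[OF \<rho>] order_trans by blast+

lemma trunc_norm_monom_at_sum:
  "trunc_norm \<rho> N1 (monom_at (\<lambda>w. s w + h w) q) \<le> (S + \<eta>) ^ tdeg q"
proof (rule trunc_norm_monom_at[OF \<rho>])
  show "trunc_norm \<rho> N1 (s w + h w) \<le> S + \<eta>" for w
    using trunc_norm_add[OF \<rho>, of N1 "s w" "h w"] S[of N1 w] h[of w] U by simp
qed

lemma monom_at_first_difference:
  "mfps_order_ge e (monom_at (\<lambda>w. s w + h w) q - monom_at s q) \<and>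
   trunc_norm \<rho> N1 (monom_at (\<lambda>w. s w + h w) q - monom_at s q) \<le> U / \<eta> * (S + \<eta>) ^ tdeg q"
proof (induction q rule: exponent_induct)
  case zero
  then show ?case using perturbation_bounds_nonneg(2) \<eta> by simp
next
  case (Suc q w)
  let ?P = "monom_at (\<lambda>w. s w + h w) q" and ?A = "monom_at s q"
  have eq: "monom_at (\<lambda>w. s w + h w) (q(w := Suc (q w))) - monom_at s (q(w := Suc (q w)))
      = s w * (?P - ?A) + ?P * h w"
    unfolding monom_at_Suc[of "\<lambda>w. s w + h w"] monom_at_Suc[of s] by (simp add: algebra_simps)
  have "trunc_norm \<rho> N1 (s w * (?P - ?A) + ?P * h w)
      \<le> trunc_norm \<rho> N1 (s w) * trunc_norm \<rho> N1 (?P - ?A) + trunc_norm \<rho> N1 ?P * trunc_norm \<rho> N1 (h w)"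
    by (intro order_trans[OF trunc_norm_add[OF \<rho>]] add_mono trunc_norm_mult_le \<rho>)
  also have "\<dots> \<le> S * (U / \<eta> * (S + \<eta>) ^ tdeg q) + (S + \<eta>) ^ tdeg q * U"
    by (intro add_mono mult_mono S h trunc_norm_monom_at_sum trunc_norm_nonneg \<rho> perturbation_bounds_nonneg(1)
        conjunct2[OF Suc]) (use perturbation_bounds_nonneg(1) \<eta> in auto)
  also have "\<dots> = U / \<eta> * (S + \<eta>) ^ Suc (tdeg q)"
    using \<eta> by (simp add: field_simps)
  finally show ?case
    unfolding eq tdeg_Suc using Suc h_order by (auto intro: mfps_order_ge_add mfps_order_ge_mult_left)
qed

lemma monom_at_second_difference:
  "mfps_order_ge (2 * e) (monom_at (\<lambda>w. s w + h w) q - monom_at s q - linear_part s h q) \<and>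
   trunc_norm \<rho> N2 (monom_at (\<lambda>w. s w + h w) q - monom_at s q - linear_part s h q)
     \<le> (U / \<eta>)\<^sup>2 * (S + \<eta>) ^ tdeg q"
proof (induction q rule: exponent_induct)
  case zero
  then show ?case using perturbation_bounds_nonneg(2) \<eta> by (simp add: linear_part_0)
next
  case (Suc q w)
  let ?D = "monom_at (\<lambda>w. s w + h w) q - monom_at s q" and ?L = "linear_part s h q"
  have eq: "monom_at (\<lambda>w. s w + h w) (q(w := Suc (q w))) - monom_at s (q(w := Suc (q w)))
      - linear_part s h (q(w := Suc (q w))) = s w * (?D - ?L) + h w * ?D"
    unfolding monom_at_Suc[of "\<lambda>w. s w + h w"] monom_at_Suc[of s] linear_part_Suc by (simp add: algebra_simps)
  have "trunc_norm \<rho> N2 (s w * (?D - ?L) + h w * ?D)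
      \<le> trunc_norm \<rho> N2 (s w) * trunc_norm \<rho> N2 (?D - ?L) + trunc_norm \<rho> N1 (h w) * trunc_norm \<rho> N1 ?D"
    by (intro order_trans[OF trunc_norm_add[OF \<rho>]] add_mono trunc_norm_mult_le \<rho>
        trunc_norm_mult[OF h_order conjunct1[OF monom_at_first_difference] N N])
  also have "\<dots> \<le> S * ((U / \<eta>)\<^sup>2 * (S + \<eta>) ^ tdeg q) + U * (U / \<eta> * (S + \<eta>) ^ tdeg q)"
    by (intro add_mono mult_mono S h trunc_norm_nonneg \<rho> perturbation_bounds_nonneg(1) perturbation_bounds_nonneg(2)
        conjunct2[OF Suc] conjunct2[OF monom_at_first_difference])
  also have "\<dots> = (U / \<eta>)\<^sup>2 * (S + \<eta>) ^ Suc (tdeg q)"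
    using \<eta> by (simp add: field_simps power2_eq_square)
  finally have "trunc_norm \<rho> N2 (s w * (?D - ?L) + h w * ?D) \<le> (U / \<eta>)\<^sup>2 * (S + \<eta>) ^ Suc (tdeg q)" .
  moreover have "mfps_order_ge (2 * e) (h w * ?D)"
    using mfps_order_ge_mult[OF h_order conjunct1[OF monom_at_first_difference]] by (simp add: mult_2)
  ultimately show ?case
    unfolding eq tdeg_Suc using Suc by (auto intro: mfps_order_ge_add mfps_order_ge_mult_left)
qed

lemma mfps_subst_second_difference:
  assumes s0: "\<And>w. mfps_nth (s w) (\<lambda>_. 0) = 0" and h0: "\<And>w. mfps_nth (h w) (\<lambda>_. 0) = 0"
    and M: "\<And>L. trunc_norm (S + \<eta>) L g \<le> M"
  defines "R \<equiv> mfps_subst g (\<lambda>w. s w + h w) - mfps_subst g s - (\<Sum>w\<in>UNIV. mfps_subst (mfps_deriv w g) s * h w)"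
  shows "mfps_order_ge (2 * e) R" and "trunc_norm \<rho> N2 R \<le> (U / \<eta>)\<^sup>2 * M"
proof -
  let ?C = "\<lambda>q. monom_at (\<lambda>w. s w + h w) q - monom_at s q - linear_part s h q"
  have R_nth: "mfps_nth R k = (\<Sum>q | tdeg q \<le> Suc L. mfps_nth g q * mfps_nth (?C q) k)" if "tdeg k \<le> L" for k L
  proof -
    have sh0: "\<And>w. mfps_nth (s w + h w) (\<lambda>_. 0) = 0" using s0 h0 by simp
    have k: "tdeg k \<le> Suc L" using that by simp
    show ?thesis
      unfolding R_def mfps_nth_diff mfps_subst_nth[OF sh0 k] mfps_subst_nth[OF s0 k] mfps_subst_linear_nth[OF s0 that]
      by (simp add: sum_subtractf right_diff_distrib)
  qed
  show "mfps_order_ge (2 * e) R"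
    unfolding mfps_order_ge_def
  proof (intro allI impI)
    fix k :: "'v \<Rightarrow> nat" assume "tdeg k < 2 * e"
    then have "mfps_nth (?C q) k = 0" for q
      using conjunct1[OF monom_at_second_difference[of q]] unfolding mfps_order_ge_def by blast
    then show "mfps_nth R k = 0" unfolding R_nth[OF order.refl] by simp
  qed
  have "trunc_norm \<rho> N2 R \<le> (U / \<eta>)\<^sup>2 * trunc_norm (S + \<eta>) (Suc N2) g"
    by (rule trunc_norm_power_sum[where c = ?C])
      (use R_nth \<rho> conjunct2[OF monom_at_second_difference] in auto)
  also have "\<dots> \<le> (U / \<eta>)\<^sup>2 * M" by (intro mult_left_mono M) simp
  finally show "trunc_norm \<rho> N2 R \<le> (U / \<eta>)\<^sup>2 * M" .
qed

end

lemma mfps_order_ge_prod_diff: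
  fixes a b :: "'i \<Rightarrow> ('v::finite, 'a::comm_ring_1) mfps"
  assumes "\<And>i. i \<in> I \<Longrightarrow> mfps_order_ge n (a i - b i)"
  shows "mfps_order_ge n (prod a I - prod b I)"
  using assms
proof (induction I rule: infinite_finite_induct)
  case (insert i I)
  have "prod a (insert i I) - prod b (insert i I) = a i * (prod a I - prod b I) + prod b I * (a i - b i)"
    using insert by (simp add: algebra_simps)
  then show ?case using insert by (auto intro!: mfps_order_ge_add mfps_order_ge_mult_left)
qed simp_all

text \<open>
  Because of this, a cut-off of the solution at degree \<open>d\<close> changes its Jacobian determinant only
  in degrees above \<open>d\<close>.
\<close>

lemma mfps_order_ge_det_diff:
  fixes A B :: "('v::finite, 'a::comm_ring_1) mfps ^ 'n::finite ^ 'n"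
  assumes "\<And>i j. mfps_order_ge n (A $ i $ j - B $ i $ j)"
  shows "mfps_order_ge n (det A - det B)"
  unfolding det_def sum_subtractf[symmetric] right_diff_distrib[symmetric]
  by (intro mfps_order_ge_sum mfps_order_ge_mult_left mfps_order_ge_prod_diff assms)

lemma mfps_order_ge_subst_diff:
  fixes s t :: "'w::finite \<Rightarrow> ('v::finite, 'a::comm_ring_1) mfps"
  assumes st: "\<And>w. mfps_order_ge n (s w - t w)"
    and s0: "\<And>w. mfps_nth (s w) (\<lambda>_. 0) = 0" and t0: "\<And>w. mfps_nth (t w) (\<lambda>_. 0) = 0"
  shows "mfps_order_ge n (mfps_subst g s - mfps_subst g t)"
proof -
  have "mfps_order_ge n (monom_at s q - monom_at t q)" for q
  proof (induction q rule: exponent_induct)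
    case (Suc q w)
    have "s w * monom_at s q - t w * monom_at t q = s w * (monom_at s q - monom_at t q) + monom_at t q * (s w - t w)"
      by (simp add: algebra_simps)
    then show ?case
      unfolding monom_at_Suc using Suc st by (auto intro!: mfps_order_ge_add mfps_order_ge_mult_left)
  qed simp
  then have eq: "mfps_nth (monom_at s q) k = mfps_nth (monom_at t q) k" if "tdeg k < n" for q k
    using that by (simp add: mfps_order_ge_def)
  show ?thesis
    unfolding mfps_order_ge_def
    by (auto simp: mfps_subst_nth[OF s0 order.refl] mfps_subst_nth[OF t0 order.refl] eq)
qed

definition cofactor :: "'a::comm_ring_1 ^ 'n::finite ^ 'n \<Rightarrow> 'n \<Rightarrow> 'n \<Rightarrow> 'a" where
  "cofactor A i j = det (\<chi> k l. if l = j then (if k = i then 1 else 0) else A $ k $ l)"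

text \<open>
  Cramer's rule over a commutative ring: the sum is the determinant of \<open>A\<close> with column \<open>j\<close>
  replaced by column \<open>l\<close>.
\<close>

lemma cofactor_expansion:
  fixes A :: "'a::comm_ring_1 ^ 'n::finite ^ 'n"
  shows "(\<Sum>i\<in>UNIV. cofactor A i j * A $ i $ l) = (if l = j then det A else 0)"
proof -
  define c where "c l = column l A" for l
  have "cofactor A i j * v = det (\<chi> k. if k = j then v *s axis i 1 else c k)" for i and v
  proof -
    have "cofactor A i j = det (transpose (\<chi> k l. if l = j then (if k = i then 1 else 0) else A $ k $ l))"
      by (simp add: cofactor_def)
    also have "transpose (\<chi> k l. if l = j then (if k = i then 1 else 0) else A $ k $ l)
        = (\<chi> k. if k = j then axis i 1 else c k)"
      by (auto simp: vec_eq_iff transpose_def axis_def c_def column_def)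
    finally show ?thesis by (simp add: det_row_mul mult.commute)
  qed
  then have "(\<Sum>i\<in>UNIV. cofactor A i j * A $ i $ l)
      = det (\<chi> k. if k = j then (\<Sum>i\<in>UNIV. A $ i $ l *s axis i 1) else c k)"
    by (simp add: det_linear_row_sum)
  also have "(\<Sum>i\<in>UNIV. A $ i $ l *s axis i 1) = c l"
    by (auto simp: vec_eq_iff c_def column_def axis_def if_distrib[of "\<lambda>x. _ * x"] cong: if_cong)
  also have "det (\<chi> k. if k = j then c l else c k) = (if l = j then det A else 0)"
  proof (cases "l = j")
    case True
    then have "(\<chi> k. if k = j then c l else c k) = transpose A"
      by (auto simp: vec_eq_iff transpose_def c_def column_def)
    then show ?thesis using True by simp
  next
    case False
    have "det (\<chi> k. if k = j then c l else c k) = 0"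
      by (rule det_identical_rows[OF False]) (use False in \<open>auto simp: row_def vec_eq_iff\<close>)
    then show ?thesis using False by simp
  qed
  finally show ?thesis .
qed

lemma converges_at_cofactor:
  "\<rho> \<ge> 0 \<Longrightarrow> (\<And>i j. converges_at \<rho> (A $ i $ j)) \<Longrightarrow> converges_at \<rho> (cofactor A i j)"
  unfolding cofactor_def by (rule converges_at_det) (auto intro: converges_at_0 converges_at_1)

lemma finite_common_bound:
  fixes F :: "'i::finite \<Rightarrow> nat \<Rightarrow> real"
  assumes "\<And>i. \<exists>B. \<forall>N. F i N \<le> B"
  obtains B where "B \<ge> 0" "\<And>i N. F i N \<le> B"
proof -
  from assms obtain b where b: "\<And>i N. F i N \<le> b i" by metis
  show thesis
  proof (rule that)
    show "(\<Sum>i\<in>UNIV. \<bar>b i\<bar>) \<ge> 0" by (simp add: sum_nonneg)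
    show "F i N \<le> (\<Sum>i\<in>UNIV. \<bar>b i\<bar>)" for i N
      using b[of i N] member_le_sum[of i UNIV "\<lambda>i. \<bar>b i\<bar>"] by simp
  qed
qed

definition mfps_truncate :: "nat \<Rightarrow> ('v::finite, 'a::zero) mfps \<Rightarrow> ('v, 'a) mfps" where
  "mfps_truncate d a = Abs_mfps (\<lambda>k. if tdeg k \<le> d then mfps_nth a k else 0)"

lemma converges_at_truncate:
  assumes "\<rho> \<ge> 0"
  shows "converges_at \<rho> (mfps_truncate d a)"
proof -
  have "trunc_norm \<rho> N (mfps_truncate d a) \<le> trunc_norm \<rho> d a" for N
  proof -
    have "trunc_norm \<rho> N (mfps_truncate d a) = (\<Sum>k | tdeg k \<le> N \<and> tdeg k \<le> d. norm (mfps_nth a k) * \<rho> ^ tdeg k)"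
      unfolding trunc_norm_def
      by (rule sum.mono_neutral_cong_right) (auto simp: mfps_truncate_def finite_exponents_degree_le)
    also have "\<dots> \<le> trunc_norm \<rho> d a"
      unfolding trunc_norm_def using assms by (intro sum_mono2) (auto simp: finite_exponents_degree_le)
    finally show ?thesis .
  qed
  then show ?thesis using assms by (auto simp: converges_at_def)
qed

lemma mfps_order_ge_diff_truncate: "mfps_order_ge (Suc d) (a - mfps_truncate d a)"
  for a :: "('v::finite, 'a::comm_ring_1) mfps"
  by (simp add: mfps_order_ge_def mfps_truncate_def)

lemma trunc_norm_unit: "trunc_norm \<rho> N (a :: (unit, complex) mfps) = (\<Sum>n\<le>N. norm (mfps_nth a (\<lambda>_. n)) * \<rho> ^ n)"
  unfolding trunc_norm_def
  by (rule sum.reindex_bij_witness[of _ "\<lambda>n _. n" "\<lambda>k. k ()"]) (auto simp: UNIV_unit)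

lemma trunc_norm_leading_term:
  fixes a :: "(unit, complex) mfps"
  assumes "\<rho> \<ge> 0"
  shows "norm c * \<rho> ^ d * trunc_norm \<rho> N a
    \<le> trunc_norm \<rho> (N + d) (Abs_mfps (\<lambda>k. if k = (\<lambda>_. d) then c else 0) * a)"
proof -
  define T where "T = Abs_mfps (\<lambda>k :: unit \<Rightarrow> nat. if k = (\<lambda>_. d) then c else 0)"
  have T: "mfps_nth (T * a) (\<lambda>_. n + d) = c * mfps_nth a (\<lambda>_. n)" for n
  proof -
    have "mfps_nth (T * a) (\<lambda>_. n + d)
        = (\<Sum>p\<in>exp_splits (\<lambda>_ :: unit. n + d). if p = (\<lambda>_. d, \<lambda>_. n) then c * mfps_nth a (\<lambda>_. n) else 0)"
      unfolding mfps_nth_mult by (rule sum.cong) (auto simp: T_def exp_splits_def fun_eq_iff split: if_splits)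
    also have "\<dots> = c * mfps_nth a (\<lambda>_. n)"
      by (subst sum.delta[OF finite_exp_splits]) (auto simp: exp_splits_def)
    finally show ?thesis .
  qed
  have "norm c * \<rho> ^ d * trunc_norm \<rho> N a = (\<Sum>n\<le>N. norm (mfps_nth (T * a) (\<lambda>_. n + d)) * \<rho> ^ (n + d))"
    by (simp add: trunc_norm_unit T norm_mult sum_distrib_left power_add mult_ac)
  also have "\<dots> = (\<Sum>n\<in>(\<lambda>n. n + d) ` {..N}. norm (mfps_nth (T * a) (\<lambda>_. n)) * \<rho> ^ n)"
    by (simp add: sum.reindex)
  also have "\<dots> \<le> trunc_norm \<rho> (N + d) (T * a)"
    unfolding trunc_norm_unit using assms by (intro sum_mono2) auto
  finally show ?thesis by (simp add: T_def)
qed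

lemma mult_divide_plus_1_le: "K * (x / (K + 1)) \<le> x" if "0 \<le> K" "0 \<le> x" for K x :: real
  using that by (simp add: divide_le_eq distrib_left mult.commute)

text \<open>
  The induction shows that the truncated norms of the tail \<open>h\<close> stay below \<open>\<rho>^d \<tau>\<close>. In the
  Newton equation everything is of size \<open>\<rho>^(2d)\<close>: the convergent part, whose order is at least
  \<open>2 d + 1\<close>, contributes a further factor \<open>\<rho>\<close>, the quadratic part a factor \<open>K \<tau>\<^sup>2\<close>, and both have
  to be compared with \<open>\<bar>\<delta>\<bar> \<tau>\<close>. So the bound is reproduced if first \<open>\<tau>\<close> and then \<open>\<rho>\<close> is
  chosen small. The error \<open>E\<close> in the determinant contributes a factor \<open>\<rho> \<tau>\<close>. The first part of
  the sum type carries the given convergent series, the second part the unknowns.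
\<close>

theorem formal_curve_converges:
  fixes G :: "'n::finite \<Rightarrow> ('m::finite + 'n, complex) mfps" and s :: "'m + 'n \<Rightarrow> (unit, complex) mfps"
  assumes r: "r > 0" and G: "\<And>a. converges_at r (G a)"
    and s0: "\<And>w. mfps_nth (s w) (\<lambda>_. 0) = 0"
    and x: "\<And>i. converges_at r (s (Inl i))"
    and sol: "\<And>a. mfps_subst (G a) s = 0"
    and det: "det (\<chi> a b. mfps_subst (mfps_deriv (Inr b) (G a)) s) \<noteq> 0"
  obtains \<rho> where "\<rho> > 0" "\<And>c. converges_at \<rho> (s (Inr c))"
proof -
  define \<Delta> where "\<Delta> = det (\<chi> a b. mfps_subst (mfps_deriv (Inr b) (G a)) s)"
  have "\<exists>n. mfps_nth \<Delta> (\<lambda>_. n) \<noteq> 0"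
  proof (rule ccontr)
    assume "\<not> ?thesis"
    moreover have "k = (\<lambda>_. k ())" for k :: "unit \<Rightarrow> nat" by (simp add: fun_eq_iff)
    ultimately have "\<Delta> = 0" by (intro mfps_eqI) (metis mfps_nth_0)
    then show False using det by (simp add: \<Delta>_def)
  qed
  define d where "d = (LEAST n. mfps_nth \<Delta> (\<lambda>_. n) \<noteq> 0)"
  define \<delta> where "\<delta> = mfps_nth \<Delta> (\<lambda>_. d)"
  have \<delta>: "\<delta> \<noteq> 0" unfolding \<delta>_def d_def using \<open>\<exists>n. _\<close> by (rule LeastI_ex)
  have \<Delta>_low: "mfps_nth \<Delta> (\<lambda>_. n) = 0" if "n < d" for n
    using not_less_Least[of n "\<lambda>n. mfps_nth \<Delta> (\<lambda>_. n) \<noteq> 0"] that by (auto simp: d_def)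

  define s' where "s' w = (case w of Inl i \<Rightarrow> s (Inl i) | Inr c \<Rightarrow> mfps_truncate d (s (Inr c)))" for w
  define h where "h w = s w - s' w" for w
  have s_eq: "(\<lambda>w. s' w + h w) = s" by (simp add: h_def)
  have h_Inl: "h (Inl i) = 0" for i by (simp add: h_def s'_def)
  have h_order: "mfps_order_ge (Suc d) (h w)" for w
    by (cases w) (simp_all add: h_def s'_def mfps_order_ge_diff_truncate)
  have s'0: "mfps_nth (s' w) (\<lambda>_. 0) = 0" for w
    by (cases w) (simp_all add: s'_def s0 mfps_truncate_def)
  have h0: "mfps_nth (h w) (\<lambda>_. 0) = 0" for w by (simp add: h_def s0 s'0)

  define J where "J = (\<chi> a b. mfps_subst (mfps_deriv (Inr b) (G a)) s')"
  \<comment> \<open>The determinant after the cut-off is the leading term \<open>\<delta> t^d\<close> plus an error of higher order.\<close>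
  define T :: "(unit, complex) mfps" where "T = Abs_mfps (\<lambda>k. if k = (\<lambda>_. d) then \<delta> else 0)"
  define E where "E = det J - T"
  have "mfps_order_ge (Suc d) (\<Delta> - det J)"
    unfolding \<Delta>_def J_def
    by (intro mfps_order_ge_det_diff, simp, intro mfps_order_ge_subst_diff s0 s'0)
      (use h_order in \<open>simp add: h_def\<close>)
  moreover have "mfps_order_ge (Suc d) (\<Delta> - T)"
    unfolding mfps_order_ge_def
  proof (intro allI impI)
    fix k :: "unit \<Rightarrow> nat" assume "tdeg k < Suc d"
    moreover obtain n where k: "k = (\<lambda>_. n)" by (metis (full_types) unit.exhaust ext)
    ultimately have "n < d \<or> n = d" by auto
    then show "mfps_nth (\<Delta> - T) k = 0"
      by (auto simp: k T_def \<delta>_def \<Delta>_low fun_eq_iff)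
  qed
  ultimately have "mfps_order_ge (Suc d) ((\<Delta> - T) - (\<Delta> - det J))"
    by (intro mfps_order_ge_diff[of _ "\<Delta> - T" "\<Delta> - det J"])
  then have E_order: "mfps_order_ge (Suc d) E" by (simp add: E_def)
  have T_order: "mfps_order_ge d T"
    by (auto simp: mfps_order_ge_def T_def UNIV_unit)

  define R where "R a = mfps_subst (G a) s - mfps_subst (G a) s'
      - (\<Sum>w\<in>UNIV. mfps_subst (mfps_deriv w (G a)) s' * h w)" for a
  define V where "V c = - (\<Sum>a\<in>UNIV. cofactor J a c * mfps_subst (G a) s')" for c
  \<comment> \<open>\<open>V\<close> collects what is known to converge, \<open>Q\<close> what is quadratic in \<open>h\<close>.\<close>
  define Q where "Q c = (\<Sum>a\<in>UNIV. cofactor J a c * R a)" for c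
  \<comment> \<open>Cramer's rule applied to Taylor's formula for \<open>G a\<close>, which vanishes at \<open>s\<close>.\<close>
  have newton: "T * h (Inr c) = V c - Q c - E * h (Inr c)" for c
  proof -
    have R: "(\<Sum>b\<in>UNIV. J $ a $ b * h (Inr b)) = - mfps_subst (G a) s' - R a" for a
    proof -
      have "(\<Sum>w\<in>UNIV <+> UNIV. mfps_subst (mfps_deriv w (G a)) s' * h w)
          = (\<Sum>b\<in>UNIV. J $ a $ b * h (Inr b))"
        by (subst sum.Plus) (simp_all add: h_Inl J_def)
      then show ?thesis by (simp add: R_def sol)
    qed
    have "det J * h (Inr c) = (\<Sum>b\<in>UNIV. (if b = c then det J else 0) * h (Inr b))"
      by (simp add: if_distrib[of "\<lambda>x. x * _"] cong: if_cong)
    also have "\<dots> = (\<Sum>b\<in>UNIV. (\<Sum>a\<in>UNIV. cofactor J a c * J $ a $ b) * h (Inr b))"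
      unfolding cofactor_expansion ..
    also have "\<dots> = (\<Sum>a\<in>UNIV. cofactor J a c * (\<Sum>b\<in>UNIV. J $ a $ b * h (Inr b)))"
      unfolding sum_distrib_right sum_distrib_left by (subst sum.swap) (simp add: mult.assoc)
    also have "\<dots> = V c - Q c"
      unfolding R by (simp add: V_def Q_def right_diff_distrib sum_subtractf sum_negf)
    finally show ?thesis by (simp add: E_def algebra_simps)
  qed

  have s'_conv: "converges_at r (s' w)" for w
    using r by (cases w) (auto simp: s'_def x intro: converges_at_truncate)
  obtain B1 where B1: "B1 \<ge> 0" "\<And>w N. trunc_norm r N (s' w) \<le> B1"
    using finite_common_bound[where F = "\<lambda>w N. trunc_norm r N (s' w)"] s'_conv
    unfolding converges_at_def by blast
  \<comment> \<open>The cut-off series have no constant term, so at this radius their norms are at most \<open>r / 2\<close>.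
    The other half of \<open>r\<close> is left for the perturbation.\<close>
  define \<rho>0 where "\<rho>0 = min 1 (min r (r * (r / 2 / (B1 + 1))))"
  have \<rho>0: "\<rho>0 > 0" "\<rho>0 \<le> 1" "\<rho>0 \<le> r" using r B1(1) by (auto simp: \<rho>0_def)
  have s'_bound: "trunc_norm \<rho> N (s' w) \<le> r / 2" if "0 \<le> \<rho>" "\<rho> \<le> \<rho>0" for \<rho> N w
  proof -
    have "mfps_order_ge 1 (s' w)"
      unfolding mfps_order_ge_def
    proof (intro allI impI)
      fix k :: "unit \<Rightarrow> nat" assume "tdeg k < 1"
      then have "k = (\<lambda>_. 0)" using tdeg_eq_0[of k] by linarith
      then show "mfps_nth (s' w) k = 0" by (simp add: s'0)
    qed
    from trunc_norm_order[OF this that(1), of r N]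
    have "trunc_norm \<rho> N (s' w) \<le> \<rho> / r * trunc_norm r N (s' w)"
      using that \<rho>0 r by simp
    also have "\<dots> \<le> \<rho> / r * B1" using that r by (intro mult_left_mono B1) auto
    also have "\<dots> \<le> (r * (r / 2 / (B1 + 1))) / r * B1"
      using that r B1(1) by (intro mult_right_mono divide_right_mono) (auto simp: \<rho>0_def)
    also have "\<dots> = B1 * (r / 2 / (B1 + 1))" using r by simp
    also have "\<dots> \<le> r / 2" using r B1(1) by (intro mult_divide_plus_1_le) auto
    finally show ?thesis .
  qed
  have J_conv: "converges_at \<rho>0 (J $ a $ b)" for a b
    unfolding J_def using converges_at_subst[OF s'0 _ s'_bound converges_at_deriv[OF G r]] \<rho>0 by simp
  have G'_conv: "converges_at \<rho>0 (mfps_subst (G a) s')" for a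
  proof (rule converges_at_subst[OF s'0 _ s'_bound])
    show "converges_at (r / 2) (G a)" by (rule converges_at_mono[OF G]) (use r in auto)
  qed (use \<rho>0 in auto)
  have cof_conv: "converges_at \<rho>0 (cofactor J a c)" for a c
    using converges_at_cofactor[OF _ J_conv] \<rho>0 by simp
  have V_conv: "converges_at \<rho>0 (V c)" for c
    unfolding V_def using \<rho>0 by (intro converges_at_uminus converges_at_sum converges_at_mult cof_conv G'_conv) simp
  have E_conv: "converges_at \<rho>0 E"
  proof -
    have "T = mfps_truncate d T"
      by (rule mfps_eqI) (auto simp: T_def mfps_truncate_def UNIV_unit)
    then have "converges_at \<rho>0 T" using converges_at_truncate[of \<rho>0 d T] \<rho>0 by simp
    then show ?thesis
      unfolding E_def using converges_at_det[OF _ J_conv] \<rho>0 by (intro converges_at_diff) auto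
  qed
  obtain BC where BC: "BC \<ge> 0" "\<And>i N. trunc_norm \<rho>0 N (cofactor J (fst i) (snd i)) \<le> BC"
  proof -
    have "\<exists>B. \<forall>N. trunc_norm \<rho>0 N (cofactor J (fst i) (snd i)) \<le> B" for i
      using cof_conv by (simp add: converges_at_def)
    then show ?thesis by (rule finite_common_bound) (rule that)
  qed
  obtain BV where BV: "BV \<ge> 0" "\<And>c N. trunc_norm \<rho>0 N (V c) \<le> BV"
  proof -
    have "\<exists>B. \<forall>N. trunc_norm \<rho>0 N (V c) \<le> B" for c using V_conv by (simp add: converges_at_def)
    then show ?thesis by (rule finite_common_bound) (rule that)
  qed
  obtain M where M: "M \<ge> 0" "\<And>a N. trunc_norm r N (G a) \<le> M"
  proof -
    have "\<exists>B. \<forall>N. trunc_norm r N (G c) \<le> B" for c using G by (simp add: converges_at_def)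
    then show ?thesis by (rule finite_common_bound) (rule that)
  qed
  obtain BE where BE: "BE \<ge> 0" "\<And>N. trunc_norm \<rho>0 N E \<le> BE"
  proof -
    obtain B where B: "\<And>N. trunc_norm \<rho>0 N E \<le> B" using E_conv by (auto simp: converges_at_def)
    have "0 \<le> B" using trunc_norm_nonneg[of \<rho>0 0 E] B[of 0] \<rho>0 by linarith
    then show ?thesis using B by (rule that)
  qed

  have R_order: "mfps_order_ge (2 * Suc d) (R a)"
    and R_bound: "trunc_norm \<rho> N2 (R a) \<le> (U / (r / 2))\<^sup>2 * M"
    if "0 \<le> \<rho>" "\<rho> \<le> \<rho>0" "U \<le> r / 2" "N2 \<le> N1 + Suc d" "\<And>w. trunc_norm \<rho> N1 (h w) \<le> U"
    for a \<rho> U N1 N2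
    using mfps_subst_second_difference[where s = s' and h = h and S = "r / 2" and \<eta> = "r / 2" and g = "G a" and M = M,
        OF that(1) _ that(3,4) s'_bound[OF that(1,2)] h_order that(5) s'0 h0]
      r M(2) by (simp_all add: R_def s_eq)
  \<comment> \<open>The order of \<open>V\<close> is read off from the Newton equation, whose other terms have at least
    that order.\<close>
  have V_order: "mfps_order_ge (Suc (2 * d)) (V c)" for c
  proof -
    have "mfps_order_ge (2 * Suc d) (R a)" for a
    proof (rule R_order[where \<rho> = 0 and U = 0 and ?N1.0 = 0 and ?N2.0 = 0])
      show "trunc_norm 0 0 (h w) \<le> 0" for w
        using h0[of w] by (simp add: trunc_norm_unit)
    qed (use \<rho>0 r in auto)
    then have "mfps_order_ge (2 * Suc d) (Q c)"
      unfolding Q_def by (intro mfps_order_ge_sum mfps_order_ge_mult_left)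
    moreover have "mfps_order_ge (Suc d + Suc d) (E * h (Inr c))"
      by (rule mfps_order_ge_mult[OF E_order h_order])
    moreover have "mfps_order_ge (d + Suc d) (T * h (Inr c))"
      by (rule mfps_order_ge_mult[OF T_order h_order])
    moreover have "V c = T * h (Inr c) + (Q c + E * h (Inr c))" by (simp add: newton)
    ultimately show ?thesis
      by (auto intro!: mfps_order_ge_add intro: mfps_order_ge_mono)
  qed

  define K where "K = real CARD('n) * BC * M / (r / 2)\<^sup>2"
  have K: "K \<ge> 0" using BC M by (simp add: K_def)
  define BV' where "BV' = BV / \<rho>0 ^ Suc (2 * d)"
  define BE' where "BE' = BE / \<rho>0 ^ Suc d"
  have BV': "BV' \<ge> 0" and BE': "BE' \<ge> 0" using BV BE \<rho>0 by (simp_all add: BV'_def BE'_def)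
  define \<tau> where "\<tau> = min (r / 2) (norm \<delta> / 3 / (K + 1))"
  have \<tau>: "\<tau> > 0" using r \<delta> K by (simp add: \<tau>_def)
  have \<tau>_r: "\<tau> \<le> r / 2" unfolding \<tau>_def by (rule min.cobounded1)
  have \<tau>_K: "K * \<tau> \<le> norm \<delta> / 3"
  proof -
    have "K * \<tau> \<le> K * (norm \<delta> / 3 / (K + 1))" using K by (intro mult_left_mono) (auto simp: \<tau>_def)
    also have "\<dots> \<le> norm \<delta> / 3" using K by (intro mult_divide_plus_1_le) auto
    finally show ?thesis .
  qed
  define \<rho> where "\<rho> = min \<rho>0 (min (norm \<delta> * \<tau> / 3 / (BV' + 1)) (norm \<delta> / 3 / (BE' + 1)))"
  have \<rho>: "\<rho> > 0" "\<rho> \<le> \<rho>0" "\<rho> \<le> 1" using \<rho>0 \<delta> \<tau> BV' BE' by (auto simp: \<rho>_def)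
  have \<rho>_V: "BV' * \<rho> \<le> norm \<delta> * \<tau> / 3"
  proof -
    have "BV' * \<rho> \<le> BV' * (norm \<delta> * \<tau> / 3 / (BV' + 1))" using BV' by (intro mult_left_mono) (auto simp: \<rho>_def)
    also have "\<dots> \<le> norm \<delta> * \<tau> / 3" using BV' \<tau> by (intro mult_divide_plus_1_le) auto
    finally show ?thesis .
  qed
  have \<rho>_E: "BE' * \<rho> \<le> norm \<delta> / 3"
  proof -
    have "BE' * \<rho> \<le> BE' * (norm \<delta> / 3 / (BE' + 1))" using BE' by (intro mult_left_mono) (auto simp: \<rho>_def)
    also have "\<dots> \<le> norm \<delta> / 3" using BE' by (intro mult_divide_plus_1_le) auto
    finally show ?thesis .
  qed
  have \<rho>_nonneg: "0 \<le> \<rho>" using \<rho> by simp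

  have power_2d: "\<rho> ^ (2 * d) = \<rho> ^ d * \<rho> ^ d" by (simp add: mult_2 power_add)
  define U where "U = \<rho> ^ d * \<tau>"
  have U: "0 \<le> U" "U \<le> r / 2"
  proof -
    show "0 \<le> U" using \<rho> \<tau> by (simp add: U_def)
    have "\<rho> ^ d * \<tau> \<le> 1 * \<tau>" using \<rho> \<tau> by (intro mult_right_mono power_le_one) auto
    then show "U \<le> r / 2" using \<tau>_r by (simp add: U_def)
  qed
  have h_bound: "trunc_norm \<rho> N (h w) \<le> U" for N w
  proof (induction N arbitrary: w)
    case 0
    then show ?case using U h0[of w] by (simp add: trunc_norm_unit)
  next
    case (Suc N)
    show ?case
    proof (cases w)
      case (Inl i)
      then show ?thesis using U by (simp add: h_Inl)
    next
      case (Inr c)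
      have V: "trunc_norm \<rho> (Suc N + d) (V c) \<le> \<rho> ^ (2 * d) * (BV' * \<rho>)"
      proof -
        have "trunc_norm \<rho> (Suc N + d) (V c) \<le> (\<rho> / \<rho>0) ^ Suc (2 * d) * trunc_norm \<rho>0 (Suc N + d) (V c)"
          using \<rho> \<rho>0 by (intro trunc_norm_order V_order) auto
        also have "\<dots> \<le> (\<rho> / \<rho>0) ^ Suc (2 * d) * BV"
          using \<rho> \<rho>0 by (intro mult_left_mono BV) auto
        finally show ?thesis by (simp add: BV'_def power_divide mult_ac)
      qed
      have Q: "trunc_norm \<rho> (Suc N + d) (Q c) \<le> \<rho> ^ (2 * d) * (K * \<tau> * \<tau>)"
      proof -
        have "trunc_norm \<rho> (Suc N + d) (Q c) \<le> (\<Sum>a\<in>UNIV. trunc_norm \<rho> (Suc N + d) (cofactor J a c * R a))"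
          unfolding Q_def by (rule trunc_norm_sum[OF \<rho>_nonneg])
        also have "\<dots> \<le> (\<Sum>a\<in>(UNIV :: 'n set). BC * ((U / (r / 2))\<^sup>2 * M))"
        proof (rule sum_mono)
          fix a
          have "trunc_norm \<rho> (Suc N + d) (cofactor J a c) \<le> BC"
            using trunc_norm_order[of 0 "cofactor J a c" \<rho> \<rho>0 "Suc N + d"] BC(2)[of "Suc N + d" "(a, c)"] \<rho> \<rho>0 by simp
          then show "trunc_norm \<rho> (Suc N + d) (cofactor J a c * R a) \<le> BC * ((U / (r / 2))\<^sup>2 * M)"
            by (intro order_trans[OF trunc_norm_mult_le] mult_mono R_bound[of \<rho> U "Suc N + d" N] Suc trunc_norm_nonneg)
              (use \<rho> U BC in auto)
        qed
        also have "\<dots> = \<rho> ^ (2 * d) * (K * \<tau> * \<tau>)"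
          by (simp add: K_def U_def power_divide power_mult_distrib power_mult[symmetric] mult_ac power2_eq_square[of \<tau>])
        finally show ?thesis .
      qed
      have E: "trunc_norm \<rho> (Suc N + d) (E * h (Inr c)) \<le> \<rho> ^ (2 * d) * (BE' * \<rho> * \<tau>)"
      proof -
        have "trunc_norm \<rho> (Suc N + d) (E * h (Inr c)) \<le> trunc_norm \<rho> N E * trunc_norm \<rho> N (h (Inr c))"
          by (rule trunc_norm_mult[OF E_order h_order]) (use \<rho> in auto)
        also have "\<dots> \<le> ((\<rho> / \<rho>0) ^ Suc d * BE) * U"
        proof (intro mult_mono Suc)
          have "trunc_norm \<rho> N E \<le> (\<rho> / \<rho>0) ^ Suc d * trunc_norm \<rho>0 N E"
            using \<rho> \<rho>0 by (intro trunc_norm_order E_order) auto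
          also have "\<dots> \<le> (\<rho> / \<rho>0) ^ Suc d * BE"
            using \<rho> \<rho>0 by (intro mult_left_mono BE) auto
          finally show "trunc_norm \<rho> N E \<le> (\<rho> / \<rho>0) ^ Suc d * BE" .
        qed (use \<rho> \<rho>0 BE in \<open>auto intro: trunc_norm_nonneg\<close>)
        also have "\<dots> = \<rho> ^ (2 * d) * (BE' * \<rho> * \<tau>)"
          unfolding power_2d by (simp add: BE'_def U_def power_divide mult_ac)
        finally show ?thesis .
      qed
      have "norm \<delta> * \<rho> ^ d * trunc_norm \<rho> (Suc N) (h (Inr c)) \<le> trunc_norm \<rho> (Suc N + d) (T * h (Inr c))"
        unfolding T_def by (rule trunc_norm_leading_term[OF \<rho>_nonneg])
      also have "\<dots> \<le> trunc_norm \<rho> (Suc N + d) (V c) + trunc_norm \<rho> (Suc N + d) (Q c)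
          + trunc_norm \<rho> (Suc N + d) (E * h (Inr c))"
        unfolding newton
        using trunc_norm_diff[OF \<rho>_nonneg, of "Suc N + d" "V c - Q c" "E * h (Inr c)"]
          trunc_norm_diff[OF \<rho>_nonneg, of "Suc N + d" "V c" "Q c"] by linarith
      also have "\<dots> \<le> \<rho> ^ (2 * d) * (BV' * \<rho> + K * \<tau> * \<tau> + BE' * \<rho> * \<tau>)"
        using V Q E by (simp add: distrib_left)
      also have "\<dots> \<le> \<rho> ^ (2 * d) * (norm \<delta> * \<tau> / 3 + norm \<delta> / 3 * \<tau> + norm \<delta> / 3 * \<tau>)"
        using \<rho> \<tau> by (intro mult_left_mono add_mono mult_right_mono \<rho>_V \<rho>_E \<tau>_K) auto
      also have "\<dots> = norm \<delta> * \<rho> ^ d * U"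
        unfolding power_2d by (simp add: U_def field_simps)
      finally show ?thesis using \<delta> \<rho> Inr by simp
    qed
  qed
  show thesis
  proof (rule that[OF \<rho>(1)])
    fix c
    have "converges_at \<rho> (h (Inr c))" using h_bound \<rho> by (auto simp: converges_at_def)
    moreover have "converges_at \<rho> (s' (Inr c))" using \<rho> by (simp add: s'_def converges_at_truncate)
    ultimately have "converges_at \<rho> (s' (Inr c) + h (Inr c))" by (intro converges_at_add)
    then show "converges_at \<rho> (s (Inr c))" by (simp add: h_def)
  qed
qed

section \<open>From lines to the whole space\<close>

lemma poly_Cauchy_estimate:
  fixes p :: "complex poly"
  assumes r: "r > 0" and B: "\<And>z. norm z = r \<Longrightarrow> norm (poly p z) \<le> B"
  shows "norm (coeff p i) \<le> B / r ^ i"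
proof -
  have "(deriv ^^ i) (poly p) = poly ((pderiv ^^ i) p)"
  proof (induction i)
    case (Suc i)
    have "deriv (poly q) = poly (pderiv q)" for q :: "complex poly"
      by (rule ext) (rule DERIV_imp_deriv[OF poly_DERIV])
    then show ?case by (simp add: Suc)
  qed simp
  then have "(deriv ^^ i) (poly p) 0 = fact i * coeff p i"
    by (simp add: poly_0_coeff_0 coeff_higher_pderiv pochhammer_fact)
  moreover have "norm ((deriv ^^ i) (poly p) 0) \<le> fact i * B / r ^ i"
    by (rule Cauchy_inequality)
      (use r B in \<open>auto intro!: continuous_intros holomorphic_on_subset[of _ UNIV] simp: holomorphic_on_open\<close>,
       metis poly_DERIV)
  ultimately have "fact i * norm (coeff p i) \<le> fact i * (B / r ^ i)"
    by (simp add: norm_mult)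
  then show ?thesis by (rule mult_left_le_imp_le) simp
qed

text \<open>
  A Bernstein-type inequality: Cauchy's inequality at \<open>z0\<close> bounds the polynomial on the unit
  circle, at the cost of a factor that is exponential in the degree, and Cauchy's inequality at
  \<open>0\<close> then bounds the coefficients. An exponential loss is affordable because it only changes the
  radius of convergence.
\<close>

lemma poly_coeff_bound_from_disc:
  fixes p :: "complex poly"
  assumes r: "0 < r" "r \<le> 1" and N: "degree p \<le> N"
    and B: "\<And>z. norm (z - z0) \<le> r \<Longrightarrow> norm (poly p z) \<le> B"
  shows "norm (coeff p j) \<le> B * (2 * (1 + norm z0) / r) ^ N"
proof -
  define q where "q = pcompose p [:z0, 1:]"
  define K where "K = (1 + norm z0) / r"
  have K: "K \<ge> 1" using r norm_ge_zero[of z0] by (simp add: K_def le_divide_eq del: norm_ge_zero)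
  have B0: "B \<ge> 0" using order_trans[OF norm_ge_zero B[of z0]] r by simp
  have q: "norm (coeff q i) \<le> B / r ^ i" for i
    by (rule poly_Cauchy_estimate[OF r(1)]) (auto simp: q_def poly_pcompose intro!: B)
  have dq: "degree q \<le> N" using N by (simp add: q_def degree_pcompose)
  have sumK: "(\<Sum>i\<le>N. K ^ i) \<le> (2 * K) ^ N"
  proof -
    have "(\<Sum>i\<le>N. K ^ i) \<le> (\<Sum>i\<le>N. K ^ N)" using K by (intro sum_mono power_increasing) auto
    also have "\<dots> = real (Suc N) * K ^ N" by simp
    also have "\<dots> \<le> 2 ^ N * K ^ N"
    proof (rule mult_right_mono)
      show "real (Suc N) \<le> 2 ^ N"
        using less_exp[of N] by (metis Suc_leI of_nat_le_iff of_nat_numeral of_nat_power)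
    qed (use K in simp)
    finally show ?thesis by (simp add: power_mult_distrib)
  qed
  have "norm (poly p z) \<le> B * (2 * K) ^ N" if z: "norm z = 1" for z
  proof -
    have "poly p z = poly q (z - z0)" by (simp add: q_def poly_pcompose)
    also have "\<dots> = (\<Sum>i\<le>N. coeff q i * (z - z0) ^ i)" 
      unfolding poly_altdef
      by (rule sum.mono_neutral_left) (use dq in \<open>auto simp: coeff_eq_0\<close>)
    finally have "norm (poly p z) \<le> (\<Sum>i\<le>N. norm (coeff q i * (z - z0) ^ i))" using norm_sum by metis
    also have "\<dots> \<le> (\<Sum>i\<le>N. B * K ^ i)"
    proof (rule sum_mono)
      fix i
      have "norm (z - z0) \<le> 1 + norm z0" using norm_triangle_ineq4[of z z0] z by simp
      then have "norm (coeff q i) * norm (z - z0) ^ i \<le> B / r ^ i * (1 + norm z0) ^ i"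
        using B0 r by (intro mult_mono q power_mono) auto
      then show "norm (coeff q i * (z - z0) ^ i) \<le> B * K ^ i"
        by (simp add: norm_mult norm_power K_def power_divide)
    qed
    also have "\<dots> \<le> B * (2 * K) ^ N"
      unfolding sum_distrib_left[symmetric] by (rule mult_left_mono[OF sumK B0])
    finally show ?thesis .
  qed
  then have "norm (coeff p j) \<le> B * (2 * K) ^ N / 1 ^ j" by (intro poly_Cauchy_estimate) auto
  then show ?thesis by (simp add: K_def)
qed

text \<open>
  Induction over the variables: as a polynomial in one of them, the given polynomial has
  coefficients that are polynomials in the others and bounded on their polydisc.
\<close>

lemma multi_poly_coeff_bound_from_polydisc:
  fixes a :: "('v \<Rightarrow> nat) \<Rightarrow> complex" and z0 :: "'v \<Rightarrow> complex"
  assumes W: "finite W" and r: "0 < r" "r \<le> 1" and R: "\<And>v. norm (z0 v) \<le> R"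
    and B: "\<And>x. (\<And>v. norm (x v - z0 v) \<le> r) \<Longrightarrow>
      norm (\<Sum>k\<in>PiE W (\<lambda>_. {..N}). a k * (\<Prod>v\<in>W. x v ^ k v)) \<le> B"
    and k: "k \<in> PiE W (\<lambda>_. {..N})"
  shows "norm (a k) \<le> B * ((2 * (1 + R) / r) ^ N) ^ card W"
  using W B k
proof (induction W arbitrary: a B k rule: finite_induct)
  case empty
  have "norm (a k) \<le> B" using empty(1)[of z0] empty(2) r by simp
  then show ?case by simp
next
  case (insert v W)
  define C where "C = (2 * (1 + R) / r) ^ N"
  have R0: "R \<ge> 0" using order_trans[OF norm_ge_zero R[of v]] .
  have C: "C \<ge> 0" using R0 r by (simp add: C_def)
  define A where "A x j = (\<Sum>k\<in>PiE W (\<lambda>_. {..N}). a (k(v := j)) * (\<Prod>v\<in>W. x v ^ k v))" for x j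
  have split: "(\<Sum>k\<in>PiE (insert v W) (\<lambda>_. {..N}). a k * (\<Prod>v\<in>insert v W. x v ^ k v))
      = (\<Sum>j\<le>N. A x j * x v ^ j)" for x
  proof -
    have inj: "inj_on (\<lambda>(j, k). k(v := j)) ({..N} \<times> PiE W (\<lambda>_. {..N}))"
      using insert.hyps(2) by (auto simp: inj_on_def PiE_def extensional_def fun_eq_iff split: if_splits)
    have "(\<Sum>k\<in>PiE (insert v W) (\<lambda>_. {..N}). a k * (\<Prod>v\<in>insert v W. x v ^ k v))
        = (\<Sum>(j, k)\<in>{..N} \<times> PiE W (\<lambda>_. {..N}). a (k(v := j)) * (\<Prod>u\<in>insert v W. x u ^ (k(v := j)) u))"
      unfolding PiE_insert_eq by (subst sum.reindex[OF inj]) (simp add: case_prod_unfold)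
    also have "\<dots> = (\<Sum>(j, k)\<in>{..N} \<times> PiE W (\<lambda>_. {..N}). a (k(v := j)) * (\<Prod>u\<in>W. x u ^ k u) * x v ^ j)"
    proof (rule sum.cong[OF refl], clarify)
      fix j k
      have "(\<Prod>u\<in>W. x u ^ (k(v := j)) u) = (\<Prod>u\<in>W. x u ^ k u)"
        using insert.hyps(2) by (intro prod.cong) auto
      then show "a (k(v := j)) * (\<Prod>u\<in>insert v W. x u ^ (k(v := j)) u)
          = a (k(v := j)) * (\<Prod>u\<in>W. x u ^ k u) * x v ^ j"
        using insert.hyps by simp
    qed
    also have "\<dots> = (\<Sum>j\<le>N. A x j * x v ^ j)"
      by (simp add: A_def sum.cartesian_product sum_distrib_right)
    finally show ?thesis .
  qed
  have A_bound: "norm (A x j) \<le> B * C" if x: "\<And>u. norm (x u - z0 u) \<le> r" and j: "j \<le> N" for x j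
  proof -
    define p where "p = (\<Sum>j\<le>N. monom (A x j) j)"
    have coeff_p: "coeff p i = (if i \<le> N then A x i else 0)" for i
      by (auto simp: p_def coeff_sum coeff_monom)
    have dp: "degree p \<le> N" by (rule degree_le) (simp add: coeff_p)
    have "norm (coeff p j) \<le> B * (2 * (1 + norm (z0 v)) / r) ^ N"
    proof (rule poly_coeff_bound_from_disc[OF r dp])
      fix z assume z: "norm (z - z0 v) \<le> r"
      have A_upd: "A (x(v := z)) i = A x i" for i
        unfolding A_def using insert.hyps(2) by (intro sum.cong refl arg_cong2[of _ _ _ _ "(*)"] prod.cong) auto
      have "poly p z = (\<Sum>j\<le>N. A (x(v := z)) j * (x(v := z)) v ^ j)"
        by (simp add: p_def poly_sum poly_monom A_upd)
      also have "norm \<dots> \<le> B"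
        unfolding split[symmetric] by (rule insert.prems(1)) (use x z in auto)
      finally show "norm (poly p z) \<le> B" .
    qed
    also have "\<dots> \<le> B * C"
    proof (rule mult_left_mono)
      show "(2 * (1 + norm (z0 v)) / r) ^ N \<le> C"
        unfolding C_def using R[of v] r by (intro power_mono divide_right_mono) auto
      have "norm (\<Sum>k\<in>PiE (insert v W) (\<lambda>_. {..N}). a k * (\<Prod>v\<in>insert v W. z0 v ^ k v)) \<le> B"
        by (rule insert.prems(1)) (use r in auto)
      then show "B \<ge> 0" using norm_ge_zero order_trans by blast
    qed
    finally show ?thesis using j by (simp add: coeff_p)
  qed
  have kv: "k v \<le> N" "k(v := undefined) \<in> PiE W (\<lambda>_. {..N})"
    using insert.prems(2) insert.hyps(2) by (auto simp: PiE_def Pi_def extensional_def)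
  have "norm (a ((k(v := undefined))(v := k v))) \<le> (B * C) * C ^ card W"
    unfolding C_def
  proof (rule insert.IH[of "\<lambda>k'. a (k'(v := k v))"])
    fix x assume "\<And>u. norm (x u - z0 u) \<le> r"
    from A_bound[OF this kv(1)]
    show "norm (\<Sum>k'\<in>PiE W (\<lambda>_. {..N}). a (k'(v := k v)) * (\<Prod>v\<in>W. x v ^ k' v)) \<le> B * (2 * (1 + R) / r) ^ N"
      by (simp add: A_def C_def)
  qed (rule kv(2))
  then show ?case using insert.hyps by (simp add: C_def mult_ac)
qed

lemma homogeneous_part_coeff_bound:
  fixes z0 :: "'v::finite \<Rightarrow> complex"
  assumes r: "0 < r"
  shows "\<exists>C\<ge>1. \<forall>a n B. (\<forall>x. (\<forall>v. norm (x v - z0 v) \<le> r) \<longrightarrow> norm (homogeneous_part a n x) \<le> B) \<longrightarrow>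
    (\<forall>k. tdeg k = n \<longrightarrow> norm (mfps_nth a k) \<le> B * C ^ n)"
proof -
  define R where "R = (\<Sum>v\<in>UNIV. norm (z0 v))"
  have R: "norm (z0 v) \<le> R" for v unfolding R_def by (rule member_le_sum) auto
  define r' where "r' = min r 1"
  have r': "0 < r'" "r' \<le> 1" "r' \<le> r" using r by (auto simp: r'_def)
  define D where "D = 2 * (1 + R) / r'"
  have "R \<ge> 0" by (simp add: R_def sum_nonneg)
  then have D: "D \<ge> 1" using r' by (simp add: D_def le_divide_eq)
  show ?thesis
  proof (intro exI[of _ "D ^ CARD('v)"] conjI allI impI)
    show "D ^ CARD('v) \<ge> 1" by (rule one_le_power[OF D])
    fix a :: "('v, complex) mfps" and n B and k :: "'v \<Rightarrow> nat"
    assume B: "\<forall>x. (\<forall>v. norm (x v - z0 v) \<le> r) \<longrightarrow> norm (homogeneous_part a n x) \<le> B" and k: "tdeg k = n"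
    \<comment> \<open>Padding with zeros turns the sum over exponents of degree \<open>n\<close> into one over a box.\<close>
    define b where "b k = (if tdeg k = n then mfps_nth a k else 0)" for k :: "'v \<Rightarrow> nat"
    have hom: "homogeneous_part a n x = (\<Sum>k\<in>PiE UNIV (\<lambda>_. {..n}). b k * (\<Prod>v\<in>UNIV. x v ^ k v))" for x
      unfolding homogeneous_part_def b_def
    proof (rule sum.mono_neutral_cong_left)
      show "finite (PiE (UNIV :: 'v set) (\<lambda>_. {..n}))" by (rule finite_PiE) auto
    qed (auto intro!: member_le_sum simp: PiE_def extensional_def)
    have "norm (b k) \<le> B * (D ^ n) ^ card (UNIV :: 'v set)"
      unfolding D_def
    proof (rule multi_poly_coeff_bound_from_polydisc[where ?z0.0 = z0])
      show "k \<in> PiE UNIV (\<lambda>_. {..n})"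
        using k by (auto simp: PiE_def extensional_def intro!: member_le_sum)
      fix x assume "\<And>v. norm (x v - z0 v) \<le> r'"
      then show "norm (\<Sum>k\<in>PiE UNIV (\<lambda>_. {..n}). b k * (\<Prod>v\<in>UNIV. x v ^ k v)) \<le> B"
        unfolding hom[symmetric] using r'(3) by (intro B[rule_format]) (meson order_trans)
    qed (use r' R in auto)
    then show "norm (mfps_nth a k) \<le> B * (D ^ CARD('v)) ^ n"
      using k by (simp add: b_def power_mult[symmetric] mult.commute)
  qed
qed

lemma vec_nth_vec_lambda [simp]: "($) (\<chi> v. x v) = x"
  by (rule ext) simp

lemma continuous_on_homogeneous_part:
  "continuous_on S (\<lambda>\<xi> :: complex ^ 'v::finite. homogeneous_part a n (($) \<xi>))"
  unfolding homogeneous_part_def by (intro continuous_intros)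

lemma polydisc_subset_ball:
  fixes \<xi> :: "complex ^ 'v::finite"
  assumes e: "e > 0" and x: "\<And>v. norm (x v - \<xi> $ v) \<le> e / CARD('v)"
  shows "(\<chi> v. x v) \<in> cball \<xi> e"
proof -
  have "norm ((\<chi> v. x v) - \<xi>) \<le> (\<Sum>v\<in>UNIV. norm (x v - \<xi> $ v))"
    unfolding norm_vec_def by (rule order_trans[OF L2_set_le_sum]) auto
  also have "\<dots> \<le> (\<Sum>v\<in>(UNIV :: 'v set). e / CARD('v))" by (rule sum_mono) (rule x)
  also have "\<dots> = e" by simp
  finally show ?thesis by (simp add: dist_norm norm_minus_commute)
qed

text \<open>
  A homogeneous part that vanishes identically has zero coefficients, by the preceding estimate
  with bound \<open>0\<close>.
\<close>

lemma homogeneous_part_nonzero_on_ball: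
  fixes a :: "('v::finite, complex) mfps"
  assumes "a \<noteq> 0"
  obtains n and \<xi> :: "complex ^ 'v" and e where "e > 0"
    "\<And>x. x \<in> cball \<xi> e \<Longrightarrow> homogeneous_part a n (($) x) \<noteq> 0"
proof -
  obtain k where k: "mfps_nth a k \<noteq> 0" using assms mfps_eqI[of a 0] by auto
  have "\<exists>\<xi> :: complex ^ 'v. homogeneous_part a (tdeg k) (($) \<xi>) \<noteq> 0"
  proof (rule ccontr)
    assume "\<not> ?thesis"
    then have z: "homogeneous_part a (tdeg k) (($) \<xi>) = 0" for \<xi> :: "complex ^ 'v" by blast
    have "homogeneous_part a (tdeg k) x = 0" for x using z[of "\<chi> v. x v"] by simp
    moreover obtain C where "\<forall>(a :: ('v, complex) mfps) n B.
        (\<forall>x. (\<forall>v. norm (x v - 0) \<le> 1) \<longrightarrow> norm (homogeneous_part a n x) \<le> B) \<longrightarrow>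
        (\<forall>k. tdeg k = n \<longrightarrow> norm (mfps_nth a k) \<le> B * C ^ n)"
      using homogeneous_part_coeff_bound[of 1 "\<lambda>_. 0"] by auto
    ultimately have "norm (mfps_nth a k) \<le> 0 * C ^ tdeg k"
      by (elim allE[of _ a] allE[of _ "tdeg k"] allE[of _ 0]) simp
    then show False using k by simp
  qed
  then obtain \<xi> :: "complex ^ 'v" where \<xi>: "homogeneous_part a (tdeg k) (($) \<xi>) \<noteq> 0" by blast
  have "open ((\<lambda>\<xi> :: complex ^ 'v. homogeneous_part a (tdeg k) (($) \<xi>)) -` (- {0}))"
    by (intro open_vimage continuous_on_homogeneous_part) auto
  then obtain e where "e > 0" "cball \<xi> e \<subseteq> (\<lambda>\<xi>. homogeneous_part a (tdeg k) (($) \<xi>)) -` (- {0})"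
    using \<xi> unfolding open_contains_cball by (metis ComplI singletonD vimageI2)
  then show thesis by (intro that[of e \<xi> "tdeg k"]) auto
qed

text \<open>
  The sets \<open>X K\<close> of directions in which the homogeneous parts of degree \<open>n\<close> are bounded by
  \<open>K^(n + 1)\<close> are closed and cover the ball, so one of them contains a ball by Baire's theorem.
  The coefficients of homogeneous polynomials that are bounded geometrically there are bounded
  geometrically too. All components are treated together since they share the radius on each line.
\<close>

theorem converges_if_converges_on_lines:
  fixes \<phi> :: "'c::finite \<Rightarrow> ('v::finite, complex) mfps" and \<xi>0 :: "complex ^ 'v"
  assumes e: "e > 0"
    and lines: "\<And>\<xi>. \<xi> \<in> cball \<xi>0 e \<Longrightarrow> \<exists>\<rho>>0. \<forall>c. converges_at \<rho> (mfps_line (($) \<xi>) (\<phi> c))"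
  shows "mfps_converges_near_0 (\<phi> c)"
proof -
  define X where "X K = {\<xi> \<in> cball \<xi>0 e. \<forall>c n. norm (homogeneous_part (\<phi> c) n (($) \<xi>)) \<le> real K ^ Suc n}" for K
  have X_closed: "closed (X K)" for K
  proof -
    have "X K = cball \<xi>0 e \<inter> (\<Inter>c. \<Inter>n. {\<xi>. norm (homogeneous_part (\<phi> c) n (($) \<xi>)) \<le> real K ^ Suc n})"
      by (auto simp: X_def)
    then show ?thesis
      by (auto intro!: closed_Int closed_INT closed_Collect_le continuous_intros continuous_on_homogeneous_part)
  qed
  have cover: "\<exists>K. \<xi> \<in> X K" if \<xi>: "\<xi> \<in> cball \<xi>0 e" for \<xi>
  proof -
    obtain \<rho> where \<rho>: "\<rho> > 0" "\<And>c. converges_at \<rho> (mfps_line (($) \<xi>) (\<phi> c))" using lines[OF \<xi>] by blast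
    have "\<exists>B. \<forall>N. trunc_norm \<rho> N (mfps_line (($) \<xi>) (\<phi> c)) \<le> B" for c
      using \<rho>(2) by (simp add: converges_at_def)
    then obtain B where B: "B \<ge> 0" "\<And>c N. trunc_norm \<rho> N (mfps_line (($) \<xi>) (\<phi> c)) \<le> B"
      by (rule finite_common_bound) (rule that)
    obtain K :: nat where K: "real K \<ge> B" "real K \<ge> 1 / \<rho>"
      using real_arch_simple[of "max B (1 / \<rho>)"] by auto
    have "norm (homogeneous_part (\<phi> c) n (($) \<xi>)) \<le> real K ^ Suc n" for c n
    proof -
      have "norm (homogeneous_part (\<phi> c) n (($) \<xi>)) * \<rho> ^ n \<le> trunc_norm \<rho> n (mfps_line (($) \<xi>) (\<phi> c))"
        unfolding trunc_norm_unit mfps_line_nth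
        by (rule member_le_sum[where f = "\<lambda>n. norm (homogeneous_part (\<phi> c) n (($) \<xi>)) * \<rho> ^ n"]) (use \<rho> in auto)
      also have "\<dots> \<le> B" by (rule B)
      finally have "norm (homogeneous_part (\<phi> c) n (($) \<xi>)) \<le> B * (1 / \<rho>) ^ n"
        using \<rho>(1) by (simp add: power_divide le_divide_eq)
      also have "\<dots> \<le> real K * real K ^ n"
        using K B(1) \<rho>(1) by (intro mult_mono power_mono) auto
      finally show ?thesis by simp
    qed
    then show ?thesis using \<xi> by (auto simp: X_def)
  qed
  have "\<exists>K. \<not> cball \<xi>0 e \<subseteq> closure (cball \<xi>0 e - X K)"
  proof (rule ccontr)
    assume neg: "\<not> ?thesis"
    have "cball \<xi>0 e \<subseteq> closure (\<Inter>K. cball \<xi>0 e - X K)"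
    proof (rule Baire)
      fix T assume "T \<in> range (\<lambda>K. cball \<xi>0 e - X K)"
      then obtain K where T: "T = cball \<xi>0 e - X K" by blast
      have "openin (top_of_set (cball \<xi>0 e)) (cball \<xi>0 e \<inter> - X K)"
        using X_closed by (intro openin_open_Int) auto
      then show "openin (top_of_set (cball \<xi>0 e)) T \<and> cball \<xi>0 e \<subseteq> closure T"
        using neg by (auto simp: T Diff_eq)
    qed auto
    moreover have empty: "(\<Inter>K. cball \<xi>0 e - X K) = {}" using cover by blast
    ultimately have "cball \<xi>0 e \<subseteq> {}" by (simp only: empty closure_empty)
    then show False using e by simp
  qed
  then obtain K \<xi>1 where \<xi>1: "\<xi>1 \<in> cball \<xi>0 e" "\<xi>1 \<notin> closure (cball \<xi>0 e - X K)" by blast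
  then obtain e1 where e1: "e1 > 0" "ball \<xi>1 e1 \<inter> (cball \<xi>0 e - X K) = {}"
    unfolding closure_approachable by (force simp: dist_commute)
  have "\<xi>1 \<in> closure (ball \<xi>0 e)" using \<xi>1(1) e by simp
  then obtain \<xi>2 where \<xi>2: "\<xi>2 \<in> ball \<xi>0 e" "dist \<xi>2 \<xi>1 < e1"
    using e1(1) unfolding closure_approachable by blast
  have "open (ball \<xi>0 e \<inter> ball \<xi>1 e1)" by auto
  moreover have "\<xi>2 \<in> ball \<xi>0 e \<inter> ball \<xi>1 e1" using \<xi>2 by (simp add: dist_commute)
  ultimately obtain e2 where e2: "e2 > 0" "cball \<xi>2 e2 \<subseteq> ball \<xi>0 e \<inter> ball \<xi>1 e1"
    unfolding open_contains_cball by blast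
  then have sub: "cball \<xi>2 e2 \<subseteq> X K" using e1(2) by fastforce
  have "e2 / CARD('v) > 0" using e2(1) by simp
  then obtain C where C: "C \<ge> 1"
    "\<forall>(a :: ('v, complex) mfps) n B. (\<forall>x. (\<forall>v. norm (x v - \<xi>2 $ v) \<le> e2 / CARD('v)) \<longrightarrow> norm (homogeneous_part a n x) \<le> B) \<longrightarrow>
      (\<forall>k. tdeg k = n \<longrightarrow> norm (mfps_nth a k) \<le> B * C ^ n)"
    using homogeneous_part_coeff_bound[of "e2 / CARD('v)" "($) \<xi>2"] by blast
  have coeff: "norm (mfps_nth (\<phi> c) k) \<le> real K ^ Suc (tdeg k) * C ^ tdeg k" for k
  proof (rule C(2)[rule_format, OF _ refl])
    fix x assume "\<And>v. norm (x v - \<xi>2 $ v) \<le> e2 / CARD('v)"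
    then have "(\<chi> v. x v) \<in> X K" using polydisc_subset_ball[OF e2(1)] sub by blast
    then have "norm (homogeneous_part (\<phi> c) (tdeg k) (($) (\<chi> v. x v))) \<le> real K ^ Suc (tdeg k)"
      by (simp add: X_def)
    then show "norm (homogeneous_part (\<phi> c) (tdeg k) x) \<le> real K ^ Suc (tdeg k)" by simp
  qed
  define r where "r = 1 / ((real K + 1) * C)"
  have r: "r > 0" using C(1) by (simp add: r_def)
  have "norm (mfps_nth (\<phi> c) k) * r ^ tdeg k \<le> real K" for k
  proof -
    have "norm (mfps_nth (\<phi> c) k) * r ^ tdeg k \<le> (real K ^ Suc (tdeg k) * C ^ tdeg k) * r ^ tdeg k"
      using r by (intro mult_right_mono coeff) auto
    also have "\<dots> = real K * (real K * C * r) ^ tdeg k" by (simp add: power_mult_distrib)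
    also have "real K * C * r = real K / (real K + 1)" using C(1) by (simp add: r_def)
    also have "real K * (real K / (real K + 1)) ^ tdeg k \<le> real K * 1"
      by (intro mult_left_mono power_le_one) (auto simp: divide_le_eq)
    finally show ?thesis by simp
  qed
  then have "converges_at (r / 2) (\<phi> c)" by (rule converges_at_geometric[OF r])
  then show ?thesis by (rule converges_at_imp_converges_near_0) (use r in simp)
qed

lemma converges_at_line_X:
  assumes "\<rho> \<ge> 0" shows "converges_at \<rho> (mfps_line \<xi> (mfps_X v))"
proof -
  have "mfps_truncate 1 (mfps_line \<xi> (mfps_X v)) = mfps_line \<xi> (mfps_X v)"
  proof (rule mfps_eqI)
    fix k :: "unit \<Rightarrow> nat"
    have "mfps_nth (mfps_line \<xi> (mfps_X v)) k = 0" if "\<not> tdeg k \<le> 1"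
      unfolding mfps_line_nth homogeneous_part_def
      by (rule sum.neutral) (use that in \<open>auto simp: mfps_X_def UNIV_unit\<close>)
    then show "mfps_nth (mfps_truncate 1 (mfps_line \<xi> (mfps_X v))) k = mfps_nth (mfps_line \<xi> (mfps_X v)) k"
      by (simp add: mfps_truncate_def)
  qed
  then show ?thesis using converges_at_truncate[OF assms, of 1 "mfps_line \<xi> (mfps_X v)"] by simp
qed

theorem theorem3:
  fixes p :: "'m::finite \<Rightarrow> nat"
    and f :: "'m \<Rightarrow> complex ^ ('m + 'n::finite) \<Rightarrow> complex ^ 'n"
    and D :: "(complex ^ ('m + 'n)) set"
    and \<phi> :: "('m, complex) mfps ^ 'n"
    and g :: "'n \<Rightarrow> complex ^ ('m + 'n) \<Rightarrow> complex"
  assumes "\<And>i. p i \<ge> 1"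
    and "open D" and "connected D" and "0 \<in> D"
    and "\<And>i. mholomorphic_on (f i) D" and "\<And>i. f i 0 = 0"
    and "\<not> completely_integrable p f D"
    and "formal_solution p f \<phi>"
    and "\<And>a. \<exists>i j c. g a = (\<lambda>z. integrability_defect p f i j z $ c)"
    and "\<And>a. \<not> (\<forall>\<^sub>F z in nhds 0. g a z = 0)"
    and "det (\<chi> a b. germ_subst (partial (Inr b) (g a)) \<phi>) \<noteq> 0"
  shows "\<forall>c. mfps_converges_near_0 (\<phi> $ c)"
proof
  note D = \<open>open D\<close> \<open>0 \<in> D\<close>
  note f = \<open>\<And>i. mholomorphic_on (f i) D\<close>
  have g_holo: "sep_holomorphic_on (g a) D" for a
    using assms(9)[of a] sep_holomorphic_on_integrability_defect[OF D(1) f] by auto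
  have g_zero: "germ_subst (g a) \<phi> = 0" for a
    using assms(9)[of a] germ_subst_integrability_defect_eq_0[OF D f assms(8)] by auto
  define \<sigma> :: "'m + 'n \<Rightarrow> ('m, complex) mfps" where "\<sigma> = case_sum mfps_X (\<lambda>c. \<phi> $ c)"
  have \<sigma>0: "mfps_nth (\<sigma> w) (\<lambda>_. 0) = 0" for w
    using assms(8) by (auto simp: \<sigma>_def formal_solution_def mfps_X_nth_0 split: sum.split)
  have germ_subst: "germ_subst h \<phi> = mfps_subst (taylor_0 h) \<sigma>" for h
    by (simp add: germ_subst_def \<sigma>_def)

  have "\<exists>r>0. converges_at r (taylor_0 (g a))" for a
  proof -
    obtain r M where "r > 0" "\<And>k. norm (mfps_nth (taylor_0 (g a)) k) * r ^ tdeg k \<le> M"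
      using taylor_0_geometric_bound[OF D g_holo[of a]] by metis
    then have "converges_at (r / 2) (taylor_0 (g a))" "r / 2 > 0"
      by (auto intro: converges_at_geometric)
    then show ?thesis by blast
  qed
  then obtain R where R: "\<And>a. R a > 0" "\<And>a. converges_at (R a) (taylor_0 (g a))" by metis
  define r where "r = Min (range R)"
  have r: "r > 0" using R(1) by (simp add: r_def)
  have G: "converges_at r (taylor_0 (g a))" for a
  proof (rule converges_at_mono[OF R(2) _ _ R(1)])
    show "r \<le> R a" unfolding r_def by (rule Min_le) auto
  qed (use r in simp)

  define \<Delta> where "\<Delta> = det (\<chi> a b. germ_subst (partial (Inr b) (g a)) \<phi>)"
  have "\<Delta> \<noteq> 0" using assms(11) by (simp add: \<Delta>_def)
  then obtain n \<xi>0 and e where e: "e > 0"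
    and ball: "\<And>\<xi> :: complex ^ 'm. \<xi> \<in> cball \<xi>0 e \<Longrightarrow> homogeneous_part \<Delta> n (($) \<xi>) \<noteq> 0"
    using homogeneous_part_nonzero_on_ball by blast
  fix c
  show "mfps_converges_near_0 (\<phi> $ c)"
  proof (rule converges_if_converges_on_lines[OF e])
    fix \<xi> :: "complex ^ 'm" assume \<xi>: "\<xi> \<in> cball \<xi>0 e"
    define s where "s w = mfps_line (($) \<xi>) (\<sigma> w)" for w
    have s_subst: "mfps_subst h s = mfps_line (($) \<xi>) (mfps_subst h \<sigma>)" for h
      unfolding s_def mfps_line_subst[OF \<sigma>0] ..
    show "\<exists>\<rho>>0. \<forall>c. converges_at \<rho> (mfps_line (($) \<xi>) (\<phi> $ c))"
    proof (rule formal_curve_converges[OF r G, where s = s])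
      show "mfps_nth (s w) (\<lambda>_. 0) = 0" for w
        unfolding s_def by (rule mfps_line_nth_0[OF \<sigma>0])
      show "converges_at r (s (Inl i))" for i
        using converges_at_line_X[OF less_imp_le[OF r]] by (simp add: s_def \<sigma>_def)
      show "mfps_subst (taylor_0 (g a)) s = 0" for a
        using g_zero[of a] by (simp add: s_subst germ_subst mfps_line_0)
      have "det (\<chi> a b. mfps_subst (mfps_deriv (Inr b) (taylor_0 (g a))) s) = mfps_line (($) \<xi>) \<Delta>"
        by (simp add: \<Delta>_def mfps_line_det s_subst germ_subst taylor_0_partial[OF D g_holo])
      moreover have "mfps_nth (mfps_line (($) \<xi>) \<Delta>) (\<lambda>_. n) \<noteq> 0"
        using ball[OF \<xi>] by (simp add: mfps_line_nth)
      ultimately show "det (\<chi> a b. mfps_subst (mfps_deriv (Inr b) (taylor_0 (g a))) s) \<noteq> 0"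
        by auto
    next
      fix \<rho> assume "\<rho> > 0" "\<And>c. converges_at \<rho> (s (Inr c))"
      then show "\<exists>\<rho>>0. \<forall>c. converges_at \<rho> (mfps_line (($) \<xi>) (\<phi> $ c))"
        by (auto simp: s_def \<sigma>_def)
    qed
  qed
qed

end
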